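(* Let $\Lambda$ and $\Omega$ be row-finite $k$-graphs without sources such that both $\Lambda^0,\Omega^0$ are finite. For each $\mathbf n\in\mathbb N^k$ let $A_{\mathbf n}\in\mathbb M_{\Lambda^0}(\mathbb N)$ and $B_{\mathbf n}\in\mathbb M_{\Omega^0}(\mathbb N)$ be given by $A_{\mathbf n}(u,v)=|u\Lambda^{\mathbf n}v|$ for $u,v\in\Lambda^0$ and $B_{\mathbf n}(x,y)=|x\Omega^{\mathbf n}y|$ for $x,y\in\Omega^0$. Then the following are equivalent. (i) There exist $R\in\mathbb M_{\Lambda^0\times\Omega^0}(\mathbb N)$, $S\in\mathbb M_{\Omega^0\times\Lambda^0}(\mathbb N)$ and $\mathbf p\in\mathbb N^k$ such that $A_{\mathbf p}=RS$, $B_{\mathbf p}=SR$, and $A_{\mathbf e_i}R=RB_{\mathbf e_i}$, $B_{\mathbf e_i}S=SA_{\mathbf e_i}$ for all $i=1,\dots,k$. (ii) There exists a group isomorphism $\phi:H_\Lambda\to H_\Omega$ such that $\phi(H_\Lambda^+)=H_\Omega^+$ and $\phi\circ\delta_i^\Lambda=\delta_i^\Omega\circ\phi$ for all $i=1,\dots,k$. (iii) The talented monoids $T_\Lambda$ and $T_\Omega$ are isomorphic as $\mathbb Z^k$-monoids. (iv) There is a $\mathbb Z[\mathbb Z^k]$-module isomorphism $\varphi:H_0^{\mathrm{gr}}(\mathcal G_\Lambda)\to H_0^{\mathrm{gr}}(\mathcal G_\Omega)$ such that $\varphi(H_0^{\mathrm{gr}}(\mathcal G_\Lambda)^+)=H_0^{\mathrm{gr}}(\mathcal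 G_\Omega)^+$. Furthermore, for isomorphisms $\phi$ as in (ii) and $\varphi$ as in (iv) which correspond to each other under the canonical identifications $\Theta_\Lambda: H_0^{\mathrm{gr}}(\mathcal G_\Lambda)\cong H_\Lambda$ and $\Theta_\Omega: H_0^{\mathrm{gr}}(\mathcal G_\Omega)\cong H_\Omega$, the isomorphism $\phi$ is pointed, i.e. preserves the order units, if and only if $\varphi([1_{\Lambda^\infty\times\{0\}}])=[1_{\Omega^\infty\times\{0\}}]$.
   Context: $\mathbb N=\{0,1,2,\dots\}$, and $\mathbf e_1,\dots,\mathbf e_k$ is the standard basis of $\mathbb N^k$. A $k$-graph is a countable small category $\Lambda$ with a functor $d:\Lambda\to\mathbb N^k$ (degree) such that whenever $d(\lambda)=\mathbf n+\mathbf m$ there are unique $\alpha,\beta$ with $d(\alpha)=\mathbf n$, $d(\beta)=\mathbf m$, $\lambda=\alpha\beta$. Range and source are $r,s$; $\lambda\mu$ is defined when $s(\lambda)=r(\mu)$. Put $\Lambda^{\mathbf n}=d^{-1}(\mathbf n)$ ($\Lambda^0$ is identified with the objects), $v\Lambda^{\mathbf n}=r^{-1}(v)\cap\Lambda^{\mathbf n}$, $u\Lambda^{\mathbf n}v=\{\lambda\in\Lambda^{\mathbf n}:r(\lambda)=u,s(\lambda)=v\}$. $\Lambda$ is row-finite without sources if $0<|v\Lambda^{\mathbf n}|<\infty$ for all $v,\mathbf n$. Dimension group: elements of $\mathbb Z\Lambda^0$ are row vectors. $H_\Lambda=(\mathbb Z\Lambda^0\times\mathbb Z^k)/\sim$,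 where $(x,\mathbf n)\sim(y,\mathbf m)$ iff $xA_{\mathbf l-\mathbf n}=yA_{\mathbf l-\mathbf m}$ for some $\mathbf l\in\mathbb Z^k$ with $\mathbf l\ge\mathbf n\vee\mathbf m$; $[x,\mathbf n]+[y,\mathbf m]=[xA_{(\mathbf n\vee\mathbf m)-\mathbf n}+yA_{(\mathbf n\vee\mathbf m)-\mathbf m},\mathbf n\vee\mathbf m]$. Positive cone $H_\Lambda^+=\{[x,\mathbf n]:x\in\mathbb N\Lambda^0\}$; order unit $[(1,1,\dots,1),0]$; automorphisms $\delta_i^\Lambda([x,\mathbf n])=[xA_{\mathbf e_i},\mathbf n]=[x,\mathbf n-\mathbf e_i]$. $H_\Omega$ is defined likewise with the $B_{\mathbf n}$. Talented monoid: $T_\Lambda$ is the commutative monoid generated by symbols $v(\mathbf n)$, $v\in\Lambda^0,\mathbf n\in\mathbb Z^k$, subject to $v(\mathbf n)=\sum_{\alpha\in v\Lambda^{\mathbf e_i}}s(\alpha)(\mathbf n+\mathbf e_i)$ for all $i$, with $\mathbb Z^k$-action ${}^{\mathbf m}v(\mathbf n)=v(\mathbf n+\mathbf m)$. Isomorphisms of $\mathbb Z^k$-monoids are monoid isomorphisms commuting with the actions. Path groupoid: $\Omega_k=\{(\mathbf p,\mathbf q)\in\mathbb N^k\times\mathbb N^k:\mathbf p\le\mathbf q\}$ is a $k$-graph with $r(\mathbf p,\mathbf q)=\mathbf p$, $s(\mathbf p,\mathbf q)=\mathbf q$, degree $\mathbf q-\mathbf p$. $\Lambda^\infty$ is the set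 of degree-preserving functors $x:\Omega_k\to\Lambda$, and $\sigma^{\mathbf p}(x)(\mathbf m,\mathbf n)=x(\mathbf m+\mathbf p,\mathbf n+\mathbf p)$. $\mathcal G_\Lambda=\{(x,\mathbf n-\mathbf m,y):x,y\in\Lambda^\infty,\ \sigma^{\mathbf n}(x)=\sigma^{\mathbf m}(y)\}$ with $r=x$, $s=y$, $(x,\mathbf n,y)(y,\mathbf m,w)=(x,\mathbf n+\mathbf m,w)$, $(x,\mathbf n,y)^{-1}=(y,-\mathbf n,x)$ and topology with basis $Z(\lambda,\mu)=\{(\lambda z,d(\lambda)-d(\mu),\mu z): z\in\Lambda^\infty,\ z(0)=s(\lambda)\}$, $s(\lambda)=s(\mu)$; it is an ample groupoid with unit space $\Lambda^\infty$ (basis $Z(\lambda)=\{\lambda z\}$). The cocycle $\tilde d(x,\mathbf n,y)=\mathbf n$ gives the skew product $\mathcal G_\Lambda\times_{\tilde d}\mathbb Z^k$ (product set and topology), with $r(g,\mathbf m)=(r(g),\mathbf m)$, $s(g,\mathbf m)=(s(g),\mathbf m+\tilde d(g))$, product $(g,\mathbf m)(h,\mathbf m+\tilde d(g))=(gh,\mathbf m)$, unit space $\Lambda^\infty\times\mathbb Z^k$, and $\mathbb Z^k$-action $\mathbf q\cdot(g,\mathbf m)=(g,\mathbf q+\mathbf m)$. Homology: for an ample groupoid $\mathcal G$, $H_0(\mathcal G)=C_c(\mathcal G^{(0)},\mathbb Z)/\operatorname{Im}\partial_1$, where $\partial_1=s_*-r_*:C_c(\mathcal G,\mathbb Z)\to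 C_c(\mathcal G^{(0)},\mathbb Z)$, $(s_*f)(u)=\sum_{s(g)=u}f(g)$, $(r_*f)(u)=\sum_{r(g)=u}f(g)$, and $H_0(\mathcal G)^+=\{[f]:f\ge0\}$. A group acting on $\mathcal G$ acts on functions by $\gamma\cdot f=f\circ\gamma^{-1}$, hence on $H_0(\mathcal G)$. $H_0^{\mathrm{gr}}(\mathcal G_\Lambda)=H_0(\mathcal G_\Lambda\times_{\tilde d}\mathbb Z^k)$ and $H_0^{\mathrm{gr}}(\mathcal G_\Lambda)^+=H_0(\mathcal G_\Lambda\times_{\tilde d}\mathbb Z^k)^+$, with the induced $\mathbb Z^k$-action. Canonical identifications: $\Theta_\Lambda:H_0^{\mathrm{gr}}(\mathcal G_\Lambda)\to H_\Lambda$ is the order isomorphism of $\mathbb Z[\mathbb Z^k]$-modules with $[1_{Z(\lambda)\times\{\mathbf n\}}]\mapsto[\epsilon_{s(\lambda)},\mathbf n+d(\lambda)]$ ($\epsilon_v$ the standard basis vector at $v$; it factors through the group completion of $T_\Lambda$ via $v(\mathbf n)\mapsto[\epsilon_v,\mathbf n]$), where $\mathbb Z^k$ acts on $H_\Lambda$ by ${}^{\mathbf m}[x,\mathbf n]=[x,\mathbf n+\mathbf m]$. $\phi$ and $\varphi$ correspond if $\phi\circ\Theta_\Lambda=\Theta_\Omega\circ\varphi$. *)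

theory Defs
  imports
    "HOL-Analysis.Analysis"
    "HOL-Algebra.Coset"
    "HOL-Algebra.FiniteProduct"
    "HOL-Library.Poly_Mapping"
    "HOL-Library.Function_Algebras"
    "HOL-Library.Multiset"
begin

section \<open>Higher-rank graphs\<close>

text \<open>
  \<open>\<nat>\<^sup>k\<close> and \<open>\<int>\<^sup>k\<close> are the function types \<open>'k \<Rightarrow> nat\<close> and \<open>'k \<Rightarrow> int\<close> over a finite index type
  \<open>'k\<close> with \<open>k = CARD('k)\<close>; sums and order are pointwise, and \<open>n \<or> m\<close> is \<open>sup n m\<close>.

  A small category is given by its arrows only: an object is identified with its identity arrow, so
  that range and source are maps from arrows to arrows. In a higher-rank graph the objects are then
  exactly the arrows of degree \<open>0\<close>.
\<close>

record 'a cat =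
  mor :: "'a set"
  rng :: "'a \<Rightarrow> 'a"
  src :: "'a \<Rightarrow> 'a"
  cmp :: "'a \<Rightarrow> 'a \<Rightarrow> 'a"

record ('a, 'k) kgr = "'a cat" +
  deg :: "'a \<Rightarrow> 'k \<Rightarrow> nat"

locale small_category =
  fixes C :: "('a, 'z) cat_scheme"
  assumes rng_mor: "l \<in> mor C \<Longrightarrow> rng C l \<in> mor C"
    and src_mor: "l \<in> mor C \<Longrightarrow> src C l \<in> mor C"
    and rng_rng: "l \<in> mor C \<Longrightarrow> rng C (rng C l) = rng C l"
    and src_rng: "l \<in> mor C \<Longrightarrow> src C (rng C l) = rng C l"
    and rng_src: "l \<in> mor C \<Longrightarrow> rng C (src C l) = src C l"
    and src_src: "l \<in> mor C \<Longrightarrow> src C (src C l) = src C l"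
    and cmp_mor: "\<lbrakk>l \<in> mor C; m \<in> mor C; src C l = rng C m\<rbrakk> \<Longrightarrow> cmp C l m \<in> mor C"
    and rng_cmp: "\<lbrakk>l \<in> mor C; m \<in> mor C; src C l = rng C m\<rbrakk> \<Longrightarrow> rng C (cmp C l m) = rng C l"
    and src_cmp: "\<lbrakk>l \<in> mor C; m \<in> mor C; src C l = rng C m\<rbrakk> \<Longrightarrow> src C (cmp C l m) = src C m"
    and cmp_rng: "l \<in> mor C \<Longrightarrow> cmp C (rng C l) l = l"
    and cmp_src: "l \<in> mor C \<Longrightarrow> cmp C l (src C l) = l"
    and cmp_assoc: "\<lbrakk>l \<in> mor C; m \<in> mor C; n \<in> mor C; src C l = rng C m; src C m = rng C n\<rbrakk>
          \<Longrightarrow> cmp C (cmp C l m) n = cmp C l (cmp C m n)"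

locale kgraph = small_category \<Lambda> for \<Lambda> :: "('a, 'k::finite) kgr" +
  assumes countable_mor: "countable (mor \<Lambda>)"
    and deg_rng: "l \<in> mor \<Lambda> \<Longrightarrow> deg \<Lambda> (rng \<Lambda> l) = 0"
    and deg_src: "l \<in> mor \<Lambda> \<Longrightarrow> deg \<Lambda> (src \<Lambda> l) = 0"
    and deg_cmp: "\<lbrakk>l \<in> mor \<Lambda>; m \<in> mor \<Lambda>; src \<Lambda> l = rng \<Lambda> m\<rbrakk>
          \<Longrightarrow> deg \<Lambda> (cmp \<Lambda> l m) = deg \<Lambda> l + deg \<Lambda> m"
    and factorization: "\<lbrakk>l \<in> mor \<Lambda>; deg \<Lambda> l = p + q\<rbrakk>
          \<Longrightarrow> \<exists>!(\<alpha>, \<beta>). \<alpha> \<in> mor \<Lambda> \<and> \<beta> \<in> mor \<Lambda> \<and> src \<Lambda> \<alpha> = rng \<Lambda> \<beta> \<and>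
                deg \<Lambda> \<alpha> = p \<and> deg \<Lambda> \<beta> = q \<and> l = cmp \<Lambda> \<alpha> \<beta>"

definition paths :: "('a, 'k) kgr \<Rightarrow> ('k \<Rightarrow> nat) \<Rightarrow> 'a set" where
  "paths \<Lambda> n = {l \<in> mor \<Lambda>. deg \<Lambda> l = n}"

abbreviation vertices :: "('a, 'k) kgr \<Rightarrow> 'a set" where
  "vertices \<Lambda> \<equiv> paths \<Lambda> 0"

definition paths_from :: "('a, 'k) kgr \<Rightarrow> 'a \<Rightarrow> ('k \<Rightarrow> nat) \<Rightarrow> 'a set" where
  "paths_from \<Lambda> v n = {l \<in> paths \<Lambda> n. rng \<Lambda> l = v}"

definition row_finite_no_sources :: "('a, 'k) kgr \<Rightarrow> bool" where
  "row_finite_no_sources \<Lambda> \<longleftrightarrow>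
     (\<forall>v \<in> vertices \<Lambda>. \<forall>n. finite (paths_from \<Lambda> v n) \<and> paths_from \<Lambda> v n \<noteq> {})"

definition basis_vec :: "'i \<Rightarrow> 'i \<Rightarrow> 'n::zero_neq_one" where
  "basis_vec i = (\<lambda>j. if j = i then 1 else 0)"

definition to_int :: "('k \<Rightarrow> nat) \<Rightarrow> 'k \<Rightarrow> int" where
  "to_int n = (\<lambda>i. int (n i))"

definition to_nat :: "('k \<Rightarrow> int) \<Rightarrow> 'k \<Rightarrow> nat" where
  "to_nat n = (\<lambda>i. nat (n i))"

definition adj_mat :: "('a, 'k) kgr \<Rightarrow> ('k \<Rightarrow> nat) \<Rightarrow> 'a \<Rightarrow> 'a \<Rightarrow> nat" where
  "adj_mat \<Lambda> n u v = card {l \<in> paths \<Lambda> n. rng \<Lambda> l = u \<and> src \<Lambda> l = v}"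


section \<open>Modules over the group ring of \<open>\<int>\<^sup>k\<close>\<close>

text \<open>
  Abelian groups are written multiplicatively, as in HOL-Algebra. The group ring \<open>\<int>[\<int>\<^sup>k]\<close> is the type
  \<open>('k \<Rightarrow> int) \<Rightarrow>\<^sub>0 int\<close> with its convolution product; an action of \<open>\<int>\<^sup>k\<close> on \<open>G\<close> turns \<open>G\<close> into a
  module via \<open>(\<Sum>q. r\<^sub>q q) \<cdot> c = \<Sum>q. r\<^sub>q (\<^sup>q c)\<close>.
\<close>

definition gr_smult ::
    "('c, 'm) monoid_scheme \<Rightarrow> (('k \<Rightarrow> int) \<Rightarrow> 'c \<Rightarrow> 'c) \<Rightarrow> (('k \<Rightarrow> int) \<Rightarrow>\<^sub>0 int) \<Rightarrow> 'c \<Rightarrow> 'c" where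
  "gr_smult G act r c =
     finprod G (\<lambda>q. act q c [^]\<^bsub>G\<^esub> (Poly_Mapping.lookup r q)) (Poly_Mapping.keys r)"

definition gr_module_iso ::
    "('c, 'm) monoid_scheme \<Rightarrow> (('k \<Rightarrow> int) \<Rightarrow> 'c \<Rightarrow> 'c) \<Rightarrow>
     ('d, 'n) monoid_scheme \<Rightarrow> (('k \<Rightarrow> int) \<Rightarrow> 'd \<Rightarrow> 'd) \<Rightarrow> ('c \<Rightarrow> 'd) \<Rightarrow> bool" where
  "gr_module_iso G act H act' f \<longleftrightarrow> f \<in> iso G H \<and>
     (\<forall>r. \<forall>c \<in> carrier G. f (gr_smult G act r c) = gr_smult H act' r (f c))"


section \<open>The dimension group\<close>

definition int_vecs :: "('a, 'k) kgr \<Rightarrow> ('a \<Rightarrow> int) set" where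
  "int_vecs \<Lambda> = {x. \<forall>v. v \<notin> vertices \<Lambda> \<longrightarrow> x v = 0}"

definition vec_mat :: "('a, 'k) kgr \<Rightarrow> ('a \<Rightarrow> int) \<Rightarrow> ('k \<Rightarrow> nat) \<Rightarrow> 'a \<Rightarrow> int" where
  "vec_mat \<Lambda> x n = (\<lambda>v. if v \<in> vertices \<Lambda> then \<Sum>u\<in>vertices \<Lambda>. x u * int (adj_mat \<Lambda> n u v) else 0)"

definition dim_rel :: "('a, 'k) kgr \<Rightarrow> (('a \<Rightarrow> int) \<times> ('k \<Rightarrow> int)) rel" where
  "dim_rel \<Lambda> = {((x, n), (y, m)). x \<in> int_vecs \<Lambda> \<and> y \<in> int_vecs \<Lambda> \<and>
     (\<exists>l. sup n m \<le> l \<and> vec_mat \<Lambda> x (to_nat (l - n)) = vec_mat \<Lambda> y (to_nat (l - m)))}"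

definition dim_class :: "('a, 'k) kgr \<Rightarrow> ('a \<Rightarrow> int) \<Rightarrow> ('k \<Rightarrow> int) \<Rightarrow> (('a \<Rightarrow> int) \<times> ('k \<Rightarrow> int)) set" where
  "dim_class \<Lambda> x n = dim_rel \<Lambda> `` {(x, n)}"

text \<open>
  Here and below, a map on equivalence classes given by a formula on representatives is written as
  the union of the resulting classes over all representatives; since the formula is independent of
  the representatives, that union is a single class.
\<close>

definition dim_group :: "('a, 'k) kgr \<Rightarrow> (('a \<Rightarrow> int) \<times> ('k \<Rightarrow> int)) set monoid" where
  "dim_group \<Lambda> = \<lparr>
     carrier = (int_vecs \<Lambda> \<times> UNIV) // dim_rel \<Lambda>,
     mult = (\<lambda>P Q. \<Union>(x, n)\<in>P. \<Union>(y, m)\<in>Q.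
       dim_class \<Lambda> (vec_mat \<Lambda> x (to_nat (sup n m - n)) + vec_mat \<Lambda> y (to_nat (sup n m - m))) (sup n m)),
     one = dim_class \<Lambda> 0 0\<rparr>"

definition dim_pos :: "('a, 'k) kgr \<Rightarrow> (('a \<Rightarrow> int) \<times> ('k \<Rightarrow> int)) set set" where
  "dim_pos \<Lambda> = {dim_class \<Lambda> x n |x n. x \<in> int_vecs \<Lambda> \<and> 0 \<le> x}"

definition dim_unit :: "('a, 'k) kgr \<Rightarrow> (('a \<Rightarrow> int) \<times> ('k \<Rightarrow> int)) set" where
  "dim_unit \<Lambda> = dim_class \<Lambda> (indicator (vertices \<Lambda>)) 0"

definition dim_delta ::
    "('a, 'k) kgr \<Rightarrow> 'k \<Rightarrow> (('a \<Rightarrow> int) \<times> ('k \<Rightarrow> int)) set \<Rightarrow> (('a \<Rightarrow> int) \<times> ('k \<Rightarrow> int)) set" where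
  "dim_delta \<Lambda> i P = (\<Union>(x, n)\<in>P. dim_class \<Lambda> (vec_mat \<Lambda> x (basis_vec i)) n)"

definition dim_act ::
    "('a, 'k) kgr \<Rightarrow> ('k \<Rightarrow> int) \<Rightarrow> (('a \<Rightarrow> int) \<times> ('k \<Rightarrow> int)) set \<Rightarrow> (('a \<Rightarrow> int) \<times> ('k \<Rightarrow> int)) set" where
  "dim_act \<Lambda> m P = (\<Union>(x, n)\<in>P. dim_class \<Lambda> x (n + m))"

definition dim_group_iso :: "('a, 'k) kgr \<Rightarrow> ('b, 'k) kgr \<Rightarrow>
    ((('a \<Rightarrow> int) \<times> ('k \<Rightarrow> int)) set \<Rightarrow> (('b \<Rightarrow> int) \<times> ('k \<Rightarrow> int)) set) \<Rightarrow> bool" where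
  "dim_group_iso \<Lambda> \<Omega> \<phi> \<longleftrightarrow>
     \<phi> \<in> iso (dim_group \<Lambda>) (dim_group \<Omega>) \<and>
     \<phi> ` dim_pos \<Lambda> = dim_pos \<Omega> \<and>
     (\<forall>i. \<forall>h \<in> carrier (dim_group \<Lambda>). \<phi> (dim_delta \<Lambda> i h) = dim_delta \<Omega> i (\<phi> h))"


section \<open>The talented monoid\<close>

text \<open>
  The pair \<open>(v, n)\<close> stands for the generator \<open>v(n)\<close>, finite multisets of generators form the free
  commutative monoid, and \<open>tal_cong\<close> is the congruence generated by the defining relations.
\<close>

definition tal_free :: "('a, 'k) kgr \<Rightarrow> ('a \<times> ('k \<Rightarrow> int)) multiset set" where
  "tal_free \<Lambda> = {M. set_mset M \<subseteq> vertices \<Lambda> \<times> UNIV}"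

inductive tal_cong :: "('a, 'k) kgr \<Rightarrow>
    ('a \<times> ('k \<Rightarrow> int)) multiset \<Rightarrow> ('a \<times> ('k \<Rightarrow> int)) multiset \<Rightarrow> bool" for \<Lambda> where
  gen: "v \<in> vertices \<Lambda> \<Longrightarrow> tal_cong \<Lambda> {#(v, n)#}
     (image_mset (\<lambda>\<alpha>. (src \<Lambda> \<alpha>, n + basis_vec i)) (mset_set (paths_from \<Lambda> v (basis_vec i))))"
| refl: "M \<in> tal_free \<Lambda> \<Longrightarrow> tal_cong \<Lambda> M M"
| sym: "tal_cong \<Lambda> M N \<Longrightarrow> tal_cong \<Lambda> N M"
| trans: "tal_cong \<Lambda> M N \<Longrightarrow> tal_cong \<Lambda> N P \<Longrightarrow> tal_cong \<Lambda> M P"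
| add: "tal_cong \<Lambda> M N \<Longrightarrow> tal_cong \<Lambda> M' N' \<Longrightarrow> tal_cong \<Lambda> (M + M') (N + N')"

definition tal_rel :: "('a, 'k) kgr \<Rightarrow> ('a \<times> ('k \<Rightarrow> int)) multiset rel" where
  "tal_rel \<Lambda> = {(M, N). tal_cong \<Lambda> M N}"

definition tal_monoid :: "('a, 'k) kgr \<Rightarrow> ('a \<times> ('k \<Rightarrow> int)) multiset set monoid" where
  "tal_monoid \<Lambda> = \<lparr>
     carrier = tal_free \<Lambda> // tal_rel \<Lambda>,
     mult = (\<lambda>P Q. \<Union>M\<in>P. \<Union>N\<in>Q. tal_rel \<Lambda> `` {M + N}),
     one = tal_rel \<Lambda> `` {{#}}\<rparr>"

definition tal_act ::
    "('a, 'k) kgr \<Rightarrow> ('k \<Rightarrow> int) \<Rightarrow> ('a \<times> ('k \<Rightarrow> int)) multiset set \<Rightarrow> ('a \<times> ('k \<Rightarrow> int)) multiset set" where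
  "tal_act \<Lambda> m P = (\<Union>M\<in>P. tal_rel \<Lambda> `` {image_mset (\<lambda>(v, n). (v, n + m)) M})"

definition zk_monoid_iso ::
    "('c, 'm) monoid_scheme \<Rightarrow> (('k \<Rightarrow> int) \<Rightarrow> 'c \<Rightarrow> 'c) \<Rightarrow>
     ('d, 'n) monoid_scheme \<Rightarrow> (('k \<Rightarrow> int) \<Rightarrow> 'd \<Rightarrow> 'd) \<Rightarrow> ('c \<Rightarrow> 'd) \<Rightarrow> bool" where
  "zk_monoid_iso G act H act' f \<longleftrightarrow> f \<in> iso G H \<and> f \<one>\<^bsub>G\<^esub> = \<one>\<^bsub>H\<^esub> \<and>
     (\<forall>m. \<forall>c \<in> carrier G. f (act m c) = act' m (f c))"


section \<open>Topological groupoids and homology\<close>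

text \<open>
  The unit space is kept as a separate space of objects, so that the unit space of the path
  groupoid is literally the infinite path space.
\<close>

record ('g, 'u) top_groupoid =
  arr :: "'g set"
  arr_top :: "'g topology"
  obj :: "'u set"
  obj_top :: "'u topology"
  grng :: "'g \<Rightarrow> 'u"
  gsrc :: "'g \<Rightarrow> 'u"
  gmult :: "'g \<Rightarrow> 'g \<Rightarrow> 'g"
  ginv :: "'g \<Rightarrow> 'g"

text \<open>
  The skew product by a cocycle, and the translation action \<open>q \<cdot> (g, m) = (g, q + m)\<close>, which has the
  same formula on arrows and on units.
\<close>

definition skew_product ::
    "('g, 'u) top_groupoid \<Rightarrow> ('g \<Rightarrow> 'z::ab_group_add) \<Rightarrow> ('g \<times> 'z, 'u \<times> 'z) top_groupoid" where
  "skew_product G c = \<lparr>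
     arr = arr G \<times> UNIV,
     arr_top = prod_topology (arr_top G) (discrete_topology UNIV),
     obj = obj G \<times> UNIV,
     obj_top = prod_topology (obj_top G) (discrete_topology UNIV),
     grng = (\<lambda>(g, m). (grng G g, m)),
     gsrc = (\<lambda>(g, m). (gsrc G g, m + c g)),
     gmult = (\<lambda>(g, m) (h, _). (gmult G g h, m)),
     ginv = (\<lambda>(g, m). (ginv G g, m + c g))\<rparr>"

definition skew_act :: "'z::ab_group_add \<Rightarrow> 'x \<times> 'z \<Rightarrow> 'x \<times> 'z" where
  "skew_act q = (\<lambda>(g, m). (g, q + m))"

text \<open>The group \<open>C\<^sub>c(X, \<int>)\<close>; its elements are extended by zero outside of \<open>X\<close>.\<close>

definition Cc :: "'x topology \<Rightarrow> ('x \<Rightarrow> int) monoid" where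
  "Cc X = \<lparr>
     carrier = {f. continuous_map X (discrete_topology UNIV) f \<and>
                   compactin X (X closure_of {x \<in> topspace X. f x \<noteq> 0}) \<and>
                   (\<forall>x. x \<notin> topspace X \<longrightarrow> f x = 0)},
     mult = (\<lambda>f g. f + g),
     one = 0\<rparr>"

text \<open>
  The push-forward \<open>u \<mapsto> \<Sum>\<^bsub>p(g) = u\<^esub> f(g)\<close>. It is applied to functions with finite support in each
  fibre of \<open>p\<close>; restricting the sum to that support makes it a finite one.
\<close>

definition push :: "'g set \<Rightarrow> ('g \<Rightarrow> 'u) \<Rightarrow> ('g \<Rightarrow> int) \<Rightarrow> 'u \<Rightarrow> int" where
  "push A p f u = (\<Sum>g | g \<in> A \<and> p g = u \<and> f g \<noteq> 0. f g)"

definition boundary1 :: "('g, 'u) top_groupoid \<Rightarrow> ('g \<Rightarrow> int) \<Rightarrow> 'u \<Rightarrow> int" where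
  "boundary1 G f = push (arr G) (gsrc G) f - push (arr G) (grng G) f"

definition im_boundary1 :: "('g, 'u) top_groupoid \<Rightarrow> ('u \<Rightarrow> int) set" where
  "im_boundary1 G = boundary1 G ` carrier (Cc (arr_top G))"

definition H0 :: "('g, 'u) top_groupoid \<Rightarrow> ('u \<Rightarrow> int) set monoid" where
  "H0 G = Cc (obj_top G) Mod im_boundary1 G"

definition H0_class :: "('g, 'u) top_groupoid \<Rightarrow> ('u \<Rightarrow> int) \<Rightarrow> ('u \<Rightarrow> int) set" where
  "H0_class G f = im_boundary1 G #>\<^bsub>Cc (obj_top G)\<^esub> f"

definition H0_pos :: "('g, 'u) top_groupoid \<Rightarrow> ('u \<Rightarrow> int) set set" where
  "H0_pos G = {H0_class G f |f. f \<in> carrier (Cc (obj_top G)) \<and> 0 \<le> f}"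


section \<open>The path groupoid and its graded homology\<close>

text \<open>The \<open>k\<close>-graph \<open>\<Omega>\<^sub>k\<close>; its object \<open>p\<close> is the identity arrow \<open>(p, p)\<close>.\<close>

definition Omega_k :: "(('k \<Rightarrow> nat) \<times> ('k \<Rightarrow> nat), 'k) kgr" where
  "Omega_k = \<lparr>
     mor = {(p, q). p \<le> q},
     rng = (\<lambda>(p, q). (p, p)),
     src = (\<lambda>(p, q). (q, q)),
     cmp = (\<lambda>(p, q) (p', q'). (p, q')),
     deg = (\<lambda>(p, q). q - p)\<rparr>"

type_synonym ('a, 'k) ipath = "('k \<Rightarrow> nat) \<times> ('k \<Rightarrow> nat) \<Rightarrow> 'a"

definition ipaths :: "('a, 'k) kgr \<Rightarrow> ('a, 'k) ipath set" where
  "ipaths \<Lambda> = {x \<in> mor Omega_k \<rightarrow>\<^sub>E mor \<Lambda>.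
     (\<forall>a \<in> mor Omega_k. rng \<Lambda> (x a) = x (rng Omega_k a) \<and> src \<Lambda> (x a) = x (src Omega_k a) \<and>
                        deg \<Lambda> (x a) = deg Omega_k a) \<and>
     (\<forall>a \<in> mor Omega_k. \<forall>b \<in> mor Omega_k. src Omega_k a = rng Omega_k b \<longrightarrow>
        x (cmp Omega_k a b) = cmp \<Lambda> (x a) (x b))}"

definition shift :: "('k \<Rightarrow> nat) \<Rightarrow> ('a, 'k) ipath \<Rightarrow> ('a, 'k) ipath" where
  "shift p x = restrict (\<lambda>(m, n). x (m + p, n + p)) (mor Omega_k)"

text \<open>
  By the factorization property, \<open>\<lambda>z\<close> is the unique infinite path with initial segment \<open>\<lambda>\<close> and
  remaining part \<open>z\<close>. It is used only when \<open>z(0) = s(\<lambda>)\<close>.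
\<close>

definition concat_path :: "('a, 'k) kgr \<Rightarrow> 'a \<Rightarrow> ('a, 'k) ipath \<Rightarrow> ('a, 'k) ipath" where
  "concat_path \<Lambda> l z = (THE x. x \<in> ipaths \<Lambda> \<and> x (0, deg \<Lambda> l) = l \<and> shift (deg \<Lambda> l) x = z)"

definition cylinder :: "('a, 'k) kgr \<Rightarrow> 'a \<Rightarrow> ('a, 'k) ipath set" where
  "cylinder \<Lambda> l = {concat_path \<Lambda> l z |z. z \<in> ipaths \<Lambda> \<and> z (0, 0) = src \<Lambda> l}"

definition cylinder2 ::
    "('a, 'k) kgr \<Rightarrow> 'a \<Rightarrow> 'a \<Rightarrow> (('a, 'k) ipath \<times> ('k \<Rightarrow> int) \<times> ('a, 'k) ipath) set" where
  "cylinder2 \<Lambda> l m =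
     {(concat_path \<Lambda> l z, to_int (deg \<Lambda> l) - to_int (deg \<Lambda> m), concat_path \<Lambda> m z) |z.
        z \<in> ipaths \<Lambda> \<and> z (0, 0) = src \<Lambda> l}"

definition path_groupoid :: "('a, 'k) kgr \<Rightarrow>
    (('a, 'k) ipath \<times> ('k \<Rightarrow> int) \<times> ('a, 'k) ipath, ('a, 'k) ipath) top_groupoid" where
  "path_groupoid \<Lambda> = \<lparr>
     arr = {(x, to_int n - to_int m, y) |x y n m.
              x \<in> ipaths \<Lambda> \<and> y \<in> ipaths \<Lambda> \<and> shift n x = shift m y},
     arr_top = topology_generated_by
       {cylinder2 \<Lambda> l m |l m. l \<in> mor \<Lambda> \<and> m \<in> mor \<Lambda> \<and> src \<Lambda> l = src \<Lambda> m},
     obj = ipaths \<Lambda>,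
     obj_top = topology_generated_by {cylinder \<Lambda> l |l. l \<in> mor \<Lambda>},
     grng = (\<lambda>(x, n, y). x),
     gsrc = (\<lambda>(x, n, y). y),
     gmult = (\<lambda>(x, n, y) (y', m, w). (x, n + m, w)),
     ginv = (\<lambda>(x, n, y). (y, - n, x))\<rparr>"

definition path_cocycle :: "('a, 'k) ipath \<times> ('k \<Rightarrow> int) \<times> ('a, 'k) ipath \<Rightarrow> 'k \<Rightarrow> int" where
  "path_cocycle = (\<lambda>(x, n, y). n)"

definition skew_path_groupoid :: "('a, 'k) kgr \<Rightarrow>
    ((('a, 'k) ipath \<times> ('k \<Rightarrow> int) \<times> ('a, 'k) ipath) \<times> ('k \<Rightarrow> int),
     ('a, 'k) ipath \<times> ('k \<Rightarrow> int)) top_groupoid" where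
  "skew_path_groupoid \<Lambda> = skew_product (path_groupoid \<Lambda>) path_cocycle"

type_synonym ('a, 'k) gr_chain = "('a, 'k) ipath \<times> ('k \<Rightarrow> int) \<Rightarrow> int"

definition H0gr :: "('a, 'k) kgr \<Rightarrow> ('a, 'k) gr_chain set monoid" where
  "H0gr \<Lambda> = H0 (skew_path_groupoid \<Lambda>)"

definition H0gr_class :: "('a, 'k) kgr \<Rightarrow> ('a, 'k) gr_chain \<Rightarrow> ('a, 'k) gr_chain set" where
  "H0gr_class \<Lambda> f = H0_class (skew_path_groupoid \<Lambda>) f"

definition H0gr_pos :: "('a, 'k) kgr \<Rightarrow> ('a, 'k) gr_chain set set" where
  "H0gr_pos \<Lambda> = H0_pos (skew_path_groupoid \<Lambda>)"

definition H0gr_act ::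
    "('a, 'k) kgr \<Rightarrow> ('k \<Rightarrow> int) \<Rightarrow> ('a, 'k) gr_chain set \<Rightarrow> ('a, 'k) gr_chain set" where
  "H0gr_act \<Lambda> q P = (\<Union>f\<in>P. H0gr_class \<Lambda> (f \<circ> skew_act (- q)))"

definition H0gr_iso :: "('a, 'k) kgr \<Rightarrow> ('b, 'k) kgr \<Rightarrow>
    (('a, 'k) gr_chain set \<Rightarrow> ('b, 'k) gr_chain set) \<Rightarrow> bool" where
  "H0gr_iso \<Lambda> \<Omega> \<psi> \<longleftrightarrow>
     gr_module_iso (H0gr \<Lambda>) (H0gr_act \<Lambda>) (H0gr \<Omega>) (H0gr_act \<Omega>) \<psi> \<and>
     \<psi> ` H0gr_pos \<Lambda> = H0gr_pos \<Omega>"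

text \<open>
  The canonical identification of the graded homology with the dimension group. The classes of the
  functions \<open>1\<^bsub>Z(\<lambda>) \<times> {n}\<^esub>\<close> generate the homology group, so that at most one map (extensional
  outside the carrier) has these properties.
\<close>

definition Theta :: "('a, 'k) kgr \<Rightarrow> ('a, 'k) gr_chain set \<Rightarrow> (('a \<Rightarrow> int) \<times> ('k \<Rightarrow> int)) set" where
  "Theta \<Lambda> = (THE \<theta>. \<theta> \<in> extensional (carrier (H0gr \<Lambda>)) \<and>
     gr_module_iso (H0gr \<Lambda>) (H0gr_act \<Lambda>) (dim_group \<Lambda>) (dim_act \<Lambda>) \<theta> \<and>
     \<theta> ` H0gr_pos \<Lambda> = dim_pos \<Lambda> \<and>
     (\<forall>l \<in> mor \<Lambda>. \<forall>n. \<theta> (H0gr_class \<Lambda> (indicator (cylinder \<Lambda> l \<times> {n}))) =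
        dim_class \<Lambda> (basis_vec (src \<Lambda> l)) (n + to_int (deg \<Lambda> l))))"

end

theory Submission
  imports Defs
begin

text \<open>
  The dimension group is the direct limit of \<open>\<int>\<Lambda>\<^sup>0\<close> along the adjacency matrices. Two multisets of
  generators of the talented monoid are congruent iff, once expanded to a sufficiently high common
  level, they have the same vertex multiplicities; so the talented monoid is the positive cone of
  the dimension group. For the homology, compactness of the cylinder sets (Koenig's lemma) shows that
  every compactly supported function is a combination of indicators of \<open>Z(\<lambda>) \<times> {n}\<close>, and that the
  boundaries are spanned by the differences of \<open>Z(\<lambda>) \<times> {n}\<close> and \<open>Z(\<mu>) \<times> {m}\<close> with \<open>s(\<lambda>) = s(\<mu>)\<close> and
  \<open>n + d(\<lambda>) = m + d(\<mu>)\<close>. Hence every class has the form \<open>\<Sum>\<^sub>v x\<^sub>v [Z(v) \<times> {n}]\<close>, and counting values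
  at a high level shows that this class determines \<open>[x, n]\<close>.

  An isomorphism of positive cones is given on the classes \<open>[\<epsilon>\<^sub>u, 0]\<close> by a matrix that intertwines
  the adjacency matrices in the limit; multiplying by a high power makes it intertwine them exactly.
  This already uses the positive cone only, so that shift equivalence follows directly from an
  isomorphism of talented monoids.
\<close>

text \<open>Equalities in a direct limit hold only from some level on, while the matrix equations
  must hold exactly. Finiteness of both vertex sets and of the set of coordinates closes this gap:
  finitely many basis vectors and directions have one common power. In the final pair only
  \<open>S\<close> absorbs the correcting power; since \<open>R\<close> already intertwines exactly,
  a power of the first graph passes through it and becomes the same power of the second, which
  repairs the other product as well. The way from talented monoids back to dimension groups runs
  through these matrices: they act on all vectors, whereas a monoid isomorphism speaks about the
  cone only. For homology the obstacle is to show that a function is not a boundary. The detecting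
  functional samples a function at one chosen infinite path in each cylinder, so it is additive on
  all functions, and boundaries can be treated one generator at a time. Units, arrows and their
  products with the discrete group carry the same kind of nested partitions, hence the abstract
  bases filtered by levels.\<close>

lemma fun_diff_add_cancel:
  fixes p q :: "'k \<Rightarrow> nat"
  assumes "p \<le> q" shows "p + (q - p) = q"
  using assms by (auto simp: fun_eq_iff le_fun_def)

lemma to_nat_simps [simp]: "to_nat 0 = 0" "to_nat (to_int n) = n"
  by (auto simp: to_nat_def to_int_def fun_eq_iff)

lemma to_int_simps [simp]: "to_int 0 = 0" "to_int (n + m) = to_int n + to_int m"
  "0 \<le> to_int n"
  by (auto simp: to_int_def fun_eq_iff le_fun_def)

lemma to_int_to_nat: "0 \<le> n \<Longrightarrow> to_int (to_nat n) = n"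
  by (auto simp: to_nat_def to_int_def fun_eq_iff le_fun_def)

lemma to_int_basis_vec [simp]: "to_int (basis_vec i) = basis_vec i"
  by (auto simp: to_int_def basis_vec_def fun_eq_iff)

lemma to_int_inj [simp]: "to_int n = to_int m \<longleftrightarrow> n = m"
  by (auto simp: to_int_def fun_eq_iff)

lemma fun_le_diff_iff: "(0 \<le> l - n) \<longleftrightarrow> n \<le> (l :: 'k \<Rightarrow> int)"
  by (auto simp: le_fun_def)

text \<open>Truncation at zero makes \<open>to_nat\<close> additive only along a chain
  \<open>n \<le> m \<le> l\<close>. This form lets a vector be lifted in two stages.\<close>

lemma to_nat_diff_split:
  fixes n m l :: "'k \<Rightarrow> int"
  assumes "n \<le> m" "m \<le> l"
  shows "to_nat (l - n) = to_nat (m - n) + to_nat (l - m)"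
  using assms by (fastforce simp: to_nat_def fun_eq_iff le_fun_def nat_add_distrib[symmetric])

text \<open>Induction on the sum of the coordinates. It carries facts known for the generators
  \<open>basis_vec i\<close> only (defining relations, intertwining, the automorphisms \<delta>)
  over to all degrees.\<close>

lemma fun_nat_induct [case_names zero step]:
  fixes P :: "('k::finite \<Rightarrow> nat) \<Rightarrow> bool"
  assumes "P 0" and "\<And>n i. P n \<Longrightarrow> P (basis_vec i + n)"
  shows "P n"
proof (induction "sum n UNIV" arbitrary: n)
  case 0
  then have "n = 0" by (auto simp: fun_eq_iff)
  then show ?case using assms(1) by blast
next
  case (Suc m)
  then obtain i where i: "n i \<noteq> 0" by (metis (no_types) nat.distinct(1) sum.neutral)
  define n' where "n' = n(i := n i - 1)"
  have n: "n = basis_vec i + n'" using i by (auto simp: n'_def basis_vec_def fun_eq_iff)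
  have "sum n UNIV = sum (basis_vec i) UNIV + sum n' UNIV"
    unfolding n by (simp add: sum.distrib)
  also have "sum (basis_vec i :: 'k \<Rightarrow> nat) UNIV = 1"
    by (simp add: basis_vec_def)
  finally have "P n'" using Suc by simp
  then show ?case unfolding n by (rule assms(2))
qed

text \<open>The diagonal is cofinal in the degrees, so a path that grows along it has prefixes of
  every degree.\<close>

lemma ex_const_ge: "\<exists>j. (n :: 'k::finite \<Rightarrow> nat) \<le> (\<lambda>_. j)"
  by (rule exI[of _ "Max (range n)"]) (auto simp: le_fun_def)

section \<open>Factorization\<close>

context kgraph begin

text \<open>Additivity of the degree forces the second factors to have equal degree once the first
  ones do, so both pairs compete in the same instance of the factorization property.\<close>

lemma fact_unique:
  assumes "a \<in> mor \<Lambda>" "b \<in> mor \<Lambda>" "a' \<in> mor \<Lambda>" "b' \<in> mor \<Lambda>"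
    "src \<Lambda> a = rng \<Lambda> b" "src \<Lambda> a' = rng \<Lambda> b'"
    "cmp \<Lambda> a b = cmp \<Lambda> a' b'" "deg \<Lambda> a = deg \<Lambda> a'"
  shows "a = a'" "b = b'"
proof -
  have "deg \<Lambda> a + deg \<Lambda> b = deg \<Lambda> a' + deg \<Lambda> b'"
    using deg_cmp[of a b] deg_cmp[of a' b'] assms by simp
  then have db: "deg \<Lambda> b = deg \<Lambda> b'" using assms by simp
  have "\<exists>!(\<alpha>, \<beta>). \<alpha> \<in> mor \<Lambda> \<and> \<beta> \<in> mor \<Lambda> \<and> src \<Lambda> \<alpha> = rng \<Lambda> \<beta> \<and>
                deg \<Lambda> \<alpha> = deg \<Lambda> a \<and> deg \<Lambda> \<beta> = deg \<Lambda> b \<and> cmp \<Lambda> a b = cmp \<Lambda> \<alpha> \<beta>"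
    using cmp_mor[OF assms(1,2,5)] deg_cmp[OF assms(1,2,5)] by (rule factorization)
  then have "(a, b) = (a', b')"
    by (rule ex1E) (use assms db in \<open>auto\<close>)
  then show "a = a'" "b = b'" by auto
qed

text \<open>For \<open>p \<le> deg \<Lambda> l\<close> factorization makes \<open>pfx p l\<close>
  and \<open>sfx p l\<close> the unique factors of \<open>l\<close>; for any other \<open>p\<close>
  the choices carry no meaning. \<open>sfx\<close> is chosen relative to \<open>pfx\<close>, so the
  two compose to \<open>l\<close> by construction.\<close>

definition pfx where
  "pfx p l = (SOME \<alpha>. \<alpha> \<in> mor \<Lambda> \<and> deg \<Lambda> \<alpha> = p \<and> (\<exists>\<beta>\<in>mor \<Lambda>. src \<Lambda> \<alpha> = rng \<Lambda> \<beta> \<and> l = cmp \<Lambda> \<alpha> \<beta>))"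

definition sfx where
  "sfx p l = (SOME \<beta>. \<beta> \<in> mor \<Lambda> \<and> src \<Lambda> (pfx p l) = rng \<Lambda> \<beta> \<and> l = cmp \<Lambda> (pfx p l) \<beta>)"

lemma pfx_sfx:
  assumes "l \<in> mor \<Lambda>" "p \<le> deg \<Lambda> l"
  shows pfx_mor: "pfx p l \<in> mor \<Lambda>" and deg_pfx: "deg \<Lambda> (pfx p l) = p"
    and sfx_mor: "sfx p l \<in> mor \<Lambda>" and src_pfx: "src \<Lambda> (pfx p l) = rng \<Lambda> (sfx p l)"
    and cmp_pfx_sfx: "cmp \<Lambda> (pfx p l) (sfx p l) = l"
    and deg_sfx: "deg \<Lambda> (sfx p l) = deg \<Lambda> l - p"
    and rng_pfx: "rng \<Lambda> (pfx p l) = rng \<Lambda> l"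
    and src_sfx: "src \<Lambda> (sfx p l) = src \<Lambda> l"
proof -
  have "\<exists>!(\<alpha>, \<beta>). \<alpha> \<in> mor \<Lambda> \<and> \<beta> \<in> mor \<Lambda> \<and> src \<Lambda> \<alpha> = rng \<Lambda> \<beta> \<and>
                deg \<Lambda> \<alpha> = p \<and> deg \<Lambda> \<beta> = deg \<Lambda> l - p \<and> l = cmp \<Lambda> \<alpha> \<beta>"
    using assms by (intro factorization) (auto simp: fun_diff_add_cancel)
  then have ex: "\<exists>\<alpha>. \<alpha> \<in> mor \<Lambda> \<and> deg \<Lambda> \<alpha> = p \<and> (\<exists>\<beta>\<in>mor \<Lambda>. src \<Lambda> \<alpha> = rng \<Lambda> \<beta> \<and> l = cmp \<Lambda> \<alpha> \<beta>)"
    by blast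
  note 1 = someI_ex[OF ex, folded pfx_def]
  then have "\<exists>\<beta>. \<beta> \<in> mor \<Lambda> \<and> src \<Lambda> (pfx p l) = rng \<Lambda> \<beta> \<and> l = cmp \<Lambda> (pfx p l) \<beta>" by blast
  note 2 = someI_ex[OF this, folded sfx_def]
  show m: "pfx p l \<in> mor \<Lambda>" "deg \<Lambda> (pfx p l) = p" "sfx p l \<in> mor \<Lambda>"
    "src \<Lambda> (pfx p l) = rng \<Lambda> (sfx p l)" "cmp \<Lambda> (pfx p l) (sfx p l) = l"
    using 1 2 by auto
  show "deg \<Lambda> (sfx p l) = deg \<Lambda> l - p" "rng \<Lambda> (pfx p l) = rng \<Lambda> l" "src \<Lambda> (sfx p l) = src \<Lambda> l"
    using deg_cmp[OF m(1,3,4)] rng_cmp[OF m(1,3,4)] src_cmp[OF m(1,3,4)] m by auto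
qed

lemma pfx_cmp:
  assumes "a \<in> mor \<Lambda>" "b \<in> mor \<Lambda>" "src \<Lambda> a = rng \<Lambda> b" "p = deg \<Lambda> a"
  shows pfx_cmp_eq: "pfx p (cmp \<Lambda> a b) = a" and sfx_cmp_eq: "sfx p (cmp \<Lambda> a b) = b"
proof -
  have "cmp \<Lambda> a b \<in> mor \<Lambda>" "p \<le> deg \<Lambda> (cmp \<Lambda> a b)"
    using assms by (auto simp: cmp_mor deg_cmp le_fun_def)
  note P = pfx_sfx[OF this]
  show "pfx p (cmp \<Lambda> a b) = a" "sfx p (cmp \<Lambda> a b) = b"
    using fact_unique[of "pfx p (cmp \<Lambda> a b)" "sfx p (cmp \<Lambda> a b)" a b] P assms by auto
qed

text \<open>Factoring the prefix once more and reassociating exhibits a factorization of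
  \<open>l\<close> whose first factor has degree \<open>p\<close>; uniqueness does the rest.\<close>

lemma pfx_pfx:
  assumes "l \<in> mor \<Lambda>" "q \<le> deg \<Lambda> l" "p \<le> q"
  shows "pfx p (pfx q l) = pfx p l"
proof -
  note Q = pfx_sfx[OF assms(1,2)]
  have "p \<le> deg \<Lambda> (pfx q l)" using assms Q by simp
  note P = pfx_sfx[OF Q(1) this]
  have "l = cmp \<Lambda> (cmp \<Lambda> (pfx p (pfx q l)) (sfx p (pfx q l))) (sfx q l)"
    using P Q by simp
  also have "\<dots> = cmp \<Lambda> (pfx p (pfx q l)) (cmp \<Lambda> (sfx p (pfx q l)) (sfx q l))"
    using P Q by (intro cmp_assoc) auto
  finally have "pfx p l = pfx p (cmp \<Lambda> (pfx p (pfx q l)) (cmp \<Lambda> (sfx p (pfx q l)) (sfx q l)))"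
    by simp
  also have "\<dots> = pfx p (pfx q l)"
    using P Q by (intro pfx_cmp_eq) (auto simp: cmp_mor rng_cmp)
  finally show ?thesis by simp
qed

lemma pfx_self [simp]: "l \<in> mor \<Lambda> \<Longrightarrow> pfx (deg \<Lambda> l) l = l"
  using pfx_cmp_eq[of l "src \<Lambda> l" "deg \<Lambda> l"] by (simp add: cmp_src src_mor rng_src)

lemma pfx_cmp_le:
  assumes "a \<in> mor \<Lambda>" "b \<in> mor \<Lambda>" "src \<Lambda> a = rng \<Lambda> b" "p \<le> deg \<Lambda> a"
  shows "pfx p (cmp \<Lambda> a b) = pfx p a"
proof -
  have "pfx p (pfx (deg \<Lambda> a) (cmp \<Lambda> a b)) = pfx p (cmp \<Lambda> a b)"
    using assms by (intro pfx_pfx) (auto simp: cmp_mor deg_cmp le_fun_def)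
  then show ?thesis using assms by (simp add: pfx_cmp_eq)
qed

text \<open>An arrow of degree zero factors both as range times itself and as itself times source,
  with first factors of the same degree; uniqueness identifies it with its range and its
  source.\<close>

lemma vertex_iff: "v \<in> vertices \<Lambda> \<longleftrightarrow> v \<in> mor \<Lambda> \<and> rng \<Lambda> v = v \<and> src \<Lambda> v = v"
proof
  assume "v \<in> vertices \<Lambda>"
  then have v: "v \<in> mor \<Lambda>" "deg \<Lambda> v = 0" by (auto simp: paths_def)
  have "src \<Lambda> (rng \<Lambda> v) = rng \<Lambda> v" "cmp \<Lambda> (rng \<Lambda> v) v = cmp \<Lambda> v (src \<Lambda> v)"
    using v by (auto simp: src_rng cmp_rng cmp_src)
  then have "rng \<Lambda> v = v" "v = src \<Lambda> v"
    using fact_unique[of "rng \<Lambda> v" v v "src \<Lambda> v"] v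
    by (auto simp: rng_mor src_mor deg_rng rng_src)
  then show "v \<in> mor \<Lambda> \<and> rng \<Lambda> v = v \<and> src \<Lambda> v = v" using v by auto
next
  assume "v \<in> mor \<Lambda> \<and> rng \<Lambda> v = v \<and> src \<Lambda> v = v"
  then show "v \<in> vertices \<Lambda>" using deg_rng[of v] by (auto simp: paths_def)
qed

lemma rng_vertex [simp]: "l \<in> mor \<Lambda> \<Longrightarrow> rng \<Lambda> l \<in> vertices \<Lambda>"
  by (simp add: vertex_iff rng_mor rng_rng src_rng)

lemma src_vertex [simp]: "l \<in> mor \<Lambda> \<Longrightarrow> src \<Lambda> l \<in> vertices \<Lambda>"
  by (simp add: vertex_iff src_mor rng_src src_src)

lemma vertex_mor: "v \<in> vertices \<Lambda> \<Longrightarrow> v \<in> mor \<Lambda>"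
  by (simp add: vertex_iff)

lemma paths_from_iff: "l \<in> paths_from \<Lambda> v n \<longleftrightarrow> l \<in> mor \<Lambda> \<and> deg \<Lambda> l = n \<and> rng \<Lambda> l = v"
  by (auto simp: paths_from_def paths_def)

lemma paths_from_0: "v \<in> vertices \<Lambda> \<Longrightarrow> paths_from \<Lambda> v 0 = {v}"
proof -
  assume v: "v \<in> vertices \<Lambda>"
  have "l = v" if "l \<in> mor \<Lambda>" "deg \<Lambda> l = 0" "rng \<Lambda> l = v" for l
  proof -
    have "l \<in> vertices \<Lambda>" using that by (simp add: paths_def)
    then show ?thesis using that by (simp add: vertex_iff)
  qed
  moreover have "deg \<Lambda> v = 0" using v by (simp add: paths_def)
  ultimately show ?thesis using v by (auto simp: paths_from_iff vertex_iff)
qed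

end

section \<open>Adjacency matrices and the dimension group\<close>

locale finite_kgraph = kgraph \<Lambda> for \<Lambda> :: "('a, 'k::finite) kgr" +
  assumes row_finite: "row_finite_no_sources \<Lambda>" and finite_vertices: "finite (vertices \<Lambda>)"
begin

lemma finite_paths_from: "v \<in> vertices \<Lambda> \<Longrightarrow> finite (paths_from \<Lambda> v n)"
  and paths_from_nonempty: "v \<in> vertices \<Lambda> \<Longrightarrow> paths_from \<Lambda> v n \<noteq> {}"
  using row_finite by (auto simp: row_finite_no_sources_def)

lemma finite_paths: "finite (paths \<Lambda> n)"
proof -
  have "l \<in> paths_from \<Lambda> (rng \<Lambda> l) n \<and> rng \<Lambda> l \<in> vertices \<Lambda>" if "l \<in> paths \<Lambda> n" for l
    using that rng_vertex[of l] by (simp add: paths_from_def paths_def)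
  then have "paths \<Lambda> n = (\<Union>v\<in>vertices \<Lambda>. paths_from \<Lambda> v n)"
    by (auto simp: paths_from_def)
  then show ?thesis using finite_vertices finite_paths_from by simp
qed

text \<open>The factorization property in the form used for counting; it is what makes adjacency
  matrices multiplicative in the degree.\<close>

lemma paths_from_add:
  assumes "v \<in> vertices \<Lambda>"
  shows "bij_betw (\<lambda>(a, b). cmp \<Lambda> a b)
    (SIGMA a:paths_from \<Lambda> v n. paths_from \<Lambda> (src \<Lambda> a) m) (paths_from \<Lambda> v (n + m))"
  unfolding bij_betw_def
proof
  show "inj_on (\<lambda>(a, b). cmp \<Lambda> a b) (SIGMA a:paths_from \<Lambda> v n. paths_from \<Lambda> (src \<Lambda> a) m)"
  proof (rule inj_onI, clarify)
    fix a b a' b'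
    assume *: "a \<in> paths_from \<Lambda> v n" "b \<in> paths_from \<Lambda> (src \<Lambda> a) m"
      "a' \<in> paths_from \<Lambda> v n" "b' \<in> paths_from \<Lambda> (src \<Lambda> a') m" "cmp \<Lambda> a b = cmp \<Lambda> a' b'"
    show "a = a' \<and> b = b'"
      using * by (intro conjI fact_unique[of a b a' b']) (simp_all only: paths_from_iff)
  qed
  have "l \<in> (\<lambda>(a, b). cmp \<Lambda> a b) ` (SIGMA a:paths_from \<Lambda> v n. paths_from \<Lambda> (src \<Lambda> a) m)"
    if l: "l \<in> paths_from \<Lambda> v (n + m)" for l
  proof -
    have *: "l \<in> mor \<Lambda>" "n \<le> deg \<Lambda> l" using l by (auto simp: paths_from_iff le_fun_def)
    have "(pfx n l, sfx n l) \<in> (SIGMA a:paths_from \<Lambda> v n. paths_from \<Lambda> (src \<Lambda> a) m)"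
      using pfx_sfx[OF *] l by (auto simp: paths_from_iff)
    moreover have "(\<lambda>(a, b). cmp \<Lambda> a b) (pfx n l, sfx n l) = l" using pfx_sfx[OF *] by simp
    ultimately show ?thesis by (metis (no_types, lifting) image_eqI)
  qed
  then show "(\<lambda>(a, b). cmp \<Lambda> a b) ` (SIGMA a:paths_from \<Lambda> v n. paths_from \<Lambda> (src \<Lambda> a) m)
    = paths_from \<Lambda> v (n + m)"
    by (auto simp: paths_from_iff cmp_mor deg_cmp rng_cmp)
qed

lemma adj_mat_alt: "adj_mat \<Lambda> n u v = card {l \<in> paths_from \<Lambda> u n. src \<Lambda> l = v}"
  unfolding adj_mat_def paths_from_def by (rule arg_cong[where f = card]) auto

text \<open>Grouping paths by their source turns a sum over paths into a matrix product. The
  semiring type serves natural and integer sums alike.\<close>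

lemma sum_paths_from:
  fixes f :: "'a \<Rightarrow> 'c::comm_semiring_1"
  assumes "u \<in> vertices \<Lambda>"
  shows "(\<Sum>l\<in>paths_from \<Lambda> u n. f (src \<Lambda> l)) = (\<Sum>v\<in>vertices \<Lambda>. of_nat (adj_mat \<Lambda> n u v) * f v)"
proof -
  have "(\<Sum>l\<in>paths_from \<Lambda> u n. f (src \<Lambda> l))
    = (\<Sum>v\<in>vertices \<Lambda>. \<Sum>l | l \<in> paths_from \<Lambda> u n \<and> src \<Lambda> l = v. f (src \<Lambda> l))"
    using finite_paths_from[OF assms] finite_vertices
    by (intro sum.group[symmetric]) (auto simp: paths_from_iff)
  also have "\<dots> = (\<Sum>v\<in>vertices \<Lambda>. of_nat (adj_mat \<Lambda> n u v) * f v)"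
    by (rule sum.cong) (simp_all add: adj_mat_alt)
  finally show ?thesis .
qed

lemma adj_mat_0: "u \<in> vertices \<Lambda> \<Longrightarrow> adj_mat \<Lambda> 0 u v = (if u = v then 1 else 0)"
proof -
  assume u: "u \<in> vertices \<Lambda>"
  then have "{l \<in> paths_from \<Lambda> u 0. src \<Lambda> l = v} = (if u = v then {u} else {})"
    by (auto simp: paths_from_0) (auto simp: vertex_iff)
  then show ?thesis by (simp add: adj_mat_alt)
qed

lemma adj_mat_add:
  assumes u: "u \<in> vertices \<Lambda>"
  shows "adj_mat \<Lambda> (n + m) u v = (\<Sum>w\<in>vertices \<Lambda>. adj_mat \<Lambda> n u w * adj_mat \<Lambda> m w v)"
proof -
  let ?I = "\<lambda>w. if w = v then 1 else 0 :: nat"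
  have fin: "finite (paths_from \<Lambda> u n)" "finite (paths_from \<Lambda> w m)" if "w \<in> vertices \<Lambda>" for w
    using finite_paths_from u that by auto
  have card: "adj_mat \<Lambda> n' u' v = (\<Sum>l\<in>paths_from \<Lambda> u' n'. ?I (src \<Lambda> l))" if "u' \<in> vertices \<Lambda>" for u' n'
    using finite_paths_from[OF that, of n']
    by (simp add: adj_mat_alt sum.If_cases Int_def)
  have "adj_mat \<Lambda> (n + m) u v = (\<Sum>l\<in>paths_from \<Lambda> u (n + m). ?I (src \<Lambda> l))" using card[OF u] .
  also have "\<dots> = (\<Sum>(a, b)\<in>(SIGMA a:paths_from \<Lambda> u n. paths_from \<Lambda> (src \<Lambda> a) m). ?I (src \<Lambda> (cmp \<Lambda> a b)))"
    by (subst sum.reindex_bij_betw[OF paths_from_add[OF u], symmetric]) (simp add: case_prod_unfold)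
  also have "\<dots> = (\<Sum>(a, b)\<in>(SIGMA a:paths_from \<Lambda> u n. paths_from \<Lambda> (src \<Lambda> a) m). ?I (src \<Lambda> b))"
    by (rule sum.cong) (auto simp: paths_from_iff src_cmp)
  also have "\<dots> = (\<Sum>a\<in>paths_from \<Lambda> u n. adj_mat \<Lambda> m (src \<Lambda> a) v)"
    using finite_paths_from u
    by (subst sum.Sigma[symmetric]) (auto simp: paths_from_iff card intro!: sum.cong)
  also have "\<dots> = (\<Sum>w\<in>vertices \<Lambda>. adj_mat \<Lambda> n u w * adj_mat \<Lambda> m w v)"
    using sum_paths_from[OF u, of "\<lambda>w. adj_mat \<Lambda> m w v" n] by simp
  finally show ?thesis .
qed

lemma vec_mat_vecs [simp]: "vec_mat \<Lambda> x n \<in> int_vecs \<Lambda>"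
  by (simp add: vec_mat_def int_vecs_def)

lemma vec_mat_0: "x \<in> int_vecs \<Lambda> \<Longrightarrow> vec_mat \<Lambda> x 0 = x"
  using finite_vertices
  by (auto simp: vec_mat_def int_vecs_def fun_eq_iff adj_mat_0 if_distrib sum.delta cong: if_cong sum.cong)

lemma vec_mat_add: "vec_mat \<Lambda> (x + y) n = vec_mat \<Lambda> x n + vec_mat \<Lambda> y n"
  by (auto simp: vec_mat_def fun_eq_iff algebra_simps sum.distrib)

lemma vec_mat_zero [simp]: "vec_mat \<Lambda> 0 n = 0"
  by (auto simp: vec_mat_def fun_eq_iff)

lemma vec_mat_nonneg: "0 \<le> x \<Longrightarrow> 0 \<le> vec_mat \<Lambda> x n"
  by (auto simp: vec_mat_def le_fun_def intro!: sum_nonneg)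

lemma vec_mat_vec_mat: "vec_mat \<Lambda> (vec_mat \<Lambda> x n) m = vec_mat \<Lambda> x (n + m)"
proof
  fix v
  have "(\<Sum>w\<in>vertices \<Lambda>. (\<Sum>u\<in>vertices \<Lambda>. x u * int (adj_mat \<Lambda> n u w)) * int (adj_mat \<Lambda> m w v))
     = (\<Sum>w\<in>vertices \<Lambda>. \<Sum>u\<in>vertices \<Lambda>. x u * (int (adj_mat \<Lambda> n u w) * int (adj_mat \<Lambda> m w v)))"
    by (simp add: sum_distrib_right mult.assoc)
  also have "\<dots> = (\<Sum>u\<in>vertices \<Lambda>. \<Sum>w\<in>vertices \<Lambda>. x u * (int (adj_mat \<Lambda> n u w) * int (adj_mat \<Lambda> m w v)))"
    by (rule sum.swap)
  also have "\<dots> = (\<Sum>u\<in>vertices \<Lambda>. x u * int (adj_mat \<Lambda> (n + m) u v))"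
    by (intro sum.cong) (simp_all add: adj_mat_add sum_distrib_left)
  finally show "vec_mat \<Lambda> (vec_mat \<Lambda> x n) m v = vec_mat \<Lambda> x (n + m) v"
    by (simp add: vec_mat_def cong: sum.cong)
qed

lemma int_vecs_add [simp]: "x \<in> int_vecs \<Lambda> \<Longrightarrow> y \<in> int_vecs \<Lambda> \<Longrightarrow> x + y \<in> int_vecs \<Lambda>"
  and int_vecs_0 [simp]: "0 \<in> int_vecs \<Lambda>"
  and int_vecs_uminus [simp]: "x \<in> int_vecs \<Lambda> \<Longrightarrow> - x \<in> int_vecs \<Lambda>"
  by (auto simp: int_vecs_def)

lemma basis_vec_int_vecs [simp]: "v \<in> vertices \<Lambda> \<Longrightarrow> basis_vec v \<in> int_vecs \<Lambda>"
  by (auto simp: int_vecs_def basis_vec_def)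

lemma vec_mat_basis_vec:
  "u \<in> vertices \<Lambda> \<Longrightarrow> v \<in> vertices \<Lambda> \<Longrightarrow> vec_mat \<Lambda> (basis_vec u) n v = int (adj_mat \<Lambda> n u v)"
  using finite_vertices
  by (simp add: vec_mat_def basis_vec_def if_distrib[of "\<lambda>x. x * _"] cong: if_cong)

text \<open>A witness level of \<open>dim_rel\<close> may be raised. Two witnesses can therefore
  always be brought together at their supremum.\<close>

lemma vec_mat_eq_mono:
  fixes n m l l' :: "'k \<Rightarrow> int"
  assumes "n \<le> l" "m \<le> l" "l \<le> l'"
    and "vec_mat \<Lambda> x (to_nat (l - n)) = vec_mat \<Lambda> y (to_nat (l - m))"
  shows "vec_mat \<Lambda> x (to_nat (l' - n)) = vec_mat \<Lambda> y (to_nat (l' - m))"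
  using assms by (simp add: to_nat_diff_split[of n l l'] to_nat_diff_split[of m l l']
    vec_mat_vec_mat[symmetric])

lemma dim_rel_iff:
  "((x, n), (y, m)) \<in> dim_rel \<Lambda> \<longleftrightarrow> x \<in> int_vecs \<Lambda> \<and> y \<in> int_vecs \<Lambda> \<and>
    (\<exists>l. n \<le> l \<and> m \<le> l \<and> vec_mat \<Lambda> x (to_nat (l - n)) = vec_mat \<Lambda> y (to_nat (l - m)))"
  by (auto simp: dim_rel_def)

lemma equiv_dim_rel: "equiv (int_vecs \<Lambda> \<times> UNIV) (dim_rel \<Lambda>)"
proof (rule equivI)
  show "dim_rel \<Lambda> \<subseteq> (int_vecs \<Lambda> \<times> UNIV) \<times> (int_vecs \<Lambda> \<times> UNIV)"
    by (auto simp: dim_rel_def)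
  show "refl_on (int_vecs \<Lambda> \<times> UNIV) (dim_rel \<Lambda>)"
    by (auto simp: refl_on_def dim_rel_iff)
  show "sym (dim_rel \<Lambda>)"
  proof (rule symI, clarify)
    fix x n y m assume "((x, n), (y, m)) \<in> dim_rel \<Lambda>"
    then show "((y, m), (x, n)) \<in> dim_rel \<Lambda>" by (auto simp: dim_rel_iff dest: HOL.sym)
  qed
  show "trans (dim_rel \<Lambda>)"
  proof (rule transI, clarify)
    fix x n y m z p
    assume "((x, n), (y, m)) \<in> dim_rel \<Lambda>" "((y, m), (z, p)) \<in> dim_rel \<Lambda>"
    then obtain l l' where *: "x \<in> int_vecs \<Lambda>" "y \<in> int_vecs \<Lambda>" "z \<in> int_vecs \<Lambda>"
      "n \<le> l" "m \<le> l" "m \<le> l'" "p \<le> l'"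
      "vec_mat \<Lambda> x (to_nat (l - n)) = vec_mat \<Lambda> y (to_nat (l - m))"
      "vec_mat \<Lambda> y (to_nat (l' - m)) = vec_mat \<Lambda> z (to_nat (l' - p))"
      unfolding dim_rel_iff by blast
    \<comment> \<open>At the common level \<open>sup l l'\<close> both equalities pass through the
      same lift of \<open>y\<close>.\<close>
    have "vec_mat \<Lambda> x (to_nat (sup l l' - n)) = vec_mat \<Lambda> z (to_nat (sup l l' - p))"
      using vec_mat_eq_mono[OF *(4,5) sup_ge1 *(8)] vec_mat_eq_mono[OF *(6,7) sup_ge2 *(9)] by simp
    moreover have "n \<le> sup l l'" "p \<le> sup l l'"
      using * by (auto intro: le_supI1 le_supI2)
    ultimately show "((x, n), (z, p)) \<in> dim_rel \<Lambda>" using * unfolding dim_rel_iff by blast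
  qed
qed

lemma dim_class_self: "x \<in> int_vecs \<Lambda> \<Longrightarrow> (x, n) \<in> dim_class \<Lambda> x n"
  by (auto simp: dim_class_def dim_rel_iff)

lemma dim_class_eq_iff:
  assumes "x \<in> int_vecs \<Lambda>" "y \<in> int_vecs \<Lambda>"
  shows "dim_class \<Lambda> x n = dim_class \<Lambda> y m \<longleftrightarrow>
    (\<exists>l. n \<le> l \<and> m \<le> l \<and> vec_mat \<Lambda> x (to_nat (l - n)) = vec_mat \<Lambda> y (to_nat (l - m)))"
  using eq_equiv_class_iff[OF equiv_dim_rel, of "(x, n)" "(y, m)"] assms
  by (simp add: dim_class_def dim_rel_iff)

text \<open>The two representatives already agree at level \<open>N\<close>, where the second one is
  multiplied by the matrix of degree zero.\<close>

lemma dim_class_lift: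
  assumes "x \<in> int_vecs \<Lambda>" "n \<le> N"
  shows "dim_class \<Lambda> x n = dim_class \<Lambda> (vec_mat \<Lambda> x (to_nat (N - n))) N"
proof -
  have "to_nat (N - N) = 0" by (simp add: to_nat_def fun_eq_iff)
  then show ?thesis
    using assms by (auto simp: dim_class_eq_iff vec_mat_0 intro!: exI[of _ N])
qed

lemma dim_class_lift_nat:
  "x \<in> int_vecs \<Lambda> \<Longrightarrow> dim_class \<Lambda> (vec_mat \<Lambda> x l) (n + to_int l) = dim_class \<Lambda> x n"
  using dim_class_lift[of x n "n + to_int l"] by (simp add: le_fun_def to_int_def to_nat_def)

text \<open>A formula that is constant on a nonempty class has that constant as its union over the
  class. All operations on dimension groups given on representatives are evaluated this way.\<close>

lemma UN_dim_class:
  assumes "x \<in> int_vecs \<Lambda>"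
    and "\<And>y m. y \<in> int_vecs \<Lambda> \<Longrightarrow> dim_class \<Lambda> y m = dim_class \<Lambda> x n \<Longrightarrow> F y m = F x n"
  shows "(\<Union>(y, m)\<in>dim_class \<Lambda> x n. F y m) = F x n"
proof -
  have "F y m = F x n" if "(y, m) \<in> dim_class \<Lambda> x n" for y m
  proof -
    have "((x, n), (y, m)) \<in> dim_rel \<Lambda>" using that by (simp add: dim_class_def)
    then have "dim_class \<Lambda> x n = dim_class \<Lambda> y m" "y \<in> int_vecs \<Lambda>"
      using equiv_class_eq[OF equiv_dim_rel] by (auto simp: dim_class_def dim_rel_iff)
    then show ?thesis using assms(2) by metis
  qed
  then have "(\<Union>(y, m)\<in>dim_class \<Lambda> x n. F y m) = (\<Union>z\<in>dim_class \<Lambda> x n. F x n)"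
    by (intro SUP_cong) auto
  also have "\<dots> = F x n" using dim_class_self[OF assms(1), of n] by auto
  finally show ?thesis .
qed

text \<open>The sum may be formed at any common upper bound of the two levels, not only at the
  supremum. This freedom is also what proves independence of representatives.\<close>

lemma dim_mult_lift:
  assumes "x \<in> int_vecs \<Lambda>" "y \<in> int_vecs \<Lambda>" "n \<le> N" "m \<le> N"
  shows "dim_class \<Lambda> x n \<otimes>\<^bsub>dim_group \<Lambda>\<^esub> dim_class \<Lambda> y m =
    dim_class \<Lambda> (vec_mat \<Lambda> x (to_nat (N - n)) + vec_mat \<Lambda> y (to_nat (N - m))) N"
proof -
  define G where "G x n y m =
    dim_class \<Lambda> (vec_mat \<Lambda> x (to_nat (sup n m - n)) + vec_mat \<Lambda> y (to_nat (sup n m - m))) (sup n m)"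
    for x n y m
  have G: "G x n y m = dim_class \<Lambda> (vec_mat \<Lambda> x (to_nat (N - n)) + vec_mat \<Lambda> y (to_nat (N - m))) N"
    if "n \<le> N" "m \<le> N" for x y n m N
  proof -
    have "sup n m \<le> N" using that by simp
    then show ?thesis
      by (simp add: G_def dim_class_lift[of _ "sup n m" N] vec_mat_add vec_mat_vec_mat
        to_nat_diff_split[of n "sup n m" N] to_nat_diff_split[of m "sup n m" N])
  qed
  have G_cong: "G x n y m = G x' n' y' m'"
    if v: "x \<in> int_vecs \<Lambda>" "y \<in> int_vecs \<Lambda>" "x' \<in> int_vecs \<Lambda>" "y' \<in> int_vecs \<Lambda>"
      and eq: "dim_class \<Lambda> x n = dim_class \<Lambda> x' n'" "dim_class \<Lambda> y m = dim_class \<Lambda> y' m'"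
    for x n y m x' n' y' m'
  proof -
    obtain l where l: "n \<le> l" "n' \<le> l" "vec_mat \<Lambda> x (to_nat (l - n)) = vec_mat \<Lambda> x' (to_nat (l - n'))"
      using eq(1) v unfolding dim_class_eq_iff[OF v(1,3)] by blast
    obtain k where k: "m \<le> k" "m' \<le> k" "vec_mat \<Lambda> y (to_nat (k - m)) = vec_mat \<Lambda> y' (to_nat (k - m'))"
      using eq(2) v unfolding dim_class_eq_iff[OF v(2,4)] by blast
    have le: "n \<le> sup l k" "n' \<le> sup l k" "m \<le> sup l k" "m' \<le> sup l k"
      using l k by (auto intro: le_supI1 le_supI2)
    \<comment> \<open>Both sums are moved to \<open>sup l k\<close>, which lies above all four
      levels and above both witnesses.\<close>
    show ?thesis
      using vec_mat_eq_mono[OF l(1,2) sup_ge1 l(3)] vec_mat_eq_mono[OF k(1,2) sup_ge2 k(3)]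
      by (simp add: G[OF le(1,3)] G[OF le(2,4)])
  qed
  have "dim_class \<Lambda> x n \<otimes>\<^bsub>dim_group \<Lambda>\<^esub> dim_class \<Lambda> y m =
    (\<Union>(x', n')\<in>dim_class \<Lambda> x n. \<Union>(y', m')\<in>dim_class \<Lambda> y m. G x' n' y' m')"
    by (simp add: dim_group_def G_def)
  also have "\<dots> = (\<Union>(x', n')\<in>dim_class \<Lambda> x n. G x' n' y m)"
  proof (rule SUP_cong[OF HOL.refl], clarify)
    fix x' n' assume "(x', n') \<in> dim_class \<Lambda> x n"
    then have "x' \<in> int_vecs \<Lambda>" by (simp add: dim_class_def dim_rel_iff)
    then show "(\<Union>(y', m')\<in>dim_class \<Lambda> y m. G x' n' y' m') = G x' n' y m"
      using assms by (intro UN_dim_class G_cong) auto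
  qed
  also have "\<dots> = G x n y m"
    using assms by (intro UN_dim_class G_cong) auto
  finally show ?thesis using G assms by simp
qed

lemma dim_mult:
  assumes "x \<in> int_vecs \<Lambda>" "y \<in> int_vecs \<Lambda>"
  shows "dim_class \<Lambda> x n \<otimes>\<^bsub>dim_group \<Lambda>\<^esub> dim_class \<Lambda> y n = dim_class \<Lambda> (x + y) n"
proof -
  have "to_nat (n - n) = 0" by (simp add: to_nat_def fun_eq_iff)
  then show ?thesis using dim_mult_lift[OF assms order_refl order_refl] assms by (simp add: vec_mat_0)
qed

lemma dim_carrier_iff:
  "P \<in> carrier (dim_group \<Lambda>) \<longleftrightarrow> (\<exists>x n. x \<in> int_vecs \<Lambda> \<and> P = dim_class \<Lambda> x n)"
  by (auto simp: dim_group_def quotient_def dim_class_def)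

lemma dim_class_carrier [simp]: "x \<in> int_vecs \<Lambda> \<Longrightarrow> dim_class \<Lambda> x n \<in> carrier (dim_group \<Lambda>)"
  by (auto simp: dim_carrier_iff)

lemma dim_carrierE:
  assumes "P \<in> carrier (dim_group \<Lambda>)"
  obtains x n where "x \<in> int_vecs \<Lambda>" "P = dim_class \<Lambda> x n" "N \<le> n"
proof -
  obtain x n where "x \<in> int_vecs \<Lambda>" "P = dim_class \<Lambda> x n" using assms by (auto simp: dim_carrier_iff)
  then show thesis using dim_class_lift[of x n "sup n N"]
      that[of "vec_mat \<Lambda> x (to_nat (sup n N - n))" "sup n N"] by simp
qed

text \<open>With representatives at one level the group law is plain addition of vectors.\<close>

lemma dim_carrierE2:
  assumes "P \<in> carrier (dim_group \<Lambda>)" "Q \<in> carrier (dim_group \<Lambda>)"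
  obtains x y n where "x \<in> int_vecs \<Lambda>" "P = dim_class \<Lambda> x n" "y \<in> int_vecs \<Lambda>" "Q = dim_class \<Lambda> y n" "N \<le> n"
proof -
  obtain x n where "x \<in> int_vecs \<Lambda>" "P = dim_class \<Lambda> x n" "N \<le> n" using assms(1) by (rule dim_carrierE)
  moreover obtain y m where "y \<in> int_vecs \<Lambda>" "Q = dim_class \<Lambda> y m" "n \<le> m" using assms(2) by (rule dim_carrierE)
  ultimately show thesis
    using dim_class_lift[of x n m] that[of "vec_mat \<Lambda> x (to_nat (m - n))" m y] by simp
qed

lemma dim_one: "\<one>\<^bsub>dim_group \<Lambda>\<^esub> = dim_class \<Lambda> 0 0"
  by (simp add: dim_group_def)

lemma dim_class_0: "dim_class \<Lambda> 0 n = \<one>\<^bsub>dim_group \<Lambda>\<^esub>"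
  by (auto simp: dim_one dim_class_eq_iff intro!: exI[of _ "sup n 0"])

lemma comm_group_dim_group: "comm_group (dim_group \<Lambda>)"
proof (rule comm_groupI)
  fix P Q assume P: "P \<in> carrier (dim_group \<Lambda>)" and Q: "Q \<in> carrier (dim_group \<Lambda>)"
  obtain x y n where *: "x \<in> int_vecs \<Lambda>" "P = dim_class \<Lambda> x n" "y \<in> int_vecs \<Lambda>" "Q = dim_class \<Lambda> y n"
    using P Q by (rule dim_carrierE2)
  show "P \<otimes>\<^bsub>dim_group \<Lambda>\<^esub> Q \<in> carrier (dim_group \<Lambda>)" using * by (simp add: dim_mult)
  show "P \<otimes>\<^bsub>dim_group \<Lambda>\<^esub> Q = Q \<otimes>\<^bsub>dim_group \<Lambda>\<^esub> P" using * by (simp add: dim_mult add.commute)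
next
  fix P Q R assume P: "P \<in> carrier (dim_group \<Lambda>)" and Q: "Q \<in> carrier (dim_group \<Lambda>)"
    and R: "R \<in> carrier (dim_group \<Lambda>)"
  obtain x y n where *: "x \<in> int_vecs \<Lambda>" "P = dim_class \<Lambda> x n" "y \<in> int_vecs \<Lambda>" "Q = dim_class \<Lambda> y n"
    using P Q by (rule dim_carrierE2)
  obtain z m where z: "z \<in> int_vecs \<Lambda>" "R = dim_class \<Lambda> z m" "n \<le> m" using R by (rule dim_carrierE)
  show "P \<otimes>\<^bsub>dim_group \<Lambda>\<^esub> Q \<otimes>\<^bsub>dim_group \<Lambda>\<^esub> R = P \<otimes>\<^bsub>dim_group \<Lambda>\<^esub> (Q \<otimes>\<^bsub>dim_group \<Lambda>\<^esub> R)"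
    using * z by (simp add: dim_class_lift[of _ n m] dim_mult add.assoc)
next
  fix P assume "P \<in> carrier (dim_group \<Lambda>)"
  then obtain x n where *: "x \<in> int_vecs \<Lambda>" "P = dim_class \<Lambda> x n" by (auto simp: dim_carrier_iff)
  then have "\<one>\<^bsub>dim_group \<Lambda>\<^esub> \<otimes>\<^bsub>dim_group \<Lambda>\<^esub> P = P"
    by (simp add: dim_class_0[of n, symmetric] dim_mult)
  then show "\<one>\<^bsub>dim_group \<Lambda>\<^esub> \<otimes>\<^bsub>dim_group \<Lambda>\<^esub> P = P" .
  have "dim_class \<Lambda> (- x) n \<otimes>\<^bsub>dim_group \<Lambda>\<^esub> P = \<one>\<^bsub>dim_group \<Lambda>\<^esub>"
    using * by (simp add: dim_mult dim_class_0)
  then show "\<exists>Q\<in>carrier (dim_group \<Lambda>). Q \<otimes>\<^bsub>dim_group \<Lambda>\<^esub> P = \<one>\<^bsub>dim_group \<Lambda>\<^esub>"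
    using * by (intro bexI[of _ "dim_class \<Lambda> (- x) n"]) simp_all
qed (simp add: dim_one)

lemma dim_act_class: "x \<in> int_vecs \<Lambda> \<Longrightarrow> dim_act \<Lambda> m (dim_class \<Lambda> x n) = dim_class \<Lambda> x (n + m)"
  unfolding dim_act_def
proof (rule UN_dim_class)
  fix y k assume x: "x \<in> int_vecs \<Lambda>" and y: "y \<in> int_vecs \<Lambda>" and "dim_class \<Lambda> y k = dim_class \<Lambda> x n"
  then obtain l where "k \<le> l" "n \<le> l" "vec_mat \<Lambda> y (to_nat (l - k)) = vec_mat \<Lambda> x (to_nat (l - n))"
    by (auto simp: dim_class_eq_iff)
  then show "dim_class \<Lambda> y (k + m) = dim_class \<Lambda> x (n + m)"
    using x y by (auto simp: dim_class_eq_iff le_fun_def intro!: exI[of _ "l + m"])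
qed

lemma dim_act_carrier [simp]: "P \<in> carrier (dim_group \<Lambda>) \<Longrightarrow> dim_act \<Lambda> m P \<in> carrier (dim_group \<Lambda>)"
  by (metis dim_act_class dim_carrier_iff)

lemma dim_act_add: "P \<in> carrier (dim_group \<Lambda>) \<Longrightarrow> dim_act \<Lambda> m (dim_act \<Lambda> n P) = dim_act \<Lambda> (m + n) P"
  by (auto simp: dim_carrier_iff dim_act_class add_ac)

lemma dim_act_0: "P \<in> carrier (dim_group \<Lambda>) \<Longrightarrow> dim_act \<Lambda> 0 P = P"
  by (auto simp: dim_carrier_iff dim_act_class)

text \<open>Multiplying by the matrix of degree \<open>basis_vec i\<close> while keeping the level
  amounts to keeping the vector and lowering the level. So commuting with the \<delta> is
  equivariance under the negative basis vectors.\<close>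

lemma dim_delta_act:
  assumes "P \<in> carrier (dim_group \<Lambda>)"
  shows "dim_delta \<Lambda> i P = dim_act \<Lambda> (- basis_vec i) P"
proof -
  obtain x n where x: "x \<in> int_vecs \<Lambda>" and P: "P = dim_class \<Lambda> x n"
    using assms by (auto simp: dim_carrier_iff)
  have *: "dim_class \<Lambda> (vec_mat \<Lambda> y (basis_vec i)) m = dim_class \<Lambda> y (m - basis_vec i)"
    if "y \<in> int_vecs \<Lambda>" for y m
    using dim_class_lift_nat[OF that, of "basis_vec i" "m - basis_vec i"] by simp
  have "dim_delta \<Lambda> i P = dim_class \<Lambda> (vec_mat \<Lambda> x (basis_vec i)) n"
    unfolding dim_delta_def P
  proof (rule UN_dim_class[OF x])
    fix y m assume y: "y \<in> int_vecs \<Lambda>" and "dim_class \<Lambda> y m = dim_class \<Lambda> x n"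
    \<comment> \<open>Independence of the representative is inherited from the action, which is
      already known to be well defined on classes.\<close>
    then have "dim_act \<Lambda> (- basis_vec i) (dim_class \<Lambda> y m) = dim_act \<Lambda> (- basis_vec i) (dim_class \<Lambda> x n)"
      by simp
    then show "dim_class \<Lambda> (vec_mat \<Lambda> y (basis_vec i)) m = dim_class \<Lambda> (vec_mat \<Lambda> x (basis_vec i)) n"
      using x y by (simp add: dim_act_class *)
  qed
  then show ?thesis using x by (simp add: P * dim_act_class)
qed

lemma dim_pos_carrier: "dim_pos \<Lambda> \<subseteq> carrier (dim_group \<Lambda>)"
  by (auto simp: dim_pos_def)

lemma dim_posE:
  assumes "P \<in> dim_pos \<Lambda>"
  obtains x n where "x \<in> int_vecs \<Lambda>" "0 \<le> x" "P = dim_class \<Lambda> x n" "N \<le> n"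
proof -
  obtain x n where "x \<in> int_vecs \<Lambda>" "0 \<le> x" "P = dim_class \<Lambda> x n" using assms by (auto simp: dim_pos_def)
  then show thesis using dim_class_lift[of x n "sup n N"] vec_mat_nonneg[of x]
      that[of "vec_mat \<Lambda> x (to_nat (sup n N - n))" "sup n N"] by simp
qed

lemma dim_class_pos: "x \<in> int_vecs \<Lambda> \<Longrightarrow> 0 \<le> x \<Longrightarrow> dim_class \<Lambda> x n \<in> dim_pos \<Lambda>"
  by (auto simp: dim_pos_def)

lemma dim_act_pos: "P \<in> dim_pos \<Lambda> \<Longrightarrow> dim_act \<Lambda> m P \<in> dim_pos \<Lambda>"
  unfolding dim_pos_def using dim_act_class by blast

lemma dim_pos_mult:
  assumes "P \<in> dim_pos \<Lambda>" "Q \<in> dim_pos \<Lambda>"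
  shows "P \<otimes>\<^bsub>dim_group \<Lambda>\<^esub> Q \<in> dim_pos \<Lambda>"
proof -
  obtain x n where x: "x \<in> int_vecs \<Lambda>" "0 \<le> x" "P = dim_class \<Lambda> x n" using assms(1) by (rule dim_posE)
  obtain y m where y: "y \<in> int_vecs \<Lambda>" "0 \<le> y" "Q = dim_class \<Lambda> y m" "n \<le> m" using assms(2) by (rule dim_posE)
  have P: "P = dim_class \<Lambda> (vec_mat \<Lambda> x (to_nat (m - n))) m"
    unfolding x(3) using x(1) y(4) by (rule dim_class_lift)
  have "0 \<le> vec_mat \<Lambda> x (to_nat (m - n)) + y"
    using vec_mat_nonneg[OF x(2), of "to_nat (m - n)"] y(2) by (simp add: le_fun_def)
  then show ?thesis unfolding P y(3) using y(1) by (simp add: dim_mult dim_class_pos)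
qed

end

section \<open>Infinite paths and cylinder sets\<close>

context kgraph begin

lemma mem_Omega_k [simp]: "(p, q) \<in> mor Omega_k \<longleftrightarrow> p \<le> q"
  by (simp add: Omega_k_def)

lemma ipath_props:
  assumes "x \<in> ipaths \<Lambda>" "p \<le> q"
  shows ipath_mor: "x (p, q) \<in> mor \<Lambda>"
    and rng_ipath: "rng \<Lambda> (x (p, q)) = x (p, p)"
    and src_ipath: "src \<Lambda> (x (p, q)) = x (q, q)"
    and deg_ipath: "deg \<Lambda> (x (p, q)) = q - p"
    and cmp_ipath: "q \<le> r \<Longrightarrow> cmp \<Lambda> (x (p, q)) (x (q, r)) = x (p, r)"
proof -
  note O = Omega_k_def
  have pm: "(p, q) \<in> mor (Omega_k :: (_, 'k) kgr)" using assms(2) by simp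
  have x: "x a \<in> mor \<Lambda>" "rng \<Lambda> (x a) = x (rng Omega_k a)" "src \<Lambda> (x a) = x (src Omega_k a)"
    "deg \<Lambda> (x a) = deg Omega_k a" if "a \<in> mor Omega_k" for a
    using assms(1) that unfolding ipaths_def by blast+
  show "x (p, q) \<in> mor \<Lambda>" "rng \<Lambda> (x (p, q)) = x (p, p)" "src \<Lambda> (x (p, q)) = x (q, q)"
    "deg \<Lambda> (x (p, q)) = q - p"
    using x[OF pm] unfolding O by simp_all
  show "cmp \<Lambda> (x (p, q)) (x (q, r)) = x (p, r)" if "q \<le> r"
  proof -
    have qm: "(q, r) \<in> mor (Omega_k :: (_, 'k) kgr)" using that by simp
    have "src (Omega_k :: (_, 'k) kgr) (p, q) = rng Omega_k (q, r)" by (simp add: O)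
    then have "x (cmp Omega_k (p, q) (q, r)) = cmp \<Lambda> (x (p, q)) (x (q, r))"
      using assms(1) pm qm unfolding ipaths_def by blast
    then show ?thesis unfolding O by simp
  qed
qed

lemma ipathI:
  assumes "\<And>a. a \<notin> mor Omega_k \<Longrightarrow> x a = undefined"
    and "\<And>p q. p \<le> q \<Longrightarrow> x (p, q) \<in> mor \<Lambda> \<and> rng \<Lambda> (x (p, q)) = x (p, p) \<and>
      src \<Lambda> (x (p, q)) = x (q, q) \<and> deg \<Lambda> (x (p, q)) = q - p"
    and "\<And>p q r. p \<le> q \<Longrightarrow> q \<le> r \<Longrightarrow> cmp \<Lambda> (x (p, q)) (x (q, r)) = x (p, r)"
  shows "x \<in> ipaths \<Lambda>"
proof -
  note O = Omega_k_def
  have "x a \<in> mor \<Lambda> \<and> rng \<Lambda> (x a) = x (rng Omega_k a) \<and> src \<Lambda> (x a) = x (src Omega_k a) \<and>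
    deg \<Lambda> (x a) = deg Omega_k a" if "a \<in> mor Omega_k" for a
    using assms(2)[of "fst a" "snd a"] that by (simp add: O case_prod_unfold)
  moreover have "x (cmp Omega_k a b) = cmp \<Lambda> (x a) (x b)"
    if "a \<in> mor Omega_k" "b \<in> mor Omega_k" "src Omega_k a = rng Omega_k b" for a b
    using assms(3)[of "fst a" "snd a" "snd b"] that by (cases a; cases b) (simp add: O)
  ultimately show ?thesis using assms(1) by (simp add: ipaths_def PiE_iff extensional_def)
qed

lemma pfx_sfx_ipath:
  assumes "x \<in> ipaths \<Lambda>" "p \<le> q"
  shows pfx_ipath: "pfx p (x (0, q)) = x (0, p)" and sfx_ipath: "sfx p (x (0, q)) = x (p, q)"
proof -
  have z: "0 \<le> p" "0 \<le> q" by (auto simp: le_fun_def)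
  have "x (0, q) = cmp \<Lambda> (x (0, p)) (x (p, q))" using cmp_ipath[of x 0 p q] assms z by simp
  moreover have "deg \<Lambda> (x (0, p)) = p" using deg_ipath[of x 0 p] assms z by simp
  moreover have "src \<Lambda> (x (0, p)) = rng \<Lambda> (x (p, q))"
    using src_ipath[of x 0 p] rng_ipath[of x p q] assms z by simp
  ultimately show "pfx p (x (0, q)) = x (0, p)" "sfx p (x (0, q)) = x (p, q)"
    using ipath_mor[of x 0 p] ipath_mor[of x p q] assms z by (simp_all add: pfx_cmp)
qed

lemma fun_nat_zero_le [simp]: "(0 :: 'k \<Rightarrow> nat) \<le> p"
  by (auto simp: le_fun_def)

text \<open>The value at \<open>(p, q)\<close> is the suffix of the initial segment of degree
  \<open>q\<close>, hence initial segments determine the path.\<close>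

lemma ipath_eqI:
  assumes "x \<in> ipaths \<Lambda>" "y \<in> ipaths \<Lambda>" "\<And>n. x (0, n) = y (0, n)"
  shows "x = y"
proof
  fix a :: "('k \<Rightarrow> nat) \<times> ('k \<Rightarrow> nat)"
  obtain p q where a: "a = (p, q)" by (cases a)
  show "x a = y a"
  proof (cases "p \<le> q")
    case True
    then show ?thesis using sfx_ipath[of x p q] sfx_ipath[of y p q] assms a by simp
  next
    case False
    then have "a \<notin> mor Omega_k" using a by simp
    \<comment> \<open>Outside the arrows of \<open>Omega_k\<close> both functions take the default
      value of extensional functions.\<close>
    moreover have "z \<in> extensional (mor Omega_k)" if "z \<in> ipaths \<Lambda>" for z :: "('a, 'k) ipath"
      using that by (simp add: ipaths_def PiE_def)
    ultimately show ?thesis using assms(1,2) by (metis extensional_arb)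
  qed
qed

text \<open>The value at \<open>(p, q)\<close> can only be the suffix of \<open>F q\<close> past
  degree \<open>p\<close>. Concatenations and the limit paths of Koenig's lemma are both obtained
  from this construction.\<close>

lemma ipath_of_prefixes:
  assumes F: "\<And>n. F n \<in> mor \<Lambda>" "\<And>n. deg \<Lambda> (F n) = n" "\<And>n m. n \<le> m \<Longrightarrow> pfx n (F m) = F n"
  shows "\<exists>x\<in>ipaths \<Lambda>. \<forall>n. x (0, n) = F n"
proof -
  define x where "x = restrict (\<lambda>(p, q). sfx p (F q)) (mor Omega_k)"
  have x: "x (p, q) = sfx p (F q)" if "p \<le> q" for p q using that by (simp add: x_def)
  have F_sfx: "sfx p (F q) \<in> mor \<Lambda>" "src \<Lambda> (F p) = rng \<Lambda> (sfx p (F q))"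
    "cmp \<Lambda> (F p) (sfx p (F q)) = F q" "deg \<Lambda> (sfx p (F q)) = q - p" "src \<Lambda> (sfx p (F q)) = src \<Lambda> (F q)"
    if "p \<le> q" for p q
    using pfx_sfx[of "F q" p] F that by auto
  have x_self: "x (p, p) = src \<Lambda> (F p)" for p
    using sfx_cmp_eq[of "F p" "src \<Lambda> (F p)" p] F by (simp add: x cmp_src src_mor rng_src)
  have "x \<in> ipaths \<Lambda>"
  proof (rule ipathI)
    fix p q r :: "'k \<Rightarrow> nat" assume pq: "p \<le> q" and qr: "q \<le> r"
    note P = F_sfx[OF pq] and Q = F_sfx[OF qr] and R = F_sfx[OF order_trans[OF pq qr]]
    \<comment> \<open>Functoriality: both candidates for the suffix of \<open>F r\<close> past
      \<open>p\<close> compose with \<open>F p\<close> to \<open>F r\<close>, so they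
      coincide.\<close>
    have "cmp \<Lambda> (F p) (cmp \<Lambda> (sfx p (F q)) (sfx q (F r))) = F r"
      using cmp_assoc[of "F p" "sfx p (F q)" "sfx q (F r)"] P Q F by simp
    then have "sfx p (F r) = cmp \<Lambda> (sfx p (F q)) (sfx q (F r))"
      using sfx_cmp_eq[of "F p" "cmp \<Lambda> (sfx p (F q)) (sfx q (F r))" p] P Q F
      by (simp add: cmp_mor rng_cmp)
    then show "cmp \<Lambda> (x (p, q)) (x (q, r)) = x (p, r)" using pq qr by (simp add: x)
  qed (use F_sfx x x_self in \<open>auto simp: x_def\<close>)
  moreover have "x (0, n) = F n" for n
  proof -
    \<comment> \<open>\<open>F 0\<close> has degree zero, hence is a vertex, and splitting it off
      leaves \<open>F n\<close> unchanged.\<close>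
    have "F 0 = rng \<Lambda> (sfx 0 (F n))"
      using F_sfx(2)[of 0 n] F(1,2)[of 0] vertex_iff[of "F 0"] by (simp add: paths_def)
    then show ?thesis using F_sfx[of 0 n] by (simp add: x cmp_rng)
  qed
  ultimately show ?thesis by blast
qed

section \<open>Shifts and concatenation of infinite paths\<close>

lemma shift_apply: "m \<le> n \<Longrightarrow> shift p x (m, n) = x (m + p, n + p)"
  by (simp add: shift_def)

lemma add_mono_fun: "m \<le> n \<Longrightarrow> m + p \<le> n + (p :: 'k \<Rightarrow> nat)"
  by (auto simp: le_fun_def)

lemma shift_ipath: "x \<in> ipaths \<Lambda> \<Longrightarrow> shift p x \<in> ipaths \<Lambda>"
proof (rule ipathI)
  fix m n assume x: "x \<in> ipaths \<Lambda>" and mn: "m \<le> (n :: 'k \<Rightarrow> nat)"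
  have "n + p - (m + p) = n - m" by (simp add: fun_eq_iff)
  then show "shift p x (m, n) \<in> mor \<Lambda> \<and> rng \<Lambda> (shift p x (m, n)) = shift p x (m, m) \<and>
      src \<Lambda> (shift p x (m, n)) = shift p x (n, n) \<and> deg \<Lambda> (shift p x (m, n)) = n - m"
    using ipath_props[OF x add_mono_fun[OF mn, of p]] mn by (simp add: shift_apply)
next
  fix m n r assume x: "x \<in> ipaths \<Lambda>" and mn: "m \<le> n" "n \<le> (r :: 'k \<Rightarrow> nat)"
  show "cmp \<Lambda> (shift p x (m, n)) (shift p x (n, r)) = shift p x (m, r)"
    using cmp_ipath[OF x add_mono_fun[OF mn(1), of p] add_mono_fun[OF mn(2), of p]] mn order_trans[OF mn]
    by (simp add: shift_apply)
qed (simp add: shift_def)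

lemma shift_shift: "shift p (shift q x) = shift (p + q) x"
  by (auto simp: shift_def fun_eq_iff restrict_def add_mono_fun add.assoc)

lemma ipath_split:
  assumes "x \<in> ipaths \<Lambda>"
  shows "x (0, p + n) = cmp \<Lambda> (x (0, p)) (shift p x (0, n))"
    and "src \<Lambda> (x (0, p)) = shift p x (0, 0)"
proof -
  have "p \<le> p + n" by (auto simp: le_fun_def)
  then show "x (0, p + n) = cmp \<Lambda> (x (0, p)) (shift p x (0, n))"
    using cmp_ipath[of x 0 p "p + n"] assms by (simp add: shift_apply add.commute)
  show "src \<Lambda> (x (0, p)) = shift p x (0, 0)"
    using src_ipath[of x 0 p] assms by (simp add: shift_apply)
qed

text \<open>Initial segment and shift together give all segments of degrees \<open>p + n\<close>,
  and every degree \<open>n\<close> lies below \<open>p + n\<close>.\<close>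

lemma ipath_eqI_shift:
  assumes "x \<in> ipaths \<Lambda>" "y \<in> ipaths \<Lambda>" "x (0, p) = y (0, p)" "shift p x = shift p y"
  shows "x = y"
proof (rule ipath_eqI[OF assms(1,2)])
  fix n
  have "x (0, p + n) = y (0, p + n)" using assms by (simp add: ipath_split(1))
  moreover have "n \<le> p + n" by (auto simp: le_fun_def)
  ultimately show "x (0, n) = y (0, n)" using pfx_ipath[of x n "p + n"] pfx_ipath[of y n "p + n"] assms by simp
qed

text \<open>The composites of \<open>l\<close> with initial segments of \<open>z\<close> are
  compatible but have degrees shifted by that of \<open>l\<close>; cutting them back gives a
  compatible family of initial segments of all degrees. Uniqueness holds because prefix and shift
  determine a path.\<close>

lemma ex1_concat:
  assumes "l \<in> mor \<Lambda>" "z \<in> ipaths \<Lambda>" "z (0, 0) = src \<Lambda> l"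
  shows "\<exists>!x. x \<in> ipaths \<Lambda> \<and> x (0, deg \<Lambda> l) = l \<and> shift (deg \<Lambda> l) x = z"
proof -
  have z: "z (0, n) \<in> mor \<Lambda>" "rng \<Lambda> (z (0, n)) = src \<Lambda> l" "deg \<Lambda> (z (0, n)) = n" for n
    using ipath_props[of z 0 n] assms by auto
  define E where "E n = cmp \<Lambda> l (z (0, n))" for n
  have E: "E n \<in> mor \<Lambda>" "deg \<Lambda> (E n) = deg \<Lambda> l + n" for n
    using z assms by (auto simp: E_def cmp_mor deg_cmp)
  \<comment> \<open>\<open>E m\<close> extends \<open>E n\<close> by the part of \<open>z\<close>
    between \<open>n\<close> and \<open>m\<close>, so their prefixes agree as far as
    \<open>E n\<close> reaches.\<close>
  have E_step: "E m = cmp \<Lambda> (E n) (z (n, m)) \<and> z (n, m) \<in> mor \<Lambda> \<and> src \<Lambda> (E n) = rng \<Lambda> (z (n, m))"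
    if "n \<le> m" for n m
  proof -
    have a: "z (0, m) = cmp \<Lambda> (z (0, n)) (z (n, m))" using cmp_ipath[of z 0 n m] assms that by simp
    have b: "z (n, m) \<in> mor \<Lambda>" "src \<Lambda> (z (0, n)) = rng \<Lambda> (z (n, m))"
      using ipath_props[of z n m] src_ipath[of z 0 n] assms that by auto
    show ?thesis using b z assms by (auto simp: E_def a cmp_assoc src_cmp)
  qed
  have E_pfx: "pfx q (E m) = pfx q (E n)" if "n \<le> m" "q \<le> deg \<Lambda> l + n" for n m q
    using E_step[OF that(1)] E that(2) by (simp add: pfx_cmp_le)
  have le: "n \<le> deg \<Lambda> l + n" for n by (auto simp: le_fun_def)
  have "\<exists>x\<in>ipaths \<Lambda>. \<forall>n. x (0, n) = pfx n (E n)"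
  proof (rule ipath_of_prefixes)
    fix n m :: "'k \<Rightarrow> nat" assume nm: "n \<le> m"
    then have "pfx n (pfx m (E m)) = pfx n (E m)" using E le by (intro pfx_pfx) auto
    then show "pfx n (pfx m (E m)) = pfx n (E n)" using E_pfx[OF nm le] by simp
  qed (use E le in \<open>auto simp: pfx_mor deg_pfx\<close>)
  then obtain x where x: "x \<in> ipaths \<Lambda>" "\<And>n. x (0, n) = pfx n (E n)" by blast
  have xl: "x (0, deg \<Lambda> l + n) = E n" for n
  proof -
    have "pfx (deg \<Lambda> l + n) (E (deg \<Lambda> l + n)) = pfx (deg \<Lambda> l + n) (E n)"
      using le by (intro E_pfx) auto
    also have "\<dots> = E n" using E pfx_self by metis
    finally show ?thesis by (simp add: x)
  qed
  have l: "x (0, deg \<Lambda> l) = l"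
    using xl[of 0] z(1)[of 0] assms by (simp add: E_def cmp_src)
  have "shift (deg \<Lambda> l) x = z"
  proof (rule ipath_eqI)
    fix n
    have s: "shift (deg \<Lambda> l) x (0, n) \<in> mor \<Lambda>" "src \<Lambda> l = rng \<Lambda> (shift (deg \<Lambda> l) x (0, n))"
      using ipath_props[OF shift_ipath[OF x(1), of "deg \<Lambda> l"], of 0 n] ipath_split(2)[OF x(1), of "deg \<Lambda> l"] l by auto
    \<comment> \<open>Both composites are the segment of degree \<open>deg \<Lambda> l + n\<close>
      of the glued path; cancelling \<open>l\<close> by unique factorization compares the
      tails.\<close>
    have "cmp \<Lambda> l (shift (deg \<Lambda> l) x (0, n)) = cmp \<Lambda> l (z (0, n))"
      using ipath_split(1)[OF x(1), of "deg \<Lambda> l" n] l xl[of n] by (simp add: E_def)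
    then show "shift (deg \<Lambda> l) x (0, n) = z (0, n)"
      using fact_unique(2)[of l "shift (deg \<Lambda> l) x (0, n)" l "z (0, n)"] s z assms by simp
  qed (use x assms shift_ipath in auto)
  moreover have "y = x" if "y \<in> ipaths \<Lambda> \<and> y (0, deg \<Lambda> l) = l \<and> shift (deg \<Lambda> l) y = z" for y
    by (rule ipath_eqI_shift[of y x "deg \<Lambda> l"]) (use that x(1) l calculation in simp_all)
  ultimately show ?thesis using x(1) l by blast
qed

lemma concat_path:
  assumes "l \<in> mor \<Lambda>" "z \<in> ipaths \<Lambda>" "z (0, 0) = src \<Lambda> l"
  shows "concat_path \<Lambda> l z \<in> ipaths \<Lambda>" "concat_path \<Lambda> l z (0, deg \<Lambda> l) = l"
    "shift (deg \<Lambda> l) (concat_path \<Lambda> l z) = z"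
  using theI'[OF ex1_concat[OF assms]] unfolding concat_path_def by auto

lemma concat_path_shift:
  assumes "x \<in> ipaths \<Lambda>" "x (0, deg \<Lambda> l) = l"
  shows "concat_path \<Lambda> l (shift (deg \<Lambda> l) x) = x"
proof -
  have "l \<in> mor \<Lambda>" using ipath_mor[of x 0 "deg \<Lambda> l"] assms by simp
  moreover have "shift (deg \<Lambda> l) x (0, 0) = src \<Lambda> l"
    using ipath_split(2)[OF assms(1), of "deg \<Lambda> l"] unfolding assms(2) by (rule HOL.sym)
  ultimately have C: "concat_path \<Lambda> l (shift (deg \<Lambda> l) x) \<in> ipaths \<Lambda>"
    "concat_path \<Lambda> l (shift (deg \<Lambda> l) x) (0, deg \<Lambda> l) = l"
    "shift (deg \<Lambda> l) (concat_path \<Lambda> l (shift (deg \<Lambda> l) x)) = shift (deg \<Lambda> l) x"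
    using concat_path[OF _ shift_ipath[OF assms(1)]] by blast+
  show ?thesis using C(1) assms(1) HOL.trans[OF C(2) assms(2)[symmetric]] C(3) by (rule ipath_eqI_shift)
qed

section \<open>Cylinder sets and their subdivision\<close>

text \<open>Cutting off the prefix inverts concatenation, so membership is a test on one value of
  the path and the definite description in \<open>concat_path\<close> drops out.\<close>

lemma cylinder_iff:
  assumes "l \<in> mor \<Lambda>"
  shows "x \<in> cylinder \<Lambda> l \<longleftrightarrow> x \<in> ipaths \<Lambda> \<and> x (0, deg \<Lambda> l) = l"
proof
  show "x \<in> cylinder \<Lambda> l \<Longrightarrow> x \<in> ipaths \<Lambda> \<and> x (0, deg \<Lambda> l) = l"
    using concat_path assms by (auto simp: cylinder_def)
  assume *: "x \<in> ipaths \<Lambda> \<and> x (0, deg \<Lambda> l) = l"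
  show "x \<in> cylinder \<Lambda> l" unfolding cylinder_def
    using * concat_path_shift[of x l] shift_ipath[of x] ipath_split(2)[of x "deg \<Lambda> l"]
    by (intro CollectI exI[of _ "shift (deg \<Lambda> l) x"]) simp
qed

lemma cylinder2_iff:
  assumes "l \<in> mor \<Lambda>" "m \<in> mor \<Lambda>" "src \<Lambda> l = src \<Lambda> m"
  shows "(x, c, y) \<in> cylinder2 \<Lambda> l m \<longleftrightarrow> c = to_int (deg \<Lambda> l) - to_int (deg \<Lambda> m) \<and>
    x \<in> cylinder \<Lambda> l \<and> y \<in> cylinder \<Lambda> m \<and> shift (deg \<Lambda> l) x = shift (deg \<Lambda> m) y"
proof
  show "(x, c, y) \<in> cylinder2 \<Lambda> l m \<Longrightarrow> c = to_int (deg \<Lambda> l) - to_int (deg \<Lambda> m) \<and>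
    x \<in> cylinder \<Lambda> l \<and> y \<in> cylinder \<Lambda> m \<and> shift (deg \<Lambda> l) x = shift (deg \<Lambda> m) y"
    using concat_path assms by (auto simp: cylinder2_def cylinder_iff)
  assume *: "c = to_int (deg \<Lambda> l) - to_int (deg \<Lambda> m) \<and>
    x \<in> cylinder \<Lambda> l \<and> y \<in> cylinder \<Lambda> m \<and> shift (deg \<Lambda> l) x = shift (deg \<Lambda> m) y"
  then have x: "x \<in> ipaths \<Lambda>" "x (0, deg \<Lambda> l) = l" and y: "y \<in> ipaths \<Lambda>" "y (0, deg \<Lambda> m) = m"
    using assms by (auto simp: cylinder_iff)
  show "(x, c, y) \<in> cylinder2 \<Lambda> l m" unfolding cylinder2_def
    using * concat_path_shift[OF x] concat_path_shift[OF y] shift_ipath[OF y(1), of "deg \<Lambda> m"] ipath_split(2)[OF x(1), of "deg \<Lambda> l"] x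
    by (intro CollectI exI[of _ "shift (deg \<Lambda> l) x"]) simp
qed

lemma cylinder_prefix: "x \<in> ipaths \<Lambda> \<Longrightarrow> x \<in> cylinder \<Lambda> (x (0, n))"
  using ipath_props[of x 0 n] by (simp add: cylinder_iff)

lemma cylinder_cmp:
  assumes "l \<in> mor \<Lambda>" "a \<in> mor \<Lambda>" "src \<Lambda> l = rng \<Lambda> a"
  shows "x \<in> cylinder \<Lambda> (cmp \<Lambda> l a) \<longleftrightarrow> x \<in> cylinder \<Lambda> l \<and> shift (deg \<Lambda> l) x \<in> cylinder \<Lambda> a"
proof -
  have le: "deg \<Lambda> l \<le> deg \<Lambda> l + deg \<Lambda> a" by (auto simp: le_fun_def)
  have "x (0, deg \<Lambda> l + deg \<Lambda> a) = cmp \<Lambda> l a \<longleftrightarrow> x (0, deg \<Lambda> l) = l \<and> shift (deg \<Lambda> l) x (0, deg \<Lambda> a) = a"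
    if x: "x \<in> ipaths \<Lambda>"
  proof
    assume e: "x (0, deg \<Lambda> l + deg \<Lambda> a) = cmp \<Lambda> l a"
    have "shift (deg \<Lambda> l) x (0, deg \<Lambda> a) = sfx (deg \<Lambda> l) (x (0, deg \<Lambda> l + deg \<Lambda> a))"
      using sfx_ipath[OF x le] by (simp add: shift_apply add.commute)
    then show "x (0, deg \<Lambda> l) = l \<and> shift (deg \<Lambda> l) x (0, deg \<Lambda> a) = a"
      using pfx_ipath[OF x le] e assms by (simp add: pfx_cmp)
  qed (use ipath_split(1)[OF x, of "deg \<Lambda> l" "deg \<Lambda> a"] in auto)
  then show ?thesis using assms shift_ipath by (auto simp: cylinder_iff cmp_mor deg_cmp)
qed

text \<open>The extension to use for a path is read off as the segment of degree \<open>n\<close>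
  that follows \<open>l\<close>.\<close>

lemma cylinder_split:
  assumes "l \<in> mor \<Lambda>"
  shows "cylinder \<Lambda> l = (\<Union>a\<in>paths_from \<Lambda> (src \<Lambda> l) n. cylinder \<Lambda> (cmp \<Lambda> l a))"
proof -
  have "\<exists>a\<in>paths_from \<Lambda> (src \<Lambda> l) n. x \<in> cylinder \<Lambda> (cmp \<Lambda> l a)" if x: "x \<in> cylinder \<Lambda> l" for x
  proof -
    let ?a = "shift (deg \<Lambda> l) x (0, n)"
    have s: "shift (deg \<Lambda> l) x \<in> ipaths \<Lambda>" using x assms shift_ipath by (auto simp: cylinder_iff)
    have "src \<Lambda> l = rng \<Lambda> ?a"
      using ipath_split(2)[of x "deg \<Lambda> l"] x assms rng_ipath[OF s, of 0 n] by (auto simp: cylinder_iff)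
    then show ?thesis
      using x assms ipath_props[OF s, of 0 n] cylinder_prefix[OF s]
      by (intro bexI[of _ ?a]) (auto simp: cylinder_cmp paths_from_iff)
  qed
  moreover have "x \<in> cylinder \<Lambda> l" if "a \<in> paths_from \<Lambda> (src \<Lambda> l) n" "x \<in> cylinder \<Lambda> (cmp \<Lambda> l a)" for x a
    using that cylinder_cmp[of l a x] assms by (simp add: paths_from_iff)
  ultimately show ?thesis by blast
qed

text \<open>The two units of an arrow share their tail after \<open>l\<close> and \<open>m\<close>.
  Prescribing the beginning of that tail on the range side therefore prescribes it on the source
  side.\<close>

lemma cylinder2_cmp:
  assumes "l \<in> mor \<Lambda>" "m \<in> mor \<Lambda>" "src \<Lambda> l = src \<Lambda> m" "a \<in> mor \<Lambda>" "src \<Lambda> l = rng \<Lambda> a"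
  shows "(x, c, y) \<in> cylinder2 \<Lambda> (cmp \<Lambda> l a) (cmp \<Lambda> m a) \<longleftrightarrow>
    (x, c, y) \<in> cylinder2 \<Lambda> l m \<and> x \<in> cylinder \<Lambda> (cmp \<Lambda> l a)"
proof -
  have m: "src \<Lambda> m = rng \<Lambda> a" using assms by simp
  note C = cmp_mor[OF assms(1,4,5)] cmp_mor[OF assms(2,4) m]
  have src: "src \<Lambda> (cmp \<Lambda> l a) = src \<Lambda> (cmp \<Lambda> m a)"
    using src_cmp[OF assms(1,4,5)] src_cmp[OF assms(2,4) m] by simp
  have deg: "deg \<Lambda> (cmp \<Lambda> l a) = deg \<Lambda> a + deg \<Lambda> l" "deg \<Lambda> (cmp \<Lambda> m a) = deg \<Lambda> a + deg \<Lambda> m"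
    using deg_cmp[OF assms(1,4,5)] deg_cmp[OF assms(2,4) m] by (simp_all add: add.commute)
  let ?x = "shift (deg \<Lambda> l) x" and ?y = "shift (deg \<Lambda> m) y"
  have iff1: "(x, c, y) \<in> cylinder2 \<Lambda> (cmp \<Lambda> l a) (cmp \<Lambda> m a) \<longleftrightarrow> c = to_int (deg \<Lambda> l) - to_int (deg \<Lambda> m) \<and>
    x \<in> cylinder \<Lambda> l \<and> ?x \<in> cylinder \<Lambda> a \<and> y \<in> cylinder \<Lambda> m \<and> ?y \<in> cylinder \<Lambda> a \<and>
    shift (deg \<Lambda> a) ?x = shift (deg \<Lambda> a) ?y"
    unfolding cylinder2_iff[OF C src] cylinder_cmp[OF assms(1,4,5)] cylinder_cmp[OF assms(2,4) m] deg shift_shift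
    by auto
  have eq: "?x = ?y" if "?x \<in> cylinder \<Lambda> a" "?y \<in> cylinder \<Lambda> a" "shift (deg \<Lambda> a) ?x = shift (deg \<Lambda> a) ?y"
    using that unfolding cylinder_iff[OF assms(4)] by (intro ipath_eqI_shift[of ?x ?y "deg \<Lambda> a"]) simp_all
  show ?thesis
    unfolding iff1 cylinder2_iff[OF assms(1-3)] cylinder_cmp[OF assms(1,4,5)] using eq by metis
qed

lemma cylinder2_split:
  assumes "l \<in> mor \<Lambda>" "m \<in> mor \<Lambda>" "src \<Lambda> l = src \<Lambda> m"
  shows "cylinder2 \<Lambda> l m = (\<Union>a\<in>paths_from \<Lambda> (src \<Lambda> l) n. cylinder2 \<Lambda> (cmp \<Lambda> l a) (cmp \<Lambda> m a))"
proof -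
  have "g \<in> cylinder2 \<Lambda> l m \<longleftrightarrow> (\<exists>a\<in>paths_from \<Lambda> (src \<Lambda> l) n. g \<in> cylinder2 \<Lambda> (cmp \<Lambda> l a) (cmp \<Lambda> m a))" for g
  proof (cases g)
    case (fields x c y)
    have "x \<in> cylinder \<Lambda> l \<longleftrightarrow> (\<exists>a\<in>paths_from \<Lambda> (src \<Lambda> l) n. x \<in> cylinder \<Lambda> (cmp \<Lambda> l a))"
      using cylinder_split[OF assms(1), of n] by auto
    moreover have "(x, c, y) \<in> cylinder2 \<Lambda> l m \<Longrightarrow> x \<in> cylinder \<Lambda> l" using assms by (simp add: cylinder2_iff)
    moreover have "(x, c, y) \<in> cylinder2 \<Lambda> (cmp \<Lambda> l a) (cmp \<Lambda> m a) \<longleftrightarrow>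
      (x, c, y) \<in> cylinder2 \<Lambda> l m \<and> x \<in> cylinder \<Lambda> (cmp \<Lambda> l a)" if "a \<in> paths_from \<Lambda> (src \<Lambda> l) n" for a
      using that assms by (intro cylinder2_cmp) (simp_all add: paths_from_iff)
    ultimately show ?thesis unfolding fields by metis
  qed
  then show ?thesis unfolding set_eq_iff UN_iff by blast
qed

end

context finite_kgraph begin

section \<open>Koenig's lemma and compactness\<close>

text \<open>If \<open>P l\<close> fails, \<open>up\<close> allows failing extensions to be chosen
  forever; the resulting infinite path has a prefix with \<open>P\<close>, and \<open>down\<close>
  carries \<open>P\<close> to a later stage of the sequence, a contradiction. Finite branching
  enters where \<open>up\<close> is verified.\<close>

lemma koenig:
  assumes l: "l \<in> mor \<Lambda>"
    and up: "\<And>m. m \<in> mor \<Lambda> \<Longrightarrow> (\<And>a. a \<in> paths_from \<Lambda> (src \<Lambda> m) 1 \<Longrightarrow> P (cmp \<Lambda> m a)) \<Longrightarrow> P m"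
    and down: "\<And>m a. m \<in> mor \<Lambda> \<Longrightarrow> a \<in> mor \<Lambda> \<Longrightarrow> src \<Lambda> m = rng \<Lambda> a \<Longrightarrow> P m \<Longrightarrow> P (cmp \<Lambda> m a)"
    and path: "\<And>x. x \<in> cylinder \<Lambda> l \<Longrightarrow> \<exists>n. P (x (0, n))"
  shows "P l"
proof (rule ccontr)
  assume "\<not> P l"
  \<comment> \<open>Here \<open>1\<close> is the constant function: each step advances every
    coordinate, so the stages eventually dominate every degree.\<close>
  define nxt where "nxt m = (SOME a. a \<in> paths_from \<Lambda> (src \<Lambda> m) 1 \<and> \<not> P (cmp \<Lambda> m a))" for m
  have nxt: "nxt m \<in> mor \<Lambda>" "rng \<Lambda> (nxt m) = src \<Lambda> m" "deg \<Lambda> (nxt m) = 1" "\<not> P (cmp \<Lambda> m (nxt m))"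
    if "m \<in> mor \<Lambda>" "\<not> P m" for m
  proof -
    have "\<exists>a. a \<in> paths_from \<Lambda> (src \<Lambda> m) 1 \<and> \<not> P (cmp \<Lambda> m a)" using up that by blast
    from someI_ex[OF this, folded nxt_def]
    show "nxt m \<in> mor \<Lambda>" "rng \<Lambda> (nxt m) = src \<Lambda> m" "deg \<Lambda> (nxt m) = 1" "\<not> P (cmp \<Lambda> m (nxt m))"
      by (auto simp: paths_from_iff)
  qed
  define s where "s j = ((\<lambda>m. cmp \<Lambda> m (nxt m)) ^^ j) l" for j
  have s0: "s 0 = l" and sS: "s (Suc j) = cmp \<Lambda> (s j) (nxt (s j))" for j by (simp_all add: s_def)
  have s: "s j \<in> mor \<Lambda> \<and> \<not> P (s j)" for j
  proof (induction j)
    case 0 then show ?case using l \<open>\<not> P l\<close> by (simp add: s0)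
  next
    case (Suc j) then show ?case using nxt[of "s j"] by (simp add: sS cmp_mor)
  qed
  have deg_s: "deg \<Lambda> (s j) = deg \<Lambda> l + (\<lambda>_. j)" for j
  proof (induction j)
    case 0 then show ?case by (simp add: s0 fun_eq_iff)
  next
    case (Suc j) then show ?case using nxt[of "s j"] s[of j] by (simp add: sS deg_cmp fun_eq_iff)
  qed
  have pfx_s: "pfx p (s j) = pfx p (s i)" if "i \<le> j" "p \<le> deg \<Lambda> (s i)" for i j p
    using that(1)
  proof (induction j rule: dec_induct)
    case base then show ?case by simp
  next
    case (step j)
    have "p \<le> deg \<Lambda> (s j)" using that(2) step by (auto simp: deg_s le_fun_def intro: order_trans)
    then show ?case using step nxt[of "s j"] s[of j] by (simp add: sS pfx_cmp_le)
  qed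
  \<comment> \<open>\<open>J n\<close> is a stage that is long enough to have a prefix of degree
    \<open>n\<close>; any later stage gives the same prefix.\<close>
  define J where "J n = (SOME j. n \<le> (\<lambda>_. j))" for n :: "'k \<Rightarrow> nat"
  have J: "n \<le> (\<lambda>_. J n)" for n unfolding J_def by (rule someI_ex[OF ex_const_ge])
  have le: "n \<le> deg \<Lambda> (s j)" if "n \<le> (\<lambda>_. j)" for n j
    using that by (auto simp: deg_s le_fun_def intro: le_add_same_cancel2 trans_le_add2)
  have pfx_J: "pfx n (s j) = pfx n (s i)" if "n \<le> deg \<Lambda> (s j)" "n \<le> deg \<Lambda> (s i)" for n i j
    using pfx_s[of i j n] pfx_s[of j i n] that by (cases "i \<le> j") auto
  have "\<exists>x\<in>ipaths \<Lambda>. \<forall>n. x (0, n) = pfx n (s (J n))"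
  proof (rule ipath_of_prefixes)
    fix n m :: "'k \<Rightarrow> nat" assume nm: "n \<le> m"
    have "n \<le> deg \<Lambda> (s (J m))" using le[OF J] nm order_trans by blast
    then have "pfx n (s (J m)) = pfx n (s (J n))" using le[OF J] by (intro pfx_J) auto
    then show "pfx n (pfx m (s (J m))) = pfx n (s (J n))" using pfx_pfx[of "s (J m)" m n] s le[OF J] nm by simp
  qed (use s le[OF J] in \<open>auto simp: pfx_mor deg_pfx\<close>)
  then obtain x where x: "x \<in> ipaths \<Lambda>" "\<And>n. x (0, n) = pfx n (s (J n))" by blast
  have xs: "x (0, deg \<Lambda> (s j)) = s j" for j
    using x(2)[of "deg \<Lambda> (s j)"] pfx_J[of "deg \<Lambda> (s j)" "J (deg \<Lambda> (s j))" j] le[OF J] s[of j] by simp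
  have "x \<in> cylinder \<Lambda> l" using x(1) l xs[of 0] by (simp add: cylinder_iff s0)
  then obtain n where n: "P (x (0, n))" using path by blast
  have "n \<le> deg \<Lambda> (s (J n))" using le[OF J] .
  then have "s (J n) = cmp \<Lambda> (x (0, n)) (x (n, deg \<Lambda> (s (J n))))" "x (n, deg \<Lambda> (s (J n))) \<in> mor \<Lambda>"
    "src \<Lambda> (x (0, n)) = rng \<Lambda> (x (n, deg \<Lambda> (s (J n))))" "x (0, n) \<in> mor \<Lambda>"
    using xs[of "J n"] cmp_ipath[of x 0 n "deg \<Lambda> (s (J n))"] ipath_props[of x n "deg \<Lambda> (s (J n))"]
      ipath_props[of x 0 n] x(1) by auto
  then have "P (s (J n))" using down n by metis
  then show False using s by blast
qed

text \<open>Koenig's lemma for the predicate that is never true: absence of sources means that every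
  path has an extension, so \<open>up\<close> holds.\<close>

lemma cylinder_nonempty: "l \<in> mor \<Lambda> \<Longrightarrow> cylinder \<Lambda> l \<noteq> {}"
proof
  assume l: "l \<in> mor \<Lambda>" and empty: "cylinder \<Lambda> l = {}"
  show False
  proof (rule koenig[OF l, of "\<lambda>_. False"])
    fix m assume "m \<in> mor \<Lambda>" and none: "\<And>a. a \<in> paths_from \<Lambda> (src \<Lambda> m) 1 \<Longrightarrow> False"
    then have "paths_from \<Lambda> (src \<Lambda> m) 1 \<noteq> {}" by (intro paths_from_nonempty) simp
    then show False using none by blast
  qed (use empty in auto)
qed

text \<open>The predicate is being covered by finitely many members of the given cover; finite
  branching makes it pass from extensions to the path. The map \<open>pt\<close> lets one argument
  serve cylinders (identity map) and bisections (the section of the range map).\<close>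

lemma koenig_compactin:
  assumes l: "l \<in> mor \<Lambda>" and sub: "pt ` cylinder \<Lambda> l \<subseteq> topspace T"
    and cont: "\<And>x U. x \<in> cylinder \<Lambda> l \<Longrightarrow> openin T U \<Longrightarrow> pt x \<in> U \<Longrightarrow>
      \<exists>n. pt ` (cylinder \<Lambda> (x (0, n)) \<inter> cylinder \<Lambda> l) \<subseteq> U"
  shows "compactin T (pt ` cylinder \<Lambda> l)"
  unfolding compactin_def
proof (intro conjI allI impI sub)
  fix \<U> assume U: "Ball \<U> (openin T) \<and> pt ` cylinder \<Lambda> l \<subseteq> \<Union> \<U>"
  \<comment> \<open>The intersection with \<open>cylinder \<Lambda> l\<close> is needed because a
    prefix \<open>x (0, n)\<close> may be shorter than \<open>l\<close>, so that its cylinder leaves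
    that of \<open>l\<close>.\<close>
  define P where "P m \<longleftrightarrow> (\<exists>\<F>. finite \<F> \<and> \<F> \<subseteq> \<U> \<and> pt ` (cylinder \<Lambda> m \<inter> cylinder \<Lambda> l) \<subseteq> \<Union> \<F>)" for m
  have "P l"
  proof (rule koenig[OF l])
    fix m assume m: "m \<in> mor \<Lambda>" and "\<And>a. a \<in> paths_from \<Lambda> (src \<Lambda> m) 1 \<Longrightarrow> P (cmp \<Lambda> m a)"
    then have "\<forall>a\<in>paths_from \<Lambda> (src \<Lambda> m) 1. \<exists>\<F>. finite \<F> \<and> \<F> \<subseteq> \<U> \<and>
        pt ` (cylinder \<Lambda> (cmp \<Lambda> m a) \<inter> cylinder \<Lambda> l) \<subseteq> \<Union> \<F>" by (simp add: P_def)
    then obtain \<F> where F: "\<And>a. a \<in> paths_from \<Lambda> (src \<Lambda> m) 1 \<Longrightarrow> finite (\<F> a) \<and> \<F> a \<subseteq> \<U> \<and>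
        pt ` (cylinder \<Lambda> (cmp \<Lambda> m a) \<inter> cylinder \<Lambda> l) \<subseteq> \<Union> (\<F> a)" by metis
    let ?F = "\<Union>a\<in>paths_from \<Lambda> (src \<Lambda> m) 1. \<F> a"
    have "finite ?F" using F finite_paths_from m by auto
    moreover have "?F \<subseteq> \<U>" using F by blast
    moreover have "pt ` (cylinder \<Lambda> m \<inter> cylinder \<Lambda> l) \<subseteq> \<Union> ?F"
      using F unfolding cylinder_split[OF m, of 1] by fastforce
    ultimately show "P m" unfolding P_def by blast
  next
    fix m a assume "m \<in> mor \<Lambda>" "a \<in> mor \<Lambda>" "src \<Lambda> m = rng \<Lambda> a" "P m"
    moreover from this have "cylinder \<Lambda> (cmp \<Lambda> m a) \<subseteq> cylinder \<Lambda> m" by (auto simp: cylinder_cmp)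
    ultimately show "P (cmp \<Lambda> m a)" unfolding P_def by (meson Int_mono image_mono order_refl order_trans)
  next
    fix x assume x: "x \<in> cylinder \<Lambda> l"
    then have "pt x \<in> \<Union> \<U>" using U by (meson imageI subsetD)
    then obtain V where V: "V \<in> \<U>" "pt x \<in> V" by (rule UnionE)
    then have "openin T V" using U by simp
    then obtain n where "pt ` (cylinder \<Lambda> (x (0, n)) \<inter> cylinder \<Lambda> l) \<subseteq> V" using cont x V(2) by metis
    then have "P (x (0, n))" unfolding P_def using V by (intro exI[of _ "{V}"]) auto
    then show "\<exists>n. P (x (0, n))" by blast
  qed
  then show "\<exists>\<F>. finite \<F> \<and> \<F> \<subseteq> \<U> \<and> pt ` cylinder \<Lambda> l \<subseteq> \<Union> \<F>" by (simp add: P_def)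
qed

end

section \<open>Compactly supported integer-valued functions\<close>

lemma continuous_map_discrete_iff:
  "continuous_map X (discrete_topology UNIV) f \<longleftrightarrow> (\<forall>c. openin X {x \<in> topspace X. f x = c})"
proof
  assume *: "\<forall>c. openin X {x \<in> topspace X. f x = c}"
  have "openin X {x \<in> topspace X. f x \<in> U}" for U
  proof -
    have "{x \<in> topspace X. f x \<in> U} = (\<Union>c\<in>U. {x \<in> topspace X. f x = c})" by auto
    then show ?thesis using * by (metis (no_types, lifting) imageE openin_Union)
  qed
  then show "continuous_map X (discrete_topology UNIV) f" by (simp add: continuous_map_def)
next
  assume *: "continuous_map X (discrete_topology UNIV) f"
  show "\<forall>c. openin X {x \<in> topspace X. f x = c}"
  proof
    fix c
    have "openin X {x \<in> topspace X. f x \<in> {c}}"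
      using * by (intro openin_continuous_map_preimage) auto
    then show "openin X {x \<in> topspace X. f x = c}" by simp
  qed
qed

lemma mem_Cc_iff:
  "f \<in> carrier (Cc X) \<longleftrightarrow> (\<forall>c. openin X {x \<in> topspace X. f x = c}) \<and>
    compactin X (X closure_of {x \<in> topspace X. f x \<noteq> 0}) \<and> (\<forall>x. x \<notin> topspace X \<longrightarrow> f x = 0)"
  by (simp add: Cc_def continuous_map_discrete_iff)

lemma compactin_closure_of_mono:
  "compactin X (X closure_of S) \<Longrightarrow> R \<subseteq> S \<Longrightarrow> compactin X (X closure_of R)"
  using closed_compactin closedin_closure_of closure_of_mono by metis

lemma Cc_zero: "0 \<in> carrier (Cc X)"
proof -
  have "{x \<in> topspace X. (0 :: 'a \<Rightarrow> int) x = c} = (if c = 0 then topspace X else {})" for c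
    by auto
  then show ?thesis by (simp add: mem_Cc_iff)
qed

lemma Cc_uminus: "f \<in> carrier (Cc X) \<Longrightarrow> - f \<in> carrier (Cc X)"
proof -
  assume f: "f \<in> carrier (Cc X)"
  have "{x \<in> topspace X. (- f) x = c} = {x \<in> topspace X. f x = - c}" for c by auto
  then show ?thesis using f by (simp add: mem_Cc_iff)
qed

lemma Cc_add:
  assumes f: "f \<in> carrier (Cc X)" and g: "g \<in> carrier (Cc X)"
  shows "f + g \<in> carrier (Cc X)"
proof -
  have "openin X {x \<in> topspace X. (f + g) x = c}" for c
  proof -
    have "{x \<in> topspace X. (f + g) x = c} =
      (\<Union>a. {x \<in> topspace X. f x = a} \<inter> {x \<in> topspace X. g x = c - a})" by auto
    then show ?thesis using f g unfolding mem_Cc_iff by (auto intro!: openin_Union openin_Int)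
  qed
  moreover have "compactin X (X closure_of {x \<in> topspace X. (f + g) x \<noteq> 0})"
  proof (rule compactin_closure_of_mono)
    show "compactin X (X closure_of ({x \<in> topspace X. f x \<noteq> 0} \<union> {x \<in> topspace X. g x \<noteq> 0}))"
      using f g by (simp add: mem_Cc_iff compactin_Un)
  qed auto
  ultimately show ?thesis using f g by (simp add: mem_Cc_iff)
qed

lemma Cc_simps [simp]: "mult (Cc X) f g = f + g" "one (Cc X) = 0"
  by (simp_all add: Cc_def)

lemma comm_group_Cc: "comm_group (Cc X)"
proof (rule comm_groupI)
  fix f assume "f \<in> carrier (Cc X)"
  then show "\<exists>g\<in>carrier (Cc X). g \<otimes>\<^bsub>Cc X\<^esub> f = \<one>\<^bsub>Cc X\<^esub>"
    by (intro bexI[of _ "- f"]) (auto intro: Cc_uminus)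
qed (auto simp: Cc_add Cc_zero add_ac)

lemma Cc_inv: "f \<in> carrier (Cc X) \<Longrightarrow> inv\<^bsub>Cc X\<^esub> f = - f"
  using comm_group_Cc[of X] Cc_uminus[of f X]
  by (intro group.inv_equality) (simp_all add: comm_group_def)

lemma Cc_diff: "f \<in> carrier (Cc X) \<Longrightarrow> g \<in> carrier (Cc X) \<Longrightarrow> f - g \<in> carrier (Cc X)"
  using Cc_add[of f X "- g"] Cc_uminus[of g X] by simp

definition scaled :: "int \<Rightarrow> 'x set \<Rightarrow> 'x \<Rightarrow> int" where
  "scaled c W = (\<lambda>x. if x \<in> W then c else 0)"

lemma scaled_1: "scaled 1 W = indicator W"
  by (auto simp: scaled_def fun_eq_iff)

text \<open>
  A base of compact open sets which is filtered by a directed set of levels: each level partitions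
  its union, and the partitions become finer as the level grows.
\<close>
locale level_base =
  fixes T :: "'x topology" and B :: "'l::semilattice_sup \<Rightarrow> 'x set \<Rightarrow> bool"
  assumes base: "\<And>U x. openin T U \<Longrightarrow> x \<in> U \<Longrightarrow> \<exists>L W. B L W \<and> x \<in> W \<and> W \<subseteq> U"
    and B_open: "\<And>L W. B L W \<Longrightarrow> openin T W"
    and B_compact: "\<And>L W. B L W \<Longrightarrow> compactin T W"
    and B_disj: "\<And>L W W'. B L W \<Longrightarrow> B L W' \<Longrightarrow> W = W' \<or> W \<inter> W' = {}"
    and B_refine: "\<And>L L' W. B L W \<Longrightarrow> L \<le> L' \<Longrightarrow> \<exists>D. finite D \<and> (\<forall>W'\<in>D. B L' W') \<and> \<Union>D = W"

text \<open>All members are subdivided at one level above all of theirs; sets of that level are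
  equal or disjoint, so a piece lies inside or outside each member. The fact is stated apart from
  the locale because it also proves the base property the locale assumes.\<close>

lemma refine_family:
  fixes B :: "'l::semilattice_sup \<Rightarrow> 'x set \<Rightarrow> bool"
  assumes disj: "\<And>L W W'. B L W \<Longrightarrow> B L W' \<Longrightarrow> W = W' \<or> W \<inter> W' = {}"
    and refine: "\<And>L L' W. B L W \<Longrightarrow> L \<le> L' \<Longrightarrow> \<exists>D. finite D \<and> (\<forall>W'\<in>D. B L' W') \<and> \<Union>D = W"
    and F: "finite F" "\<And>W. W \<in> F \<Longrightarrow> \<exists>L. B L W"
  shows "\<exists>L D. finite D \<and> (\<forall>W\<in>D. B L W) \<and> \<Union>D = \<Union>F \<and> (\<forall>U\<in>F. \<forall>W\<in>D. W \<subseteq> U \<or> W \<inter> U = {})"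
proof -
  from F have "\<exists>L. \<forall>W\<in>F. \<exists>L'\<le>L. B L' W"
  proof (induction F rule: finite_induct)
    case (insert W F)
    have "\<exists>L. \<forall>W\<in>F. \<exists>L'\<le>L. B L' W" using insert.IH insert.prems by (metis insertI2)
    then obtain L where L: "\<forall>W\<in>F. \<exists>L'\<le>L. B L' W" by blast
    obtain K where K: "B K W" using insert.prems[OF insertI1] by (elim exE)
    have "\<forall>W'\<in>insert W F. \<exists>L'\<le>sup L K. B L' W'"
    proof (intro ballI)
      fix W' assume "W' \<in> insert W F"
      then show "\<exists>L'\<le>sup L K. B L' W'"
      proof (rule insertE)
        assume "W' \<in> F"
        with L show ?thesis using le_supI1 by metis
      qed (use K sup_ge2 in metis)
    qed
    then show ?case by blast
  qed simp
  then obtain L where "\<forall>W\<in>F. \<exists>L'\<le>L. B L' W" by blast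
  then have "\<forall>W\<in>F. \<exists>D. finite D \<and> (\<forall>W'\<in>D. B L W') \<and> \<Union>D = W" using refine by metis
  then obtain D where D: "\<And>W. W \<in> F \<Longrightarrow> finite (D W) \<and> (\<forall>W'\<in>D W. B L W') \<and> \<Union>(D W) = W" by metis
  have "W \<subseteq> U \<or> W \<inter> U = {}" if *: "U \<in> F" "W \<in> D V" "V \<in> F" for U V W
  proof (cases "W \<inter> U = {}")
    case False
    then obtain W' where W': "W' \<in> D U" "W \<inter> W' \<noteq> {}" using D[OF *(1)] by blast
    then have "B L W'" "B L W" using D * by blast+
    then have "W = W'" using disj W'(2) by blast
    then show ?thesis using W'(1) D[OF *(1)] by blast
  qed blast
  moreover have "\<Union>(\<Union>(D ` F)) = (\<Union>W\<in>F. \<Union>(D W))" by blast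
  then have "\<Union>(\<Union>(D ` F)) = \<Union>F" using D by simp
  ultimately show ?thesis using D F(1) by (intro exI[of _ L] exI[of _ "\<Union>(D ` F)"]) auto
qed

text \<open>Only intersections need an argument: a common refinement of the two basic neighbourhoods
  has a piece containing the point, and that piece must lie inside both.\<close>

lemma generated_base:
  fixes B :: "'l::semilattice_sup \<Rightarrow> 'x set \<Rightarrow> bool"
  assumes disj: "\<And>L W W'. B L W \<Longrightarrow> B L W' \<Longrightarrow> W = W' \<or> W \<inter> W' = {}"
    and refine: "\<And>L L' W. B L W \<Longrightarrow> L \<le> L' \<Longrightarrow> \<exists>D. finite D \<and> (\<forall>W'\<in>D. B L' W') \<and> \<Union>D = W"
    and "openin (topology_generated_by {W. \<exists>L. B L W}) U" "x \<in> U"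
  shows "\<exists>L W. B L W \<and> x \<in> W \<and> W \<subseteq> U"
proof -
  have "generate_topology_on {W. \<exists>L. B L W} U" using assms(3) by (rule openin_topology_generated_by)
  then show ?thesis using assms(4)
  proof (induction arbitrary: x)
    case (Int a b)
    have "x \<in> a" "x \<in> b" using Int.prems by auto
    obtain L W where 1: "B L W" "x \<in> W" "W \<subseteq> a" using Int.IH(1)[OF \<open>x \<in> a\<close>] by blast
    obtain L' W' where 2: "B L' W'" "x \<in> W'" "W' \<subseteq> b" using Int.IH(2)[OF \<open>x \<in> b\<close>] by blast
    note * = 1 2
    have "\<exists>L. B L V" if "V \<in> {W, W'}" for V using * that by blast
    then have "\<exists>L D. finite D \<and> (\<forall>V\<in>D. B L V) \<and> \<Union>D = \<Union>{W, W'} \<and> (\<forall>U\<in>{W, W'}. \<forall>V\<in>D. V \<subseteq> U \<or> V \<inter> U = {})"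
      by (intro refine_family disj refine) auto
    then obtain K D where D: "\<forall>W\<in>D. B K W" "\<Union>D = \<Union>{W, W'}" "\<forall>U\<in>{W, W'}. \<forall>W\<in>D. W \<subseteq> U \<or> W \<inter> U = {}"
      by (elim exE conjE)
    have "x \<in> \<Union>D" unfolding D(2) using * by simp
    then obtain V where V: "V \<in> D" "x \<in> V" by blast
    have "V \<subseteq> W" "V \<subseteq> W'" using D(3) V *(2,5) by auto
    then show ?case using V D(1) * by (intro exI[of _ K] exI[of _ V]) auto
  next
    case (UN K)
    then obtain k where k: "k \<in> K" "x \<in> k" by blast
    from UN.IH[OF this] show ?case using Union_upper[OF k(1)] by (meson order_trans)
  qed auto
qed

context level_base begin

text \<open>A basic set around a point outside \<open>W\<close>, refined together with
  \<open>W\<close>, has a piece that contains the point and is therefore disjoint from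
  \<open>W\<close>. Clopen basic sets make multiples of their characteristic functions continuous
  with compact support.\<close>

lemma B_closed:
  assumes "B L W"
  shows "closedin T W"
proof -
  have "\<exists>V. openin T V \<and> x \<in> V \<and> V \<subseteq> topspace T - W" if x: "x \<in> topspace T - W" for x
  proof -
    obtain K V where V: "B K V" "x \<in> V" using base[OF openin_topspace, of x] x by blast
    have "\<exists>L. B L U" if "U \<in> {W, V}" for U using assms V that by blast
    then have "\<exists>L D. finite D \<and> (\<forall>W\<in>D. B L W) \<and> \<Union>D = \<Union>{W, V} \<and> (\<forall>U\<in>{W, V}. \<forall>W\<in>D. W \<subseteq> U \<or> W \<inter> U = {})"
      by (intro refine_family B_disj B_refine) auto
    then obtain M D where D: "\<forall>W\<in>D. B M W" "\<Union>D = \<Union>{W, V}" "\<forall>U\<in>{W, V}. \<forall>W\<in>D. W \<subseteq> U \<or> W \<inter> U = {}"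
      by (elim exE conjE)
    have "x \<in> \<Union>D" unfolding D(2) using V by simp
    then obtain V' where V': "V' \<in> D" "x \<in> V'" by blast
    then have "V' \<inter> W = {}" using D(3) x by blast
    moreover have "openin T V'" using V' D(1) B_open by blast
    ultimately show ?thesis using V'(2) openin_subset[of T V'] by blast
  qed
  then have "openin T (topspace T - W)" by (subst openin_subopen) blast
  then show ?thesis using B_open[OF assms] openin_subset by (auto simp: closedin_def)
qed

lemma scaled_Cc:
  assumes "B L W"
  shows "scaled c W \<in> carrier (Cc T)"
proof -
  have W: "openin T W" "W \<subseteq> topspace T" "compactin T W" "closedin T W"
    using assms B_open B_compact B_closed openin_subset by blast+
  then have op: "openin T (topspace T - W)" by blast
  have "openin T {x \<in> topspace T. scaled c W x = a}" for a
  proof -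
    have "{x \<in> topspace T. scaled c W x = a} =
      (if a = c then W else {}) \<union> (if a = 0 then topspace T - W else {})"
      using W(2) by (auto simp: scaled_def)
    then show ?thesis using op W(1) by (simp add: openin_Un)
  qed
  moreover have "compactin T (T closure_of {x \<in> topspace T. scaled c W x \<noteq> 0})"
  proof (rule compactin_closure_of_mono)
    show "compactin T (T closure_of W)" using W(3,4) by (simp add: closure_of_closedin)
    show "{x \<in> topspace T. scaled c W x \<noteq> 0} \<subseteq> W" by (auto simp: scaled_def)
  qed
  moreover have "scaled c W x = 0" if "x \<notin> topspace T" for x
    using W(2) that by (auto simp: scaled_def)
  ultimately show ?thesis by (simp add: mem_Cc_iff)
qed

text \<open>Finitely many basic sets on which \<open>f\<close> is constant cover the closed support;
  at one level they become disjoint, so the sum counts no point twice. Coefficients in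
  \<open>range f\<close> ensure that a nonnegative function has nonnegative coefficients.\<close>

lemma Cc_decomp:
  assumes f: "f \<in> carrier (Cc T)"
  obtains L D c where "finite D" "\<And>W. W \<in> D \<Longrightarrow> B L W" "\<And>W. W \<in> D \<Longrightarrow> c W \<in> range f"
    "f = (\<Sum>W\<in>D. scaled (c W) W)"
proof -
  let ?K = "T closure_of {x \<in> topspace T. f x \<noteq> 0}"
  have K: "compactin T ?K" and f0: "\<And>x. x \<notin> topspace T \<Longrightarrow> f x = 0"
    and fo: "\<And>c. openin T {x \<in> topspace T. f x = c}" using f by (auto simp: mem_Cc_iff)
  define \<U> where "\<U> = {W. (\<exists>L. B L W) \<and> (\<forall>x\<in>W. \<forall>y\<in>W. f x = f y)}"
  have "\<exists>W\<in>\<U>. x \<in> W" if x: "x \<in> topspace T" for x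
  proof -
    obtain L W where W: "B L W" "x \<in> W" "W \<subseteq> {y \<in> topspace T. f y = f x}"
      using base[OF fo, of x "f x"] x by blast
    have "f y = f x" if "y \<in> W" for y using that W(3) by blast
    then have "W \<in> \<U>" unfolding \<U>_def using W(1) by (intro CollectI conjI ballI exI[of _ L]) simp_all
    then show ?thesis using W(2) by blast
  qed
  then have "?K \<subseteq> \<Union>\<U>" using closure_of_subset_topspace[of T] by blast
  moreover have "\<forall>U\<in>\<U>. openin T U" using B_open by (auto simp: \<U>_def)
  ultimately obtain F where F: "finite F" "F \<subseteq> \<U>" "?K \<subseteq> \<Union>F"
    using K unfolding compactin_def by meson
  have "\<exists>L. B L W" if "W \<in> F" for W using F(2) that unfolding \<U>_def by blast
  then have "\<exists>L D. finite D \<and> (\<forall>W\<in>D. B L W) \<and> \<Union>D = \<Union>F \<and> (\<forall>U\<in>F. \<forall>W\<in>D. W \<subseteq> U \<or> W \<inter> U = {})"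
    using F(1) by (intro refine_family B_disj B_refine)
  then obtain L D where D: "finite D" "\<forall>W\<in>D. B L W" "\<Union>D = \<Union>F" "\<forall>U\<in>F. \<forall>W\<in>D. W \<subseteq> U \<or> W \<inter> U = {}"
    by (elim exE conjE)
  \<comment> \<open>An empty \<open>W\<close> gets the value at an arbitrary point. That value still
    lies in \<open>range f\<close>, and its summand vanishes.\<close>
  define c where "c W = f (SOME x. x \<in> W)" for W
  have fc: "f x = c W" if *: "W \<in> D" "x \<in> W" for x W
  proof -
    have "x \<in> \<Union>F" using * unfolding D(3)[symmetric] by blast
    then obtain U where U: "U \<in> F" "x \<in> U" by blast
    then have "W \<subseteq> U" using D(4) * by blast
    moreover have "(SOME x. x \<in> W) \<in> W" using *(2) by (rule someI)
    ultimately show ?thesis using U F(2) unfolding \<U>_def c_def by blast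
  qed
  have "f x = (\<Sum>W\<in>D. scaled (c W) W) x" for x
  proof (cases "x \<in> \<Union>D")
    case True
    then obtain W where W: "W \<in> D" "x \<in> W" by blast
    have "(\<Sum>V\<in>D. scaled (c V) V) x = (\<Sum>V\<in>D. scaled (c V) V x)" by (induction D rule: infinite_finite_induct) auto
    also have "\<dots> = (\<Sum>V\<in>D. if V = W then c W else 0)"
    proof (rule sum.cong[OF HOL.refl])
      fix V assume V: "V \<in> D"
      \<comment> \<open>All members of \<open>D\<close> have the same level \<open>L\<close>, so
        \<open>W\<close> is the only one that contains \<open>x\<close>.\<close>
      have "V = W \<or> x \<notin> V" using B_disj[of L V W] D(2) V W by blast
      then show "scaled (c V) V x = (if V = W then c W else 0)"
        using W(2) unfolding scaled_def by metis
    qed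
    also have "\<dots> = c W" using W D(1) by simp
    finally show ?thesis using fc W by simp
  next
    case False
    have "f x = 0"
    proof (rule ccontr)
      assume "f x \<noteq> 0"
      then have "x \<in> {x \<in> topspace T. f x \<noteq> 0}" using f0 by blast
      moreover have "{x \<in> topspace T. f x \<noteq> 0} \<subseteq> ?K" by (intro closure_of_subset) auto
      ultimately show False using False F(3) D(3) by blast
    qed
    moreover have "(\<Sum>V\<in>D. scaled (c V) V) x = (\<Sum>V\<in>D. scaled (c V) V x)" by (induction D rule: infinite_finite_induct) auto
    moreover have "(\<Sum>V\<in>D. scaled (c V) V x) = 0" using False by (intro sum.neutral) (auto simp: scaled_def)
    ultimately show ?thesis by simp
  qed
  then have "f = (\<Sum>W\<in>D. scaled (c W) W)" by blast
  then show thesis using that[of D L c] D(1,2) unfolding c_def by blast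
qed

text \<open>Slices over single points of the discrete factor keep all properties: different slices
  are disjoint, and a slice is refined within itself.\<close>

lemma level_base_prod:
  "level_base (prod_topology T (discrete_topology (UNIV :: 'z set)))
    (\<lambda>L V. \<exists>W n. V = W \<times> {n :: 'z} \<and> B L W)"
proof
  fix U and x :: "'x \<times> 'z"
  assume "openin (prod_topology T (discrete_topology UNIV)) U" "x \<in> U"
  moreover obtain y n where x: "x = (y, n)" by (cases x)
  ultimately obtain A C where A: "openin T A" "x \<in> A \<times> C" "A \<times> C \<subseteq> U"
    unfolding openin_prod_topology_alt x by blast
  then obtain L W where "B L W" "fst x \<in> W" "W \<subseteq> A" using base[OF A(1), of "fst x"] by auto
  then show "\<exists>L V. (\<exists>W n. V = W \<times> {n} \<and> B L W) \<and> x \<in> V \<and> V \<subseteq> U"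
    using A by (intro exI[of _ L] exI[of _ "W \<times> {snd x}"]) (auto simp: mem_Times_iff)
next
  fix L V assume "\<exists>W n. V = W \<times> {n :: 'z} \<and> B L W"
  then show "openin (prod_topology T (discrete_topology UNIV)) V"
    by (auto simp: openin_prod_Times_iff B_open)
next
  fix L V assume "\<exists>W n. V = W \<times> {n :: 'z} \<and> B L W"
  then show "compactin (prod_topology T (discrete_topology UNIV)) V"
    by (auto simp: compactin_Times B_compact compactin_discrete_topology)
next
  fix L V V' assume "\<exists>W n. V = W \<times> {n :: 'z} \<and> B L W" "\<exists>W n. V' = W \<times> {n :: 'z} \<and> B L W"
  then show "V = V' \<or> V \<inter> V' = {}" using B_disj by blast
next
  fix L L' V assume "\<exists>W n. V = W \<times> {n :: 'z} \<and> B L W" and L: "L \<le> L'"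
  then obtain W n where W: "V = W \<times> {n}" "B L W" by blast
  obtain D where "finite D" "\<forall>W'\<in>D. B L' W'" "\<Union>D = W" using B_refine[OF W(2) L] by blast
  then show "\<exists>D. finite D \<and> (\<forall>W'\<in>D. \<exists>W n. W' = W \<times> {n} \<and> B L' W) \<and> \<Union>D = V"
    unfolding W(1) by (intro exI[of _ "(\<lambda>W. W \<times> {n}) ` D"]) auto
qed

end

section \<open>The topology of the path groupoid\<close>

context finite_kgraph begin

definition cyl_base :: "('k \<Rightarrow> nat) \<Rightarrow> ('a, 'k) ipath set \<Rightarrow> bool" where
  "cyl_base L W \<longleftrightarrow> (\<exists>l\<in>mor \<Lambda>. deg \<Lambda> l = L \<and> W = cylinder \<Lambda> l)"

text \<open>The level records the degree of the range path only; the cocycle value of an arrow then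
  fixes the degree of the source path.\<close>

definition cyl2_base :: "('k \<Rightarrow> nat) \<Rightarrow> (('a, 'k) ipath \<times> ('k \<Rightarrow> int) \<times> ('a, 'k) ipath) set \<Rightarrow> bool" where
  "cyl2_base L W \<longleftrightarrow> (\<exists>l\<in>mor \<Lambda>. \<exists>m\<in>mor \<Lambda>. src \<Lambda> l = src \<Lambda> m \<and> deg \<Lambda> l = L \<and> W = cylinder2 \<Lambda> l m)"

lemma cyl_base_disj: "cyl_base L W \<Longrightarrow> cyl_base L W' \<Longrightarrow> W = W' \<or> W \<inter> W' = {}"
  unfolding cyl_base_def by (metis cylinder_iff disjoint_iff)

lemma cyl_base_refine:
  assumes "cyl_base L W" "L \<le> L'"
  shows "\<exists>D. finite D \<and> (\<forall>W'\<in>D. cyl_base L' W') \<and> \<Union>D = W"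
proof -
  obtain l where l: "l \<in> mor \<Lambda>" "deg \<Lambda> l = L" "W = cylinder \<Lambda> l" using assms(1) by (auto simp: cyl_base_def)
  let ?P = "paths_from \<Lambda> (src \<Lambda> l) (L' - L)"
  have "cmp \<Lambda> l a \<in> mor \<Lambda> \<and> deg \<Lambda> (cmp \<Lambda> l a) = L'" if "a \<in> ?P" for a
    using that l cmp_mor[of l a] deg_cmp[of l a] fun_diff_add_cancel[OF assms(2)] by (simp add: paths_from_iff)
  then have "\<forall>W'\<in>(\<lambda>a. cylinder \<Lambda> (cmp \<Lambda> l a)) ` ?P. cyl_base L' W'" unfolding cyl_base_def by blast
  moreover have "finite ((\<lambda>a. cylinder \<Lambda> (cmp \<Lambda> l a)) ` ?P)" using finite_paths_from l by simp
  moreover have "\<Union>((\<lambda>a. cylinder \<Lambda> (cmp \<Lambda> l a)) ` ?P) = W" using cylinder_split[OF l(1)] l(3) by simp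
  ultimately show ?thesis by blast
qed

text \<open>A common arrow determines everything: its range gives the first path, its cocycle value
  the degree of the second, and its source the second path itself.\<close>

lemma cyl2_base_disj:
  assumes "cyl2_base L W" "cyl2_base L W'"
  shows "W = W' \<or> W \<inter> W' = {}"
proof (rule disjCI)
  assume "W \<inter> W' \<noteq> {}"
  then obtain x c y where g: "(x, c, y) \<in> W" "(x, c, y) \<in> W'" by auto
  obtain l m where l: "l \<in> mor \<Lambda>" "m \<in> mor \<Lambda>" "src \<Lambda> l = src \<Lambda> m" "deg \<Lambda> l = L" "W = cylinder2 \<Lambda> l m"
    using assms(1) unfolding cyl2_base_def by blast
  obtain l' m' where l': "l' \<in> mor \<Lambda>" "m' \<in> mor \<Lambda>" "src \<Lambda> l' = src \<Lambda> m'" "deg \<Lambda> l' = L" "W' = cylinder2 \<Lambda> l' m'"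
    using assms(2) unfolding cyl2_base_def by blast
  have x: "x (0, L) = l" "y (0, deg \<Lambda> m) = m" "c = to_int L - to_int (deg \<Lambda> m)"
    using g(1) l by (simp_all add: cylinder2_iff cylinder_iff)
  have x': "x (0, L) = l'" "y (0, deg \<Lambda> m') = m'" "c = to_int L - to_int (deg \<Lambda> m')"
    using g(2) l' by (simp_all add: cylinder2_iff cylinder_iff)
  have "to_int (deg \<Lambda> m) = to_int (deg \<Lambda> m')" using x(3) x'(3) by simp
  then have "deg \<Lambda> m = deg \<Lambda> m'" by simp
  then have "m = m'" using x(2) x'(2) by metis
  moreover have "l = l'" using x(1) x'(1) by (rule HOL.trans[OF HOL.sym])
  ultimately show "W = W'" using l(5) l'(5) by simp
qed

lemma cyl2_base_refine:
  assumes "cyl2_base L W" "L \<le> L'"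
  shows "\<exists>D. finite D \<and> (\<forall>W'\<in>D. cyl2_base L' W') \<and> \<Union>D = W"
proof -
  obtain l m where l: "l \<in> mor \<Lambda>" "m \<in> mor \<Lambda>" "src \<Lambda> l = src \<Lambda> m" "deg \<Lambda> l = L" "W = cylinder2 \<Lambda> l m"
    using assms(1) unfolding cyl2_base_def by blast
  let ?P = "paths_from \<Lambda> (src \<Lambda> l) (L' - L)"
  have "cmp \<Lambda> l a \<in> mor \<Lambda> \<and> cmp \<Lambda> m a \<in> mor \<Lambda> \<and> src \<Lambda> (cmp \<Lambda> l a) = src \<Lambda> (cmp \<Lambda> m a) \<and>
    deg \<Lambda> (cmp \<Lambda> l a) = L'" if "a \<in> ?P" for a
    using that l cmp_mor[of l a] deg_cmp[of l a] cmp_mor[of m a] src_cmp[of l a] src_cmp[of m a]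
      fun_diff_add_cancel[OF assms(2)] by (simp add: paths_from_iff)
  then have "\<forall>W'\<in>(\<lambda>a. cylinder2 \<Lambda> (cmp \<Lambda> l a) (cmp \<Lambda> m a)) ` ?P. cyl2_base L' W'"
    unfolding cyl2_base_def by blast
  moreover have "finite ((\<lambda>a. cylinder2 \<Lambda> (cmp \<Lambda> l a) (cmp \<Lambda> m a)) ` ?P)" using finite_paths_from l(1) by simp
  moreover have "\<Union>((\<lambda>a. cylinder2 \<Lambda> (cmp \<Lambda> l a) (cmp \<Lambda> m a)) ` ?P) = W"
    using cylinder2_split[OF l(1,2,3)] l(5) by simp
  ultimately show ?thesis by blast
qed

lemma obj_top_eq: "obj_top (path_groupoid \<Lambda>) = topology_generated_by {W. \<exists>L. cyl_base L W}"
  unfolding path_groupoid_def cyl_base_def by (simp, intro arg_cong[where f = topology_generated_by]) blast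

lemma arr_top_eq: "arr_top (path_groupoid \<Lambda>) = topology_generated_by {W. \<exists>L. cyl2_base L W}"
  unfolding path_groupoid_def cyl2_base_def by (simp, intro arg_cong[where f = topology_generated_by]) blast

lemma obj_base:
  assumes "openin (obj_top (path_groupoid \<Lambda>)) U" "x \<in> U"
  shows "\<exists>L W. cyl_base L W \<and> x \<in> W \<and> W \<subseteq> U"
  using assms cyl_base_disj cyl_base_refine unfolding obj_top_eq by (intro generated_base) 

lemma arr_base:
  assumes "openin (arr_top (path_groupoid \<Lambda>)) U" "g \<in> U"
  shows "\<exists>L W. cyl2_base L W \<and> g \<in> W \<and> W \<subseteq> U"
  using assms cyl2_base_disj cyl2_base_refine unfolding arr_top_eq by (intro generated_base)

lemma cyl_base_open: "cyl_base L W \<Longrightarrow> openin (obj_top (path_groupoid \<Lambda>)) W"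
  unfolding obj_top_eq by (rule topology_generated_by_Basis) blast

lemma cyl2_base_open: "cyl2_base L W \<Longrightarrow> openin (arr_top (path_groupoid \<Lambda>)) W"
  unfolding arr_top_eq by (rule topology_generated_by_Basis) blast

lemma level_base_obj: "level_base (obj_top (path_groupoid \<Lambda>)) cyl_base"
proof
  fix L W assume W: "cyl_base L W"
  then obtain l where l: "l \<in> mor \<Lambda>" "W = cylinder \<Lambda> l" by (auto simp: cyl_base_def)
  have "compactin (obj_top (path_groupoid \<Lambda>)) ((\<lambda>x. x) ` cylinder \<Lambda> l)"
  proof (rule koenig_compactin[OF l(1)])
    show "(\<lambda>x. x) ` cylinder \<Lambda> l \<subseteq> topspace (obj_top (path_groupoid \<Lambda>))"
      using cyl_base_open[OF W] openin_subset l(2) by auto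
    fix x U assume "openin (obj_top (path_groupoid \<Lambda>)) U" "x \<in> U"
    from obj_base[OF this] obtain m where m: "m \<in> mor \<Lambda>" "x \<in> cylinder \<Lambda> m" "cylinder \<Lambda> m \<subseteq> U"
      unfolding cyl_base_def by blast
    then have "x (0, deg \<Lambda> m) = m" by (simp add: cylinder_iff)
    then show "\<exists>n. (\<lambda>x. x) ` (cylinder \<Lambda> (x (0, n)) \<inter> cylinder \<Lambda> l) \<subseteq> U"
      using m(3) by (intro exI[of _ "deg \<Lambda> m"]) auto
  qed
  then show "compactin (obj_top (path_groupoid \<Lambda>)) W" using l(2) by simp
qed (fact obj_base cyl_base_open cyl_base_disj cyl_base_refine)+

lemma level_base_arr: "level_base (arr_top (path_groupoid \<Lambda>)) cyl2_base"
proof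
  fix L W assume W: "cyl2_base L W"
  then obtain l m where l: "l \<in> mor \<Lambda>" "m \<in> mor \<Lambda>" "src \<Lambda> l = src \<Lambda> m" "deg \<Lambda> l = L" "W = cylinder2 \<Lambda> l m"
    unfolding cyl2_base_def by blast
  \<comment> \<open>The section of the range map: it sends \<open>x\<close> to the arrow that
    exchanges the initial segment \<open>l\<close> for \<open>m\<close>. Its image is the whole
    bisection.\<close>
  define pt where "pt x = (x, to_int (deg \<Lambda> l) - to_int (deg \<Lambda> m), concat_path \<Lambda> m (shift (deg \<Lambda> l) x))"
    for x :: "('a, 'k) ipath"
  have pt: "pt x \<in> cylinder2 \<Lambda> l m" if "x \<in> cylinder \<Lambda> l" for x
  proof -
    have x: "x \<in> ipaths \<Lambda>" "x (0, deg \<Lambda> l) = l" using that l(1) by (simp_all add: cylinder_iff)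
    have "shift (deg \<Lambda> l) x (0, 0) = src \<Lambda> m" using ipath_split(2)[OF x(1), of "deg \<Lambda> l"] x(2) l(3) by simp
    from concat_path[OF l(2) shift_ipath[OF x(1)] this] show ?thesis
      unfolding pt_def cylinder2_iff[OF l(1-3)] using that l(2) by (simp add: cylinder_iff)
  qed
  have "W = pt ` cylinder \<Lambda> l"
  proof
    show "W \<subseteq> pt ` cylinder \<Lambda> l"
    proof (rule subsetI, clarify)
      fix x c y assume "(x, c, y) \<in> W"
      then have *: "c = to_int (deg \<Lambda> l) - to_int (deg \<Lambda> m)" "x \<in> cylinder \<Lambda> l" "y \<in> cylinder \<Lambda> m"
        "shift (deg \<Lambda> l) x = shift (deg \<Lambda> m) y"
        unfolding l(5) cylinder2_iff[OF l(1-3)] by blast+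
      have "y \<in> ipaths \<Lambda>" "y (0, deg \<Lambda> m) = m" using *(3) l(2) by (simp_all add: cylinder_iff)
      then have "y = concat_path \<Lambda> m (shift (deg \<Lambda> l) x)" using concat_path_shift[of y m] *(4) by simp
      then have "(x, c, y) = pt x" using *(1) by (simp add: pt_def)
      then show "(x, c, y) \<in> pt ` cylinder \<Lambda> l" using *(2) by blast
    qed
  qed (use pt l(5) in blast)
  moreover have "compactin (arr_top (path_groupoid \<Lambda>)) (pt ` cylinder \<Lambda> l)"
  proof (rule koenig_compactin[OF l(1)])
    show "pt ` cylinder \<Lambda> l \<subseteq> topspace (arr_top (path_groupoid \<Lambda>))"
      using cyl2_base_open[OF W] openin_subset pt l(5) by blast
    fix x U assume x: "x \<in> cylinder \<Lambda> l" and U: "openin (arr_top (path_groupoid \<Lambda>)) U" "pt x \<in> U"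
    obtain K V where V: "cyl2_base K V" "pt x \<in> V" "V \<subseteq> U" using arr_base[OF U] by blast
    \<comment> \<open>The neighbourhood and the bisection are both refined to level
      \<open>sup L K\<close>, where the pieces through \<open>pt x\<close> can be compared.\<close>
    obtain D where D: "\<forall>W'\<in>D. cyl2_base (sup L K) W'" "\<Union>D = V" using cyl2_base_refine[OF V(1) sup_ge2] by metis
    obtain V' where V': "V' \<in> D" "pt x \<in> V'" using D(2) V(2) by blast
    obtain a where a: "a \<in> paths_from \<Lambda> (src \<Lambda> l) (sup L K - L)" "pt x \<in> cylinder2 \<Lambda> (cmp \<Lambda> l a) (cmp \<Lambda> m a)"
      using pt[OF x] cylinder2_split[OF l(1-3), of "sup L K - L"] by blast
    have a': "a \<in> mor \<Lambda>" "src \<Lambda> l = rng \<Lambda> a" "deg \<Lambda> a = sup L K - L" using a(1) by (simp_all add: paths_from_iff)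
    have "cmp \<Lambda> l a \<in> mor \<Lambda>" "cmp \<Lambda> m a \<in> mor \<Lambda>" "src \<Lambda> (cmp \<Lambda> l a) = src \<Lambda> (cmp \<Lambda> m a)"
      "deg \<Lambda> (cmp \<Lambda> l a) = sup L K"
      using a' l cmp_mor[of l a] cmp_mor[of m a] src_cmp[of l a] src_cmp[of m a] deg_cmp[of l a]
        fun_diff_add_cancel[of L "sup L K"] by simp_all
    then have "cyl2_base (sup L K) (cylinder2 \<Lambda> (cmp \<Lambda> l a) (cmp \<Lambda> m a))" unfolding cyl2_base_def by blast
    \<comment> \<open>Two basic sets of the same level that share the arrow \<open>pt x\<close>
      coincide.\<close>
    then have "V' = cylinder2 \<Lambda> (cmp \<Lambda> l a) (cmp \<Lambda> m a)" using cyl2_base_disj D(1) V' a(2) by blast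
    then have sub: "cylinder2 \<Lambda> (cmp \<Lambda> l a) (cmp \<Lambda> m a) \<subseteq> U" using D(2) V'(1) V(3) by blast
    have iff: "pt z \<in> cylinder2 \<Lambda> (cmp \<Lambda> l a) (cmp \<Lambda> m a) \<longleftrightarrow> pt z \<in> cylinder2 \<Lambda> l m \<and> z \<in> cylinder \<Lambda> (cmp \<Lambda> l a)" for z
      unfolding pt_def using l a' by (intro cylinder2_cmp) auto
    have "x \<in> cylinder \<Lambda> (cmp \<Lambda> l a)" using iff a(2) by blast
    then have "x (0, sup L K) = cmp \<Lambda> l a" using \<open>cmp \<Lambda> l a \<in> mor \<Lambda>\<close> \<open>deg \<Lambda> (cmp \<Lambda> l a) = sup L K\<close>
      by (simp add: cylinder_iff)
    moreover have "pt ` (cylinder \<Lambda> (cmp \<Lambda> l a) \<inter> cylinder \<Lambda> l) \<subseteq> U"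
      using iff pt sub by blast
    ultimately show "\<exists>n. pt ` (cylinder \<Lambda> (x (0, n)) \<inter> cylinder \<Lambda> l) \<subseteq> U"
      by (intro exI[of _ "sup L K"]) simp
  qed
  ultimately show "compactin (arr_top (path_groupoid \<Lambda>)) W" by simp
qed (fact arr_base cyl2_base_open cyl2_base_disj cyl2_base_refine)+

abbreviation "G \<equiv> skew_path_groupoid \<Lambda>"

lemma level_base_obj_skew: "level_base (obj_top G) (\<lambda>L V. \<exists>W (n :: 'k \<Rightarrow> int). V = W \<times> {n} \<and> cyl_base L W)"
  using level_base.level_base_prod[OF level_base_obj] by (simp add: skew_path_groupoid_def skew_product_def)

lemma level_base_arr_skew: "level_base (arr_top G) (\<lambda>L V. \<exists>W (n :: 'k \<Rightarrow> int). V = W \<times> {n} \<and> cyl2_base L W)"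
  using level_base.level_base_prod[OF level_base_arr] by (simp add: skew_path_groupoid_def skew_product_def)

lemma scaled_cyl_Cc: "l \<in> mor \<Lambda> \<Longrightarrow> scaled c (cylinder \<Lambda> l \<times> {n}) \<in> carrier (Cc (obj_top G))"
  by (rule level_base.scaled_Cc[OF level_base_obj_skew]) (auto simp: cyl_base_def)

lemma scaled_cyl2_Cc:
  "l \<in> mor \<Lambda> \<Longrightarrow> m \<in> mor \<Lambda> \<Longrightarrow> src \<Lambda> l = src \<Lambda> m \<Longrightarrow>
    scaled c (cylinder2 \<Lambda> l m \<times> {n}) \<in> carrier (Cc (arr_top G))"
  by (rule level_base.scaled_Cc[OF level_base_arr_skew]) (unfold cyl2_base_def, blast)

end

section \<open>Graded homology\<close>

lemma sum_fun_app: "(\<Sum>i\<in>A. f i) x = (\<Sum>i\<in>A. f i x :: 'c::comm_monoid_add)"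
  by (induction A rule: infinite_finite_induct) auto

text \<open>The support over a point varies with the function; allowing any finite larger index set
  inside the fibre lets several functions be summed over the same one.\<close>

lemma push_eq_sum:
  assumes "finite K" "K \<subseteq> {g \<in> A. p g = u}" "{g \<in> A. p g = u \<and> f g \<noteq> 0} \<subseteq> K"
  shows "push A p f u = (\<Sum>g\<in>K. f g)"
  unfolding push_def using assms by (intro sum.mono_neutral_left) auto

lemma finite_fibre: "inj_on p W \<Longrightarrow> finite {g \<in> W. p g = u}"
proof (cases "{g \<in> W. p g = u} = {}")
  case False
  assume inj: "inj_on p W"
  from False obtain g where g: "g \<in> W" "p g = u" by blast
  then have "{g \<in> W. p g = u} \<subseteq> {g}" using inj by (auto simp: inj_on_def)
  then show ?thesis using finite_subset by blast
next
  case True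
  then show ?thesis by (simp only: finite.emptyI)
qed

lemma sum_scaled_eq_0:
  assumes "x \<notin> \<Union>D" shows "(\<Sum>W\<in>D. scaled (c W) W) x = 0"
  unfolding sum_fun_app using assms by (intro sum.neutral) (auto simp: scaled_def)

text \<open>An injective map has at most one point of each \<open>W\<close> over \<open>u\<close>,
  so each summand is pushed to the same multiple of the characteristic function of the
  image.\<close>

lemma push_sum_scaled:
  assumes D: "finite D" and W: "\<And>W. W \<in> D \<Longrightarrow> inj_on p W \<and> W \<subseteq> A"
  shows "push A p (\<Sum>W\<in>D. scaled (c W) W) = (\<Sum>W\<in>D. scaled (c W) (p ` W))"
    and "finite {g \<in> A. p g = u \<and> (\<Sum>W\<in>D. scaled (c W) W) g \<noteq> 0}"
proof -
  let ?f = "\<Sum>W\<in>D. scaled (c W) W"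
  have fin: "finite (\<Union>W\<in>D. {g \<in> W. p g = u})" for u
    using D W by (intro finite_UN_I finite_fibre) simp_all
  have sub: "{g \<in> A. p g = u \<and> ?f g \<noteq> 0} \<subseteq> (\<Union>W\<in>D. {g \<in> W. p g = u})" for u
  proof
    fix g assume g: "g \<in> {g \<in> A. p g = u \<and> ?f g \<noteq> 0}"
    then have "g \<in> \<Union>D" using sum_scaled_eq_0[of g D c] by blast
    then show "g \<in> (\<Union>W\<in>D. {g \<in> W. p g = u})" using g by blast
  qed
  then show "finite {g \<in> A. p g = u \<and> ?f g \<noteq> 0}" using fin by (rule finite_subset)
  show "push A p ?f = (\<Sum>W\<in>D. scaled (c W) (p ` W))"
  proof
    fix u
    let ?K = "\<Union>W\<in>D. {g \<in> W. p g = u}"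
    have "push A p ?f u = (\<Sum>g\<in>?K. ?f g)"
      using W by (intro push_eq_sum fin sub) blast
    also have "\<dots> = (\<Sum>W\<in>D. \<Sum>g\<in>?K. scaled (c W) W g)"
      unfolding sum_fun_app by (rule sum.swap)
    also have "\<dots> = (\<Sum>W\<in>D. scaled (c W) (p ` W) u)"
    proof (rule sum.cong[OF HOL.refl])
      fix V assume V: "V \<in> D"
      have "(\<Sum>g\<in>?K. scaled (c V) V g) = (\<Sum>g | g \<in> V \<and> p g = u. scaled (c V) V g)"
        using V fin[of u] by (intro sum.mono_neutral_right) (auto simp: scaled_def)
      also have "\<dots> = scaled (c V) (p ` V) u"
      proof (cases "u \<in> p ` V")
        case True
        then obtain g where g: "g \<in> V" "p g = u" by blast
        then have *: "{g \<in> V. p g = u} = {g}" using W[OF V] by (auto simp: inj_on_def)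
        show ?thesis unfolding * using g True by (simp add: scaled_def)
      next
        case False
        then have *: "{g \<in> V. p g = u} = {}" by blast
        show ?thesis unfolding * using False by (simp add: scaled_def)
      qed
      finally show "(\<Sum>g\<in>?K. scaled (c V) V g) = scaled (c V) (p ` V) u" .
    qed
    finally show "push A p ?f u = (\<Sum>W\<in>D. scaled (c W) (p ` W)) u" by (simp add: sum_fun_app)
  qed
qed

text \<open>Sums over infinite sets take the default value zero, which would spoil additivity; the
  finiteness assumptions rule this out and allow the union of both supports as index set.\<close>

lemma push_add:
  assumes "\<And>u. finite {g \<in> A. p g = u \<and> f g \<noteq> 0}" "\<And>u. finite {g \<in> A. p g = u \<and> h g \<noteq> 0}"
  shows "push A p (f + h) = push A p f + push A p h"
proof
  fix u
  let ?K = "{g \<in> A. p g = u \<and> f g \<noteq> 0} \<union> {g \<in> A. p g = u \<and> h g \<noteq> 0}"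
  have K: "finite ?K" using assms by blast
  have "push A p (f + h) u = (\<Sum>g\<in>?K. (f + h) g)" using K by (rule push_eq_sum) auto
  moreover have "push A p f u = (\<Sum>g\<in>?K. f g)" using K by (rule push_eq_sum) auto
  moreover have "push A p h u = (\<Sum>g\<in>?K. h g)" using K by (rule push_eq_sum) auto
  ultimately show "push A p (f + h) u = (push A p f + push A p h) u" by (simp add: sum.distrib)
qed

lemma push_uminus: "push A p (- f) = - push A p f"
  by (auto simp: push_def fun_eq_iff sum_negf)

context finite_kgraph begin

abbreviation "I \<equiv> im_boundary1 G"

lemma G_simps:
  "gsrc G ((x, c, y), m) = (y, m + c)" "grng G ((x, c, y), m) = (x, m)"
  "arr G = arr (path_groupoid \<Lambda>) \<times> UNIV"
  by (simp_all add: skew_path_groupoid_def skew_product_def path_groupoid_def path_cocycle_def)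

lemma cylinder2_arr:
  assumes "l \<in> mor \<Lambda>" "m \<in> mor \<Lambda>" "src \<Lambda> l = src \<Lambda> m"
  shows "cylinder2 \<Lambda> l m \<subseteq> arr (path_groupoid \<Lambda>)"
proof (rule subsetI, clarify)
  fix x c y assume "(x, c, y) \<in> cylinder2 \<Lambda> l m"
  then have "c = to_int (deg \<Lambda> l) - to_int (deg \<Lambda> m)" "x \<in> ipaths \<Lambda>" "y \<in> ipaths \<Lambda>"
    "shift (deg \<Lambda> l) x = shift (deg \<Lambda> m) y"
    using assms by (simp_all add: cylinder2_iff cylinder_iff)
  then show "(x, c, y) \<in> arr (path_groupoid \<Lambda>)" unfolding path_groupoid_def by auto
qed

text \<open>The common tail is determined by either end of an arrow, which makes both end maps
  injective. The source slice is shifted by the cocycle value, which is constant on the set.\<close>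

lemma bisection:
  fixes n :: "'k \<Rightarrow> int"
  assumes "l \<in> mor \<Lambda>" "m \<in> mor \<Lambda>" "src \<Lambda> l = src \<Lambda> m"
  defines "W \<equiv> cylinder2 \<Lambda> l m \<times> {n}"
  shows "inj_on (gsrc G) W" "inj_on (grng G) W" "W \<subseteq> arr G"
    "gsrc G ` W = cylinder \<Lambda> m \<times> {n + to_int (deg \<Lambda> l) - to_int (deg \<Lambda> m)}"
    "grng G ` W = cylinder \<Lambda> l \<times> {n}"
proof -
  let ?d = "to_int (deg \<Lambda> l) - to_int (deg \<Lambda> m)"
  note iff = cylinder2_iff[OF assms(1-3)]
  have uniq: "x = x' \<and> y = y'" if "(x, c, y) \<in> cylinder2 \<Lambda> l m" "(x', c', y') \<in> cylinder2 \<Lambda> l m" "x = x' \<or> y = y'"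
    for x c y x' c' y'
  proof -
    have *: "x \<in> ipaths \<Lambda>" "x' \<in> ipaths \<Lambda>" "y \<in> ipaths \<Lambda>" "y' \<in> ipaths \<Lambda>"
      "x (0, deg \<Lambda> l) = x' (0, deg \<Lambda> l)" "y (0, deg \<Lambda> m) = y' (0, deg \<Lambda> m)"
      "shift (deg \<Lambda> l) x = shift (deg \<Lambda> m) y" "shift (deg \<Lambda> l) x' = shift (deg \<Lambda> m) y'"
      using that(1,2) assms unfolding iff by (simp_all add: cylinder_iff)
    from that(3) show ?thesis
    proof
      assume "x = x'"
      then have "shift (deg \<Lambda> m) y = shift (deg \<Lambda> m) y'" using *(7,8) by metis
      then show ?thesis using ipath_eqI_shift[OF *(3,4,6)] \<open>x = x'\<close> by blast
    next
      assume "y = y'"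
      then have "shift (deg \<Lambda> l) x = shift (deg \<Lambda> l) x'" using *(7,8) by metis
      then show ?thesis using ipath_eqI_shift[OF *(1,2,5)] \<open>y = y'\<close> by blast
    qed
  qed
  have dd: "c = ?d" if "(x, c, y) \<in> cylinder2 \<Lambda> l m" for x c y using that iff by blast
  show "inj_on (gsrc G) W"
  proof (rule inj_onI)
    fix g h assume "g \<in> W" "h \<in> W" and eq: "gsrc G g = gsrc G h"
    then obtain x c y x' c' y' where g: "g = ((x, c, y), n)" "h = ((x', c', y'), n)"
      "(x, c, y) \<in> cylinder2 \<Lambda> l m" "(x', c', y') \<in> cylinder2 \<Lambda> l m" unfolding W_def by auto
    have "y = y'" using eq unfolding g(1,2) G_simps by blast
    then have "x = x' \<and> y = y'" using uniq[OF g(3,4)] by blast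
    moreover have "c = c'" using dd[OF g(3)] dd[OF g(4)] by simp
    ultimately show "g = h" unfolding g(1,2) by blast
  qed
  show "inj_on (grng G) W"
  proof (rule inj_onI)
    fix g h assume "g \<in> W" "h \<in> W" and eq: "grng G g = grng G h"
    then obtain x c y x' c' y' where g: "g = ((x, c, y), n)" "h = ((x', c', y'), n)"
      "(x, c, y) \<in> cylinder2 \<Lambda> l m" "(x', c', y') \<in> cylinder2 \<Lambda> l m" unfolding W_def by auto
    have "x = x'" using eq unfolding g(1,2) G_simps by blast
    then have "x = x' \<and> y = y'" using uniq[OF g(3,4)] by blast
    moreover have "c = c'" using dd[OF g(3)] dd[OF g(4)] by simp
    ultimately show "g = h" unfolding g(1,2) by blast
  qed
  show "W \<subseteq> arr G" unfolding W_def G_simps using cylinder2_arr[OF assms(1-3)] by blast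
  have mem: "(concat_path \<Lambda> l z, ?d, concat_path \<Lambda> m z) \<in> cylinder2 \<Lambda> l m" if "z \<in> ipaths \<Lambda>" "z (0, 0) = src \<Lambda> l" for z
    using that unfolding cylinder2_def by blast
  show "gsrc G ` W = cylinder \<Lambda> m \<times> {n + to_int (deg \<Lambda> l) - to_int (deg \<Lambda> m)}"
  proof
    show "gsrc G ` W \<subseteq> cylinder \<Lambda> m \<times> {n + to_int (deg \<Lambda> l) - to_int (deg \<Lambda> m)}"
      unfolding W_def by (rule image_subsetI) (auto simp: G_simps iff)
    show "cylinder \<Lambda> m \<times> {n + to_int (deg \<Lambda> l) - to_int (deg \<Lambda> m)} \<subseteq> gsrc G ` W"
    proof (rule subsetI, clarify)
      fix y assume "y \<in> cylinder \<Lambda> m"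
      then obtain z where z: "y = concat_path \<Lambda> m z" "z \<in> ipaths \<Lambda>" "z (0, 0) = src \<Lambda> m" unfolding cylinder_def by blast
      have "(y, n + to_int (deg \<Lambda> l) - to_int (deg \<Lambda> m)) = gsrc G ((concat_path \<Lambda> l z, ?d, y), n)"
        by (simp add: G_simps)
      moreover have "((concat_path \<Lambda> l z, ?d, y), n) \<in> W" unfolding W_def z(1) using mem z assms(3) by simp
      ultimately show "(y, n + to_int (deg \<Lambda> l) - to_int (deg \<Lambda> m)) \<in> gsrc G ` W" by blast
    qed
  qed
  show "grng G ` W = cylinder \<Lambda> l \<times> {n}"
  proof
    show "grng G ` W \<subseteq> cylinder \<Lambda> l \<times> {n}"
      unfolding W_def by (rule image_subsetI) (auto simp: G_simps iff)
    show "cylinder \<Lambda> l \<times> {n} \<subseteq> grng G ` W"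
    proof (rule subsetI, clarify)
      fix x assume "x \<in> cylinder \<Lambda> l"
      then obtain z where z: "x = concat_path \<Lambda> l z" "z \<in> ipaths \<Lambda>" "z (0, 0) = src \<Lambda> l" unfolding cylinder_def by blast
      have "(x, n) = grng G ((x, ?d, concat_path \<Lambda> m z), n)" by (simp add: G_simps)
      moreover have "((x, ?d, concat_path \<Lambda> m z), n) \<in> W" unfolding W_def z(1) using mem z by simp
      ultimately show "(x, n) \<in> grng G ` W" by blast
    qed
  qed
qed

text \<open>The boundary of a multiple of one skew bisection. Slice plus degree is the same for both
  cylinders, namely \<open>n + to_int (deg \<Lambda> l)\<close>; every invariant of classes below
  rests on this.\<close>

definition cyl_diff :: "int \<Rightarrow> 'a \<Rightarrow> 'a \<Rightarrow> ('k \<Rightarrow> int) \<Rightarrow> ('a, 'k) gr_chain" where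
  "cyl_diff c l m n = scaled c (cylinder \<Lambda> m \<times> {n + to_int (deg \<Lambda> l) - to_int (deg \<Lambda> m)})
     - scaled c (cylinder \<Lambda> l \<times> {n})"

lemma arr_decomp:
  assumes "F \<in> carrier (Cc (arr_top G))"
  obtains D c where "finite D" "F = (\<Sum>W\<in>D. scaled (c W) W)"
    "\<forall>W\<in>D. \<exists>l\<in>mor \<Lambda>. \<exists>m\<in>mor \<Lambda>. \<exists>n. src \<Lambda> l = src \<Lambda> m \<and> W = cylinder2 \<Lambda> l m \<times> {n}"
proof (rule level_base.Cc_decomp[OF level_base_arr_skew assms])
  fix L D c
  assume D: "finite D" "\<And>W. W \<in> D \<Longrightarrow> \<exists>V (n :: 'k \<Rightarrow> int). W = V \<times> {n} \<and> cyl2_base L V"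
    "F = (\<Sum>W\<in>D. scaled (c W) W)"
  have "\<forall>W\<in>D. \<exists>l\<in>mor \<Lambda>. \<exists>m\<in>mor \<Lambda>. \<exists>n. src \<Lambda> l = src \<Lambda> m \<and> W = cylinder2 \<Lambda> l m \<times> {n}"
  proof
    fix W assume "W \<in> D"
    from D(2)[OF this] obtain V n where "W = V \<times> {n :: 'k \<Rightarrow> int}" "cyl2_base L V" by blast
    then show "\<exists>l\<in>mor \<Lambda>. \<exists>m\<in>mor \<Lambda>. \<exists>n. src \<Lambda> l = src \<Lambda> m \<and> W = cylinder2 \<Lambda> l m \<times> {n}"
      unfolding cyl2_base_def by blast
  qed
  then show thesis using that[OF D(1,3)] by blast
qed

lemma arr_finite_fibre:
  assumes "F \<in> carrier (Cc (arr_top G))"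
  shows "finite {g \<in> arr G. gsrc G g = u \<and> F g \<noteq> 0}" "finite {g \<in> arr G. grng G g = u \<and> F g \<noteq> 0}"
proof -
  obtain D c where D: "finite D" "F = (\<Sum>W\<in>D. scaled (c W) W)"
    "\<forall>W\<in>D. \<exists>l\<in>mor \<Lambda>. \<exists>m\<in>mor \<Lambda>. \<exists>n. src \<Lambda> l = src \<Lambda> m \<and> W = cylinder2 \<Lambda> l m \<times> {n}"
    using assms by (rule arr_decomp)
  have b: "inj_on (gsrc G) W \<and> W \<subseteq> arr G" "inj_on (grng G) W \<and> W \<subseteq> arr G" if "W \<in> D" for W
    using bspec[OF D(3) that] bisection(1,2,3) by blast+
  show "finite {g \<in> arr G. gsrc G g = u \<and> F g \<noteq> 0}"
    unfolding D(2) using b(1) by (rule push_sum_scaled(2)[OF D(1)])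
  show "finite {g \<in> arr G. grng G g = u \<and> F g \<noteq> 0}"
    unfolding D(2) using b(2) by (rule push_sum_scaled(2)[OF D(1)])
qed

lemma boundary1_add:
  assumes "F \<in> carrier (Cc (arr_top G))" "F' \<in> carrier (Cc (arr_top G))"
  shows "boundary1 G (F + F') = boundary1 G F + boundary1 G F'"
  unfolding boundary1_def using arr_finite_fibre[OF assms(1)] arr_finite_fibre[OF assms(2)]
  by (simp add: push_add)

lemma boundary1_uminus: "boundary1 G (- F) = - boundary1 G F"
  unfolding boundary1_def by (simp add: push_uminus)

lemma boundary1_scaled:
  assumes "l \<in> mor \<Lambda>" "m \<in> mor \<Lambda>" "src \<Lambda> l = src \<Lambda> m"
  shows "boundary1 G (scaled c (cylinder2 \<Lambda> l m \<times> {n})) = cyl_diff c l m n"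
  using push_sum_scaled(1)[of "{cylinder2 \<Lambda> l m \<times> {n}}" "gsrc G" "arr G" "\<lambda>_. c"]
    push_sum_scaled(1)[of "{cylinder2 \<Lambda> l m \<times> {n}}" "grng G" "arr G" "\<lambda>_. c"] bisection[OF assms, of n]
  by (simp add: boundary1_def cyl_diff_def)

lemma I_iff: "f \<in> I \<longleftrightarrow> (\<exists>F. F \<in> carrier (Cc (arr_top G)) \<and> f = boundary1 G F)"
  unfolding im_boundary1_def by blast

lemma I_0: "0 \<in> I"
proof -
  have "boundary1 G 0 = 0" by (auto simp: boundary1_def push_def fun_eq_iff)
  then show ?thesis unfolding I_iff using Cc_zero by (intro exI[of _ 0]) simp
qed

lemma I_add: "f \<in> I \<Longrightarrow> g \<in> I \<Longrightarrow> f + g \<in> I"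
proof -
  assume "f \<in> I" "g \<in> I"
  then obtain F F' where F: "F \<in> carrier (Cc (arr_top G))" "f = boundary1 G F"
    "F' \<in> carrier (Cc (arr_top G))" "g = boundary1 G F'"
    unfolding I_iff by (elim exE conjE)
  then show ?thesis
    unfolding I_iff using Cc_add[OF F(1,3)] boundary1_add[OF F(1,3)] by (intro exI[of _ "F + F'"]) simp
qed

lemma I_uminus: "f \<in> I \<Longrightarrow> - f \<in> I"
proof -
  assume "f \<in> I"
  then obtain F where F: "F \<in> carrier (Cc (arr_top G))" "f = boundary1 G F" unfolding I_iff by (elim exE conjE)
  then show ?thesis
    unfolding I_iff using Cc_uminus[OF F(1)] boundary1_uminus[of F] by (intro exI[of _ "- F"]) simp
qed

lemma I_sum: "(\<And>i. i \<in> A \<Longrightarrow> f i \<in> I) \<Longrightarrow> (\<Sum>i\<in>A. f i) \<in> I"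
  by (induction A rule: infinite_finite_induct) (auto intro: I_0 I_add)

lemma cyl_diff_I: "l \<in> mor \<Lambda> \<Longrightarrow> m \<in> mor \<Lambda> \<Longrightarrow> src \<Lambda> l = src \<Lambda> m \<Longrightarrow> cyl_diff c l m n \<in> I"
  unfolding I_iff using boundary1_scaled[of l m c n] scaled_cyl2_Cc[of l m c n]
  by (intro exI[of _ "scaled c (cylinder2 \<Lambda> l m \<times> {n})"]) simp

text \<open>Every function on arrows is a finite sum of multiples of bisections, and the boundary
  map is additive, so the boundaries are generated by \<open>cyl_diff\<close>.\<close>

lemma I_induct [consumes 1, case_names zero step]:
  assumes "f \<in> I" and "P 0"
    and step: "\<And>f c l m n. P f \<Longrightarrow> l \<in> mor \<Lambda> \<Longrightarrow> m \<in> mor \<Lambda> \<Longrightarrow> src \<Lambda> l = src \<Lambda> m \<Longrightarrow> P (cyl_diff c l m n + f)"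
  shows "P f"
proof -
  obtain F where F: "F \<in> carrier (Cc (arr_top G))" "f = boundary1 G F"
    using assms(1) unfolding I_iff by (elim exE conjE)
  obtain D c where D: "finite D" "F = (\<Sum>W\<in>D. scaled (c W) W)"
    "\<forall>W\<in>D. \<exists>l\<in>mor \<Lambda>. \<exists>m\<in>mor \<Lambda>. \<exists>n. src \<Lambda> l = src \<Lambda> m \<and> W = cylinder2 \<Lambda> l m \<times> {n}"
    using F(1) by (rule arr_decomp)
  \<comment> \<open>Membership in the carrier is carried through the induction because additivity of
    the boundary map relies on it.\<close>
  have "(\<Sum>W\<in>D. scaled (c W) W) \<in> carrier (Cc (arr_top G)) \<and> P (boundary1 G (\<Sum>W\<in>D. scaled (c W) W))"
    using D(1,3)
  proof (induction D rule: finite_induct)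
    case empty
    have "boundary1 G 0 = 0" by (auto simp: boundary1_def push_def fun_eq_iff)
    moreover have "(\<Sum>W\<in>{}. scaled (c W) W) = 0" by (rule sum.empty)
    ultimately show ?case using assms(2) Cc_zero by metis
  next
    case (insert W D)
    obtain l m n where W: "l \<in> mor \<Lambda>" "m \<in> mor \<Lambda>" "src \<Lambda> l = src \<Lambda> m" "W = cylinder2 \<Lambda> l m \<times> {n}"
      using bspec[OF insert.prems insertI1] by blast
    have IH: "(\<Sum>W\<in>D. scaled (c W) W) \<in> carrier (Cc (arr_top G))" "P (boundary1 G (\<Sum>W\<in>D. scaled (c W) W))"
      using insert.IH insert.prems by simp_all
    have Wc: "scaled (c W) W \<in> carrier (Cc (arr_top G))" unfolding W(4) using W(1-3) by (rule scaled_cyl2_Cc)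
    have "boundary1 G (scaled (c W) W) = cyl_diff (c W) l m n" unfolding W(4) using W(1-3) by (rule boundary1_scaled)
    then have "boundary1 G (scaled (c W) W + (\<Sum>W\<in>D. scaled (c W) W)) =
      cyl_diff (c W) l m n + boundary1 G (\<Sum>W\<in>D. scaled (c W) W)"
      using boundary1_add[OF Wc IH(1)] by simp
    moreover have "(\<Sum>W\<in>insert W D. scaled (c W) W) = scaled (c W) W + (\<Sum>W\<in>D. scaled (c W) W)"
      using insert.hyps by (rule sum.insert)
    ultimately show ?case using step[OF IH(2) W(1-3)] Cc_add[OF Wc IH(1)] by metis
  qed
  then show ?thesis using F D(2) by simp
qed

lemma I_subset: "I \<subseteq> carrier (Cc (obj_top G))"
proof
  fix f assume "f \<in> I"
  then show "f \<in> carrier (Cc (obj_top G))"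
  proof (induction rule: I_induct)
    case zero
    show ?case by (rule Cc_zero)
  next
    case (step f c l m n)
    then show ?case unfolding cyl_diff_def by (intro Cc_add Cc_diff scaled_cyl_Cc)
  qed
qed

lemma subgroup_I: "subgroup I (Cc (obj_top G))"
proof
  fix f assume f: "f \<in> I"
  then have "inv\<^bsub>Cc (obj_top G)\<^esub> f = - f" using I_subset by (intro Cc_inv) blast
  then show "inv\<^bsub>Cc (obj_top G)\<^esub> f \<in> I" using I_uminus[OF f] by metis
qed (use I_subset I_0 I_add in \<open>simp_all only: Cc_simps\<close>)

lemma H0gr_class_eq: "H0gr_class \<Lambda> f = (\<lambda>h. h + f) ` I"
  unfolding H0gr_class_def H0_class_def r_coset_def Cc_simps by blast

lemma H0gr_class_eq_iff: "H0gr_class \<Lambda> f = H0gr_class \<Lambda> g \<longleftrightarrow> f - g \<in> I"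
proof
  assume "H0gr_class \<Lambda> f = H0gr_class \<Lambda> g"
  moreover have "f \<in> H0gr_class \<Lambda> f" unfolding H0gr_class_eq by (rule image_eqI[of f "\<lambda>h. h + f" 0, OF add_0[symmetric] I_0])
  ultimately obtain h where "h \<in> I" "f = h + g" unfolding H0gr_class_eq by blast
  then show "f - g \<in> I" by (metis add_diff_cancel_right')
next
  have *: "H0gr_class \<Lambda> f \<subseteq> H0gr_class \<Lambda> g" if "f - g \<in> I" for f g
  proof
    fix x assume "x \<in> H0gr_class \<Lambda> f"
    then obtain h where h: "h \<in> I" "x = h + f" unfolding H0gr_class_eq by blast
    have "x = (h + (f - g)) + g" unfolding h(2) by (metis add.assoc diff_add_cancel)
    then show "x \<in> H0gr_class \<Lambda> g" unfolding H0gr_class_eq using I_add[OF h(1) that] by blast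
  qed
  assume "f - g \<in> I"
  moreover from this have "g - f \<in> I" using I_uminus[of "f - g"] by (metis minus_diff_eq)
  ultimately show "H0gr_class \<Lambda> f = H0gr_class \<Lambda> g" using * by blast
qed

lemma H0gr_carrier_iff: "h \<in> carrier (H0gr \<Lambda>) \<longleftrightarrow> (\<exists>f\<in>carrier (Cc (obj_top G)). h = H0gr_class \<Lambda> f)"
  unfolding H0gr_def H0_def FactGroup_def RCOSETS_def H0gr_class_def H0_class_def by simp

lemma normal_I: "I \<lhd> Cc (obj_top G)"
  using comm_group.normal_iff_subgroup[OF comm_group_Cc] subgroup_I by blast

lemma H0gr_mult:
  "f \<in> carrier (Cc (obj_top G)) \<Longrightarrow> g \<in> carrier (Cc (obj_top G)) \<Longrightarrow>
    H0gr_class \<Lambda> f \<otimes>\<^bsub>H0gr \<Lambda>\<^esub> H0gr_class \<Lambda> g = H0gr_class \<Lambda> (f + g)"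
  using normal.rcos_sum[OF normal_I, of f g]
  unfolding H0gr_def H0_def FactGroup_def H0gr_class_def H0_class_def Cc_simps by simp

lemma comm_group_H0gr: "comm_group (H0gr \<Lambda>)"
  unfolding H0gr_def H0_def using comm_group.abelian_FactGroup[OF comm_group_Cc subgroup_I] .

section \<open>Functions that depend on the initial vertex in a single slice\<close>

definition chain :: "('a \<Rightarrow> int) \<Rightarrow> ('k \<Rightarrow> int) \<Rightarrow> ('a, 'k) gr_chain" where
  "chain x n = (\<lambda>(y, m). if y \<in> ipaths \<Lambda> \<and> m = n then x (y (0, 0)) else 0)"

lemma chain_app: "chain x n (y, m) = (if y \<in> ipaths \<Lambda> \<and> m = n then x (y (0, 0)) else 0)"
  by (simp add: chain_def)

lemma chain_add: "chain (x + y) n = chain x n + chain y n"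
  by (rule ext) (auto simp: chain_def)

lemma chain_0: "chain 0 n = 0"
  by (rule ext) (auto simp: chain_def)

lemma chain_nonneg: "0 \<le> x \<Longrightarrow> 0 \<le> chain x n"
  by (auto simp: chain_def le_fun_def)

lemma mem_cylinder_vertex:
  "v \<in> vertices \<Lambda> \<Longrightarrow> y \<in> cylinder \<Lambda> v \<longleftrightarrow> y \<in> ipaths \<Lambda> \<and> y (0, 0) = v"
  using cylinder_iff[of v y] by (simp add: paths_def)

lemma ipath_vertex: "y \<in> ipaths \<Lambda> \<Longrightarrow> y (0, 0) \<in> vertices \<Lambda>"
  using ipath_props[of y 0 0] by (simp add: paths_def)

text \<open>Each infinite path lies in exactly one cylinder of a vertex, that of its initial vertex,
  so the sum has at most one nonzero term at each point.\<close>

lemma chain_eq_sum: "chain x n = (\<Sum>v\<in>vertices \<Lambda>. scaled (x v) (cylinder \<Lambda> v \<times> {n}))"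
proof
  fix z :: "('a, 'k) ipath \<times> ('k \<Rightarrow> int)"
  obtain y m where z: "z = (y, m)" by (cases z)
  have "(\<Sum>v\<in>vertices \<Lambda>. scaled (x v) (cylinder \<Lambda> v \<times> {n})) z =
    (\<Sum>v\<in>vertices \<Lambda>. if v = y (0, 0) then (if y \<in> ipaths \<Lambda> \<and> m = n then x v else 0) else 0)"
    unfolding sum_fun_app z by (rule sum.cong[OF HOL.refl]) (auto simp: scaled_def mem_cylinder_vertex)
  also have "\<dots> = (if y (0, 0) \<in> vertices \<Lambda> then (if y \<in> ipaths \<Lambda> \<and> m = n then x (y (0, 0)) else 0) else 0)"
    using finite_vertices by (rule sum.delta)
  also have "\<dots> = chain x n z" using ipath_vertex[of y] by (auto simp: z chain_app)
  finally show "chain x n z = (\<Sum>v\<in>vertices \<Lambda>. scaled (x v) (cylinder \<Lambda> v \<times> {n})) z" by simp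
qed

lemma Cc_sum: "(\<And>i. i \<in> A \<Longrightarrow> f i \<in> carrier (Cc X)) \<Longrightarrow> (\<Sum>i\<in>A. f i) \<in> carrier (Cc X)"
proof (induction A rule: infinite_finite_induct)
  case (insert i A)
  then have "f i + (\<Sum>i\<in>A. f i) \<in> carrier (Cc X)" by (intro Cc_add) blast+
  then show ?case using insert.hyps by (metis sum.insert)
next
  case (infinite A)
  then show ?case by (metis Cc_zero sum.infinite)
next
  case empty
  show ?case by (metis Cc_zero sum.empty)
qed

lemma chain_Cc: "chain x n \<in> carrier (Cc (obj_top G))"
  unfolding chain_eq_sum by (intro Cc_sum scaled_cyl_Cc) (simp add: vertex_mor)

section \<open>Detecting homology classes by counting at a high level\<close>

text \<open>A sample point in each cylinder. Evaluating there makes the level vector additive on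
  arbitrary functions, without asking them to be constant on the cylinders.\<close>

definition pick :: "'a \<Rightarrow> ('a, 'k) ipath" where
  "pick l = (SOME x. x \<in> cylinder \<Lambda> l)"

lemma pick: "l \<in> mor \<Lambda> \<Longrightarrow> pick l \<in> ipaths \<Lambda> \<and> pick l (0, deg \<Lambda> l) = l"
  using cylinder_nonempty[of l] unfolding pick_def by (metis cylinder_iff ex_in_conv someI_ex)

text \<open>
  The vector of a function at level \<open>N\<close>: the value on \<open>Z(\<lambda>) \<times> {n}\<close> with \<open>n + d(\<lambda>) = N\<close> contributes
  to the entry at \<open>s(\<lambda>)\<close>. The finite set \<open>K\<close> only serves to make the sum finite.
\<close>
definition level_vec :: "('k \<Rightarrow> int) set \<Rightarrow> ('k \<Rightarrow> int) \<Rightarrow> ('a, 'k) gr_chain \<Rightarrow> 'a \<Rightarrow> int" where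
  "level_vec K N f v = (\<Sum>n\<in>{n \<in> K. n \<le> N}. \<Sum>l\<in>{l \<in> paths \<Lambda> (to_nat (N - n)). src \<Lambda> l = v}. f (pick l, n))"

lemma level_vec_add: "level_vec K N (f + g) v = level_vec K N f v + level_vec K N g v"
  unfolding level_vec_def plus_fun_apply by (simp add: sum.distrib)

lemma level_vec_diff: "level_vec K N (f - g) v = level_vec K N f v - level_vec K N g v"
  unfolding level_vec_def fun_diff_def by (simp add: sum_subtractf)

lemma level_vec_0: "level_vec K N 0 v = 0"
  unfolding level_vec_def zero_fun_apply by simp

lemma level_vec_sum: "level_vec K N (\<Sum>i\<in>A. f i) v = (\<Sum>i\<in>A. level_vec K N (f i) v)"
proof (induction A rule: infinite_finite_induct)
  case (insert i A)
  then have "level_vec K N (\<Sum>i\<in>insert i A. f i) v = level_vec K N (f i) v + level_vec K N (\<Sum>i\<in>A. f i) v"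
    by (metis sum.insert level_vec_add)
  also have "\<dots> = (\<Sum>i\<in>insert i A. level_vec K N (f i) v)" using insert by simp
  finally show ?case .
next
  case (infinite A)
  then show ?case by (metis level_vec_0 sum.infinite)
next
  case empty
  show ?case by (metis level_vec_0 sum.empty)
qed

text \<open>Extending \<open>l\<close> on the right is a bijection with inverse \<open>sfx\<close>.
  The number of ways to reach \<open>v\<close> depends on \<open>l\<close> only through its
  source.\<close>

lemma card_extensions:
  assumes "l \<in> mor \<Lambda>"
  shows "card {l' \<in> paths \<Lambda> (deg \<Lambda> l + q). src \<Lambda> l' = v \<and> pfx (deg \<Lambda> l) l' = l} = adj_mat \<Lambda> q (src \<Lambda> l) v"
proof -
  let ?A = "{a \<in> paths_from \<Lambda> (src \<Lambda> l) q. src \<Lambda> a = v}"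
  let ?B = "{l' \<in> paths \<Lambda> (deg \<Lambda> l + q). src \<Lambda> l' = v \<and> pfx (deg \<Lambda> l) l' = l}"
  have "bij_betw (cmp \<Lambda> l) ?A ?B"
  proof (rule bij_betw_byWitness[where f' = "sfx (deg \<Lambda> l)"])
    have A: "a \<in> mor \<Lambda>" "src \<Lambda> l = rng \<Lambda> a" "deg \<Lambda> a = q" "src \<Lambda> a = v" if "a \<in> ?A" for a
      using that by (auto simp: paths_from_iff)
    show "\<forall>a\<in>?A. sfx (deg \<Lambda> l) (cmp \<Lambda> l a) = a"
      using sfx_cmp_eq[OF assms A(1,2) HOL.refl] by blast
    have B: "l' \<in> mor \<Lambda>" "deg \<Lambda> l' = deg \<Lambda> l + q" "src \<Lambda> l' = v" "pfx (deg \<Lambda> l) l' = l" "deg \<Lambda> l \<le> deg \<Lambda> l'"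
      if "l' \<in> ?B" for l' using that by (auto simp: paths_def le_fun_def)
    show "\<forall>l'\<in>?B. cmp \<Lambda> l (sfx (deg \<Lambda> l) l') = l'"
    proof
      fix l' assume "l' \<in> ?B"
      note b = B[OF this]
      show "cmp \<Lambda> l (sfx (deg \<Lambda> l) l') = l'" using cmp_pfx_sfx[OF b(1,5)] unfolding b(4) .
    qed
    show "cmp \<Lambda> l ` ?A \<subseteq> ?B"
    proof (rule image_subsetI)
      fix a assume "a \<in> ?A"
      note a = A[OF this]
      show "cmp \<Lambda> l a \<in> ?B"
        using cmp_mor[OF assms a(1,2)] deg_cmp[OF assms a(1,2)] src_cmp[OF assms a(1,2)]
          pfx_cmp_eq[OF assms a(1,2) HOL.refl] a(3,4) unfolding paths_def by blast
    qed
    show "sfx (deg \<Lambda> l) ` ?B \<subseteq> ?A"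
    proof (rule image_subsetI)
      fix l' assume "l' \<in> ?B"
      note b = B[OF this]
      have "deg \<Lambda> l + q - deg \<Lambda> l = q" by (simp add: fun_eq_iff)
      then show "sfx (deg \<Lambda> l) l' \<in> ?A"
        using pfx_sfx(3,4,6,8)[OF b(1,5)] unfolding b(2-4) paths_from_iff mem_Collect_eq by metis
    qed
  qed
  then show ?thesis unfolding adj_mat_alt by (rule bij_betw_same_card[symmetric])
qed

text \<open>The sampled cylinders that lie in \<open>cylinder \<Lambda> l\<close> are those of its
  extensions. The result depends on \<open>l\<close> and \<open>n\<close> only through the source
  and the total \<open>n + to_int (deg \<Lambda> l)\<close>, exactly the data shared by the two
  parts of \<open>cyl_diff\<close>.\<close>

lemma level_vec_scaled:
  assumes l: "l \<in> mor \<Lambda>" and K: "finite K" "n \<in> K" and N: "n + to_int (deg \<Lambda> l) \<le> N"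
  shows "level_vec K N (scaled c (cylinder \<Lambda> l \<times> {n})) v =
    c * int (adj_mat \<Lambda> (to_nat (N - (n + to_int (deg \<Lambda> l)))) (src \<Lambda> l) v)"
proof -
  have nN: "n \<le> n + to_int (deg \<Lambda> l)" by (auto simp: le_fun_def to_int_def)
  then have nN': "n \<le> N" using N by (rule order_trans)
  let ?q = "to_nat (N - (n + to_int (deg \<Lambda> l)))"
  have q: "to_nat (N - n) = deg \<Lambda> l + ?q"
    using to_nat_diff_split[OF nN N] by simp
  let ?S = "\<lambda>n. {l \<in> paths \<Lambda> (to_nat (N - n)). src \<Lambda> l = v}"
  have "level_vec K N (scaled c (cylinder \<Lambda> l \<times> {n})) v =
    (\<Sum>n'\<in>{n}. \<Sum>l'\<in>?S n'. scaled c (cylinder \<Lambda> l \<times> {n}) (pick l', n'))"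
    unfolding level_vec_def using K nN' by (intro sum.mono_neutral_right) (auto simp: scaled_def)
  also have "\<dots> = (\<Sum>l'\<in>?S n. if pfx (deg \<Lambda> l) l' = l then c else 0)"
  proof -
    have "scaled c (cylinder \<Lambda> l \<times> {n}) (pick l', n) = (if pfx (deg \<Lambda> l) l' = l then c else 0)"
      if "l' \<in> ?S n" for l'
    proof -
      have l': "l' \<in> mor \<Lambda>" "deg \<Lambda> l \<le> deg \<Lambda> l'" using that q by (auto simp: paths_def le_fun_def)
      \<comment> \<open>Since \<open>l'\<close> is at least as long as \<open>l\<close>, the sample
        path over \<open>l'\<close> starts with \<open>l\<close> exactly when \<open>l'\<close>
        does.\<close>
      then have "pfx (deg \<Lambda> l) l' = pick l' (0, deg \<Lambda> l)"
        using pfx_ipath[of "pick l'" "deg \<Lambda> l" "deg \<Lambda> l'"] pick[of l'] by simp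
      then have "pick l' \<in> cylinder \<Lambda> l \<longleftrightarrow> pfx (deg \<Lambda> l) l' = l"
        using pick[OF l'(1)] cylinder_iff[OF l] by metis
      then show ?thesis by (simp add: scaled_def)
    qed
    then have "(\<Sum>l'\<in>?S n. scaled c (cylinder \<Lambda> l \<times> {n}) (pick l', n)) =
      (\<Sum>l'\<in>?S n. if pfx (deg \<Lambda> l) l' = l then c else 0)"
      by (rule sum.cong[OF HOL.refl])
    moreover have "(\<Sum>n'\<in>{n}. g n') = g n" for g :: "('k \<Rightarrow> int) \<Rightarrow> int" by simp
    ultimately show ?thesis by metis
  qed
  also have "\<dots> = (\<Sum>l'\<in>{l' \<in> paths \<Lambda> (deg \<Lambda> l + ?q). src \<Lambda> l' = v \<and> pfx (deg \<Lambda> l) l' = l}. c)"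
    unfolding q using finite_paths by (intro sum.mono_neutral_cong_right) auto
  also have "\<dots> = c * int (adj_mat \<Lambda> ?q (src \<Lambda> l) v)"
    using card_extensions[OF l, of ?q v] by simp
  finally show ?thesis .
qed

lemma level_vec_chain:
  assumes "finite K" "n \<in> K" "n \<le> N" "v \<in> vertices \<Lambda>"
  shows "level_vec K N (chain x n) v = vec_mat \<Lambda> x (to_nat (N - n)) v"
proof -
  have "level_vec K N (scaled (x u) (cylinder \<Lambda> u \<times> {n})) v = x u * int (adj_mat \<Lambda> (to_nat (N - n)) u v)"
    if u: "u \<in> vertices \<Lambda>" for u
  proof -
    have "deg \<Lambda> u = 0" "src \<Lambda> u = u" "u \<in> mor \<Lambda>" using u vertex_iff[of u] by (simp_all add: paths_def)
    then show ?thesis using level_vec_scaled[of u K n N "x u" v] assms by simp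
  qed
  then show ?thesis unfolding chain_eq_sum level_vec_sum vec_mat_def using assms(4) by simp
qed

text \<open>Each generator is annihilated once \<open>K\<close> contains its two slices and
  \<open>N\<close> lies above its total degree. A boundary has finitely many generators, so these
  bounds can be accumulated.\<close>

lemma level_vec_I:
  assumes "f \<in> I"
  shows "\<exists>K0 N0. finite K0 \<and> (\<forall>K N. finite K \<longrightarrow> K0 \<subseteq> K \<longrightarrow> N0 \<le> N \<longrightarrow> (\<forall>v. level_vec K N f v = 0))"
  using assms
proof (induction rule: I_induct)
  case zero
  show ?case by (intro exI[of _ "{}"] exI[of _ 0] conjI allI impI finite.emptyI level_vec_0)
next
  case (step f c l m n)
  from step.IH obtain K0 N0 where "finite K0 \<and>
    (\<forall>K N. finite K \<longrightarrow> K0 \<subseteq> K \<longrightarrow> N0 \<le> N \<longrightarrow> (\<forall>v. level_vec K N f v = 0))" by (elim exE)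
  then have K0: "finite K0" "\<And>K N v. finite K \<Longrightarrow> K0 \<subseteq> K \<Longrightarrow> N0 \<le> N \<Longrightarrow> level_vec K N f v = 0"
    by simp_all
  let ?n = "n + to_int (deg \<Lambda> l) - to_int (deg \<Lambda> m)"
  let ?N = "n + to_int (deg \<Lambda> l)"
  have eq: "?n + to_int (deg \<Lambda> m) = ?N" by simp
  have "level_vec K N (cyl_diff c l m n + f) v = 0"
    if *: "finite K" "K0 \<union> {n, ?n} \<subseteq> K" "sup N0 ?N \<le> N" for K N v
  proof -
    have N: "N0 \<le> N" "?N \<le> N" using *(3) by simp_all
    then have "?n + to_int (deg \<Lambda> m) \<le> N" unfolding eq by blast
    from level_vec_scaled[OF step(3) *(1) _ this, of c v] *(2)
    have "level_vec K N (scaled c (cylinder \<Lambda> m \<times> {?n})) v = c * int (adj_mat \<Lambda> (to_nat (N - ?N)) (src \<Lambda> l) v)"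
      unfolding eq step(4) by blast
    moreover have "level_vec K N (scaled c (cylinder \<Lambda> l \<times> {n})) v = c * int (adj_mat \<Lambda> (to_nat (N - ?N)) (src \<Lambda> l) v)"
      using level_vec_scaled[OF step(2) *(1) _ N(2), of c v] *(2) by blast
    moreover have "level_vec K N f v = 0" using K0(2)[OF *(1) _ N(1)] *(2) by blast
    ultimately show ?thesis unfolding cyl_diff_def level_vec_add level_vec_diff by simp
  qed
  moreover have "finite (K0 \<union> {n, ?n})" using K0(1) by simp
  ultimately show ?case
    by (intro exI[of _ "K0 \<union> {n, ?n}"] exI[of _ "sup N0 ?N"] conjI allI impI)
qed

lemma scaled_split:
  fixes n :: "'k \<Rightarrow> int"
  assumes "v \<in> vertices \<Lambda>"
  shows "scaled c (cylinder \<Lambda> v \<times> {n}) = (\<Sum>a\<in>paths_from \<Lambda> v q. scaled c (cylinder \<Lambda> a \<times> {n}))"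
proof
  fix z :: "('a, 'k) ipath \<times> ('k \<Rightarrow> int)"
  obtain y m where z: "z = (y, m)" by (cases z)
  have y: "y (0, q) \<in> paths_from \<Lambda> v q \<longleftrightarrow> y (0, 0) = v" if "y \<in> ipaths \<Lambda>"
    using ipath_props[OF that, of 0 q] by (auto simp: paths_from_iff)
  have "scaled c (cylinder \<Lambda> a \<times> {n}) z = (if a = y (0, q) then (if y \<in> ipaths \<Lambda> \<and> m = n then c else 0) else 0)"
    if a: "a \<in> paths_from \<Lambda> v q" for a
  proof -
    have "a \<in> mor \<Lambda>" "deg \<Lambda> a = q" using a by (simp_all add: paths_from_iff)
    then have "y \<in> cylinder \<Lambda> a \<longleftrightarrow> y \<in> ipaths \<Lambda> \<and> a = y (0, q)" using cylinder_iff[of a y] by metis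
    then show ?thesis by (simp add: scaled_def z)
  qed
  then have "(\<Sum>a\<in>paths_from \<Lambda> v q. scaled c (cylinder \<Lambda> a \<times> {n})) z =
    (\<Sum>a\<in>paths_from \<Lambda> v q. if a = y (0, q) then (if y \<in> ipaths \<Lambda> \<and> m = n then c else 0) else 0)"
    unfolding sum_fun_app by (intro sum.cong) simp_all
  also have "\<dots> = (if y (0, q) \<in> paths_from \<Lambda> v q then (if y \<in> ipaths \<Lambda> \<and> m = n then c else 0) else 0)"
    using finite_paths_from[OF assms] by (rule sum.delta)
  also have "\<dots> = scaled c (cylinder \<Lambda> v \<times> {n}) z"
    using y mem_cylinder_vertex[OF assms, of y] by (simp add: scaled_def z)
  finally show "scaled c (cylinder \<Lambda> v \<times> {n}) z = (\<Sum>a\<in>paths_from \<Lambda> v q. scaled c (cylinder \<Lambda> a \<times> {n})) z" by simp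
qed

text \<open>Each vertex cylinder is cut into the cylinders of the paths of degree \<open>q\<close>,
  and each of these is moved to the cylinder of its source, \<open>q\<close> slices up. Counting the
  sources gives the adjacency matrix.\<close>

lemma chain_lift_nat: "chain (vec_mat \<Lambda> x q) (n + to_int q) - chain x n \<in> I"
proof -
  \<comment> \<open>The boundary that performs these moves: the bisections pair each path
    \<open>a\<close> with its source vertex.\<close>
  have "(\<Sum>v\<in>vertices \<Lambda>. \<Sum>a\<in>paths_from \<Lambda> v q. cyl_diff (x v) a (src \<Lambda> a) n) \<in> I"
    by (intro I_sum cyl_diff_I) (simp_all add: paths_from_iff src_mor src_src)
  moreover have "(\<Sum>v\<in>vertices \<Lambda>. \<Sum>a\<in>paths_from \<Lambda> v q. cyl_diff (x v) a (src \<Lambda> a) n) =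
    chain (vec_mat \<Lambda> x q) (n + to_int q) - chain x n"
  proof
    fix z :: "('a, 'k) ipath \<times> ('k \<Rightarrow> int)"
    let ?s = "\<lambda>c w. scaled c (cylinder \<Lambda> w \<times> {n + to_int q}) z"
    have d: "cyl_diff (x v) a (src \<Lambda> a) n z = ?s (x v) (src \<Lambda> a) - scaled (x v) (cylinder \<Lambda> a \<times> {n}) z"
      if "a \<in> paths_from \<Lambda> v q" for v a
      using that deg_src[of a] by (simp add: cyl_diff_def paths_from_iff)
    have "(\<Sum>v\<in>vertices \<Lambda>. \<Sum>a\<in>paths_from \<Lambda> v q. ?s (x v) (src \<Lambda> a))
      = (\<Sum>v\<in>vertices \<Lambda>. \<Sum>w\<in>vertices \<Lambda>. int (adj_mat \<Lambda> q v w) * ?s (x v) w)"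
    proof (rule sum.cong[OF HOL.refl])
      fix v assume "v \<in> vertices \<Lambda>"
      from sum_paths_from[OF this, of "\<lambda>w. ?s (x v) w" q]
      show "(\<Sum>a\<in>paths_from \<Lambda> v q. ?s (x v) (src \<Lambda> a)) =
        (\<Sum>w\<in>vertices \<Lambda>. int (adj_mat \<Lambda> q v w) * ?s (x v) w)" by simp
    qed
    also have "\<dots> = (\<Sum>w\<in>vertices \<Lambda>. \<Sum>v\<in>vertices \<Lambda>. int (adj_mat \<Lambda> q v w) * ?s (x v) w)"
      by (rule sum.swap)
    also have "\<dots> = (\<Sum>w\<in>vertices \<Lambda>. ?s (vec_mat \<Lambda> x q w) w)"
    proof (rule sum.cong[OF HOL.refl])
      fix w assume "w \<in> vertices \<Lambda>"
      then show "(\<Sum>v\<in>vertices \<Lambda>. int (adj_mat \<Lambda> q v w) * ?s (x v) w) = ?s (vec_mat \<Lambda> x q w) w"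
        by (cases "z \<in> cylinder \<Lambda> w \<times> {n + to_int q}") (simp_all add: vec_mat_def scaled_def mult.commute)
    qed
    also have "\<dots> = chain (vec_mat \<Lambda> x q) (n + to_int q) z" unfolding chain_eq_sum sum_fun_app ..
    finally have 1: "(\<Sum>v\<in>vertices \<Lambda>. \<Sum>a\<in>paths_from \<Lambda> v q. ?s (x v) (src \<Lambda> a)) =
      chain (vec_mat \<Lambda> x q) (n + to_int q) z" .
    have 2: "(\<Sum>v\<in>vertices \<Lambda>. \<Sum>a\<in>paths_from \<Lambda> v q. scaled (x v) (cylinder \<Lambda> a \<times> {n}) z) = chain x n z"
      unfolding chain_eq_sum sum_fun_app
    proof (rule sum.cong[OF HOL.refl])
      fix v assume "v \<in> vertices \<Lambda>"
      from scaled_split[OF this, of "x v" n q]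
      show "(\<Sum>a\<in>paths_from \<Lambda> v q. scaled (x v) (cylinder \<Lambda> a \<times> {n}) z) = scaled (x v) (cylinder \<Lambda> v \<times> {n}) z"
        unfolding fun_eq_iff sum_fun_app by metis
    qed
    have "(\<Sum>v\<in>vertices \<Lambda>. \<Sum>a\<in>paths_from \<Lambda> v q. cyl_diff (x v) a (src \<Lambda> a) n) z =
      (\<Sum>v\<in>vertices \<Lambda>. \<Sum>a\<in>paths_from \<Lambda> v q. ?s (x v) (src \<Lambda> a) - scaled (x v) (cylinder \<Lambda> a \<times> {n}) z)"
      unfolding sum_fun_app by (intro sum.cong[OF HOL.refl] d)
    also have "\<dots> = (chain (vec_mat \<Lambda> x q) (n + to_int q) - chain x n) z"
      unfolding sum_subtractf fun_diff_def 1 2 ..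
    finally show "(\<Sum>v\<in>vertices \<Lambda>. \<Sum>a\<in>paths_from \<Lambda> v q. cyl_diff (x v) a (src \<Lambda> a) n) z =
      (chain (vec_mat \<Lambda> x q) (n + to_int q) - chain x n) z" .
  qed
  ultimately show ?thesis by metis
qed

lemma chain_lift: "n \<le> N \<Longrightarrow> chain (vec_mat \<Lambda> x (to_nat (N - n))) N - chain x n \<in> I"
  using chain_lift_nat[of x "to_nat (N - n)" n] by (simp add: to_int_to_nat fun_le_diff_iff)

lemma I_trans: "f - g \<in> I \<Longrightarrow> g - h \<in> I \<Longrightarrow> f - h \<in> I"
  using I_add[of "f - g" "g - h"] by (metis diff_add_cancel diff_diff_eq2)

lemma I_sym: "f - g \<in> I \<Longrightarrow> g - f \<in> I"
  using I_uminus[of "f - g"] by (metis minus_diff_eq)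

text \<open>This makes the correspondence with the dimension group well defined and injective. A
  boundary has zero level vector at high levels, where that vector is the lifted difference;
  conversely, equal lifts are homologous to both chains.\<close>

lemma chain_diff_I_iff:
  assumes "x \<in> int_vecs \<Lambda>" "y \<in> int_vecs \<Lambda>"
  shows "chain x n - chain y m \<in> I \<longleftrightarrow> dim_class \<Lambda> x n = dim_class \<Lambda> y m"
proof
  assume "chain x n - chain y m \<in> I"
  from level_vec_I[OF this] obtain K0 N0 where "finite K0 \<and>
    (\<forall>K N. finite K \<longrightarrow> K0 \<subseteq> K \<longrightarrow> N0 \<le> N \<longrightarrow> (\<forall>v. level_vec K N (chain x n - chain y m) v = 0))"
    by (elim exE)
  then have K0: "finite K0" "\<And>K N v. finite K \<Longrightarrow> K0 \<subseteq> K \<Longrightarrow> N0 \<le> N \<Longrightarrow>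
    level_vec K N (chain x n - chain y m) v = 0" by simp_all
  \<comment> \<open>Both slices are added to \<open>K0\<close> and both levels to \<open>N0\<close>,
    so that the formula for the level vector of a chain applies to either chain.\<close>
  let ?K = "K0 \<union> {n, m}" and ?N = "sup N0 (sup n m)"
  have le: "n \<le> ?N" "m \<le> ?N" by (simp_all add: le_supI2)
  have "vec_mat \<Lambda> x (to_nat (?N - n)) v = vec_mat \<Lambda> y (to_nat (?N - m)) v" for v
  proof (cases "v \<in> vertices \<Lambda>")
    case True
    have fin: "finite ?K" using K0(1) by simp
    have "level_vec ?K ?N (chain x n - chain y m) v = 0" by (rule K0(2)[OF fin _ sup_ge1]) blast
    then show ?thesis
      unfolding level_vec_diff using level_vec_chain[OF fin _ le(1) True, of x] level_vec_chain[OF fin _ le(2) True, of y]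
      by simp
  qed (simp add: vec_mat_def)
  then show "dim_class \<Lambda> x n = dim_class \<Lambda> y m"
    unfolding dim_class_eq_iff[OF assms] using le by blast
next
  assume "dim_class \<Lambda> x n = dim_class \<Lambda> y m"
  then obtain l where l: "n \<le> l" "m \<le> l" "vec_mat \<Lambda> x (to_nat (l - n)) = vec_mat \<Lambda> y (to_nat (l - m))"
    unfolding dim_class_eq_iff[OF assms] by blast
  show "chain x n - chain y m \<in> I"
    using I_sym[OF chain_lift[OF l(1), of x]] chain_lift[OF l(2), of y] unfolding l(3) by (rule I_trans)
qed

text \<open>The bisection of \<open>l\<close> with its source vertex moves the cylinder of
  \<open>l\<close> to a vertex cylinder in the slice raised by the degree of
  \<open>l\<close>.\<close>

lemma scaled_chain:
  assumes "l \<in> mor \<Lambda>"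
  shows "scaled c (cylinder \<Lambda> l \<times> {n}) - chain (\<lambda>v. c * basis_vec (src \<Lambda> l) v) (n + to_int (deg \<Lambda> l)) \<in> I"
proof -
  have S: "scaled c (cylinder \<Lambda> (src \<Lambda> l) \<times> {m}) = chain (\<lambda>v. c * basis_vec (src \<Lambda> l) v) m" for m
  proof
    fix z :: "('a, 'k) ipath \<times> ('k \<Rightarrow> int)"
    show "scaled c (cylinder \<Lambda> (src \<Lambda> l) \<times> {m}) z = chain (\<lambda>v. c * basis_vec (src \<Lambda> l) v) m z"
      using mem_cylinder_vertex[of "src \<Lambda> l"] assms by (cases z) (auto simp: scaled_def chain_def basis_vec_def)
  qed
  have "cyl_diff c l (src \<Lambda> l) n \<in> I"
    using assms src_src[OF assms, symmetric] by (intro cyl_diff_I src_mor)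
  then show ?thesis
    unfolding cyl_diff_def deg_src[OF assms] to_int_simps(1) diff_zero S by (rule I_sym)
qed

text \<open>The pieces of \<open>f\<close> become chains at different levels, which are added after
  lifting to a common one. Nonnegative matrices and coefficients keep the vector nonnegative, so
  positive classes have positive representatives.\<close>

lemma chain_repr:
  assumes "f \<in> carrier (Cc (obj_top G))"
  shows "\<exists>x\<in>int_vecs \<Lambda>. \<exists>n. f - chain x n \<in> I \<and> (0 \<le> f \<longrightarrow> 0 \<le> x)"
proof (rule level_base.Cc_decomp[OF level_base_obj_skew assms])
  fix L D c
  assume D: "finite D" "\<And>W. W \<in> D \<Longrightarrow> \<exists>V (n :: 'k \<Rightarrow> int). W = V \<times> {n} \<and> cyl_base L V"
    and c: "\<And>W. W \<in> D \<Longrightarrow> c W \<in> range f" and f: "f = (\<Sum>W\<in>D. scaled (c W) W)"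
  have "\<exists>x\<in>int_vecs \<Lambda>. \<exists>n. (\<Sum>W\<in>D. scaled (c W) W) - chain x n \<in> I \<and> ((\<forall>W\<in>D. 0 \<le> c W) \<longrightarrow> 0 \<le> x)"
    using D
  proof (induction D rule: finite_induct)
    case empty
    have "(\<Sum>W\<in>{}. scaled (c W) W) - chain 0 0 = 0" unfolding chain_0 sum.empty by (rule diff_self)
    then have "(\<Sum>W\<in>{}. scaled (c W) W) - chain 0 0 \<in> I" using I_0 by metis
    then show ?case by (intro bexI[of _ 0] exI[of _ 0] conjI impI order_refl int_vecs_0)
  next
    case (insert W D)
    have "\<exists>x\<in>int_vecs \<Lambda>. \<exists>n. (\<Sum>W\<in>D. scaled (c W) W) - chain x n \<in> I \<and> ((\<forall>W\<in>D. 0 \<le> c W) \<longrightarrow> 0 \<le> x)"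
      by (rule insert.IH) (rule insert.prems, erule insertI2)
    then obtain x n where x: "x \<in> int_vecs \<Lambda>" "(\<Sum>W\<in>D. scaled (c W) W) - chain x n \<in> I"
      "(\<forall>W\<in>D. 0 \<le> c W) \<longrightarrow> 0 \<le> x" by blast
    obtain l m where l: "l \<in> mor \<Lambda>" "W = cylinder \<Lambda> l \<times> {m}"
      using insert.prems[OF insertI1] unfolding cyl_base_def by blast
    let ?y = "\<lambda>v. c W * basis_vec (src \<Lambda> l) v"
    let ?m = "m + to_int (deg \<Lambda> l)"
    have y: "?y \<in> int_vecs \<Lambda>" using l(1) src_vertex[of l] by (auto simp: int_vecs_def basis_vec_def)
    have W: "scaled (c W) W - chain ?y ?m \<in> I"
      unfolding l(2) using scaled_chain[OF l(1), of "c (cylinder \<Lambda> l \<times> {m})" m] .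
    let ?N = "sup n ?m"
    let ?x' = "vec_mat \<Lambda> x (to_nat (?N - n))" and ?y' = "vec_mat \<Lambda> ?y (to_nat (?N - ?m))"
    have 1: "scaled (c W) W - chain ?y' ?N \<in> I"
      using W I_sym[OF chain_lift[OF sup_ge2]] by (rule I_trans)
    have 2: "(\<Sum>W\<in>D. scaled (c W) W) - chain ?x' ?N \<in> I"
      using x(2) I_sym[OF chain_lift[OF sup_ge1]] by (rule I_trans)
    have "(\<Sum>W\<in>insert W D. scaled (c W) W) = scaled (c W) W + (\<Sum>W\<in>D. scaled (c W) W)"
      using insert.hyps by (rule sum.insert)
    then have "(\<Sum>W\<in>insert W D. scaled (c W) W) - chain (?y' + ?x') ?N =
      (scaled (c W) W - chain ?y' ?N) + ((\<Sum>W\<in>D. scaled (c W) W) - chain ?x' ?N)"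
      unfolding chain_add by (simp only: add_diff_add)
    from I_add[OF 1 2, folded this]
    have "(\<Sum>W\<in>insert W D. scaled (c W) W) - chain (?y' + ?x') ?N \<in> I" .
    moreover have "0 \<le> ?y' + ?x'" if "\<forall>W\<in>insert W D. 0 \<le> c W"
    proof -
      have "0 \<le> ?y" "0 \<le> x" using that x(3) by (auto simp: le_fun_def basis_vec_def)
      then show ?thesis using vec_mat_nonneg[of ?y "to_nat (?N - ?m)"] vec_mat_nonneg[of x "to_nat (?N - n)"]
        by (simp add: le_fun_def)
    qed
    ultimately show ?case by (intro bexI[of _ "?y' + ?x'"] exI[of _ ?N] conjI impI) (simp_all only: int_vecs_add vec_mat_vecs)
  qed
  moreover have "0 \<le> c W" if "0 \<le> f" "W \<in> D" for W
    using c[OF that(2)] that(1) by (auto simp: le_fun_def)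
  ultimately show ?thesis unfolding f[symmetric] by blast
qed

end

section \<open>Linearity over the group ring as equivariance\<close>

lemma hom_finprod_group:
  assumes "comm_group K" "comm_group H" "f \<in> hom K H" "\<And>i. i \<in> A \<Longrightarrow> g i \<in> carrier K"
  shows "f (finprod K g A) = finprod H (\<lambda>i. f (g i)) A"
proof -
  interpret K: comm_group K by fact
  interpret H: comm_group H by fact
  have one: "f \<one>\<^bsub>K\<^esub> = \<one>\<^bsub>H\<^esub>" using hom_one[OF assms(3) K.is_group H.is_group] .
  show ?thesis using assms(4)
  proof (induction A rule: infinite_finite_induct)
    case (insert i A)
    have g: "g \<in> A \<rightarrow> carrier K" "g i \<in> carrier K" using insert.prems by auto
    have fg: "(\<lambda>i. f (g i)) \<in> A \<rightarrow> carrier H" "f (g i) \<in> carrier H"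
      using g assms(3) by (auto simp: hom_def)
    have "f (finprod K g (insert i A)) = f (g i) \<otimes>\<^bsub>H\<^esub> f (finprod K g A)"
      using insert.hyps g K.finprod_closed[OF g(1)] assms(3) by (simp add: K.finprod_insert hom_mult)
    then show ?case using insert fg g by (simp add: H.finprod_insert)
  qed (simp_all add: one)
qed

text \<open>Monomials of the group ring recover the action of single elements; conversely a
  homomorphism of commutative groups respects the finite products of integer powers that define
  scalar multiplication.\<close>

lemma gr_module_iso_iff:
  fixes act :: "('k \<Rightarrow> int) \<Rightarrow> 'c \<Rightarrow> 'c" and act' :: "('k \<Rightarrow> int) \<Rightarrow> 'd \<Rightarrow> 'd"
  assumes "comm_group K" "comm_group H"
    and act: "\<And>q c. c \<in> carrier K \<Longrightarrow> act q c \<in> carrier K"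
    and act': "\<And>q c. c \<in> carrier H \<Longrightarrow> act' q c \<in> carrier H"
  shows "gr_module_iso K act H act' f \<longleftrightarrow> f \<in> iso K H \<and> (\<forall>q. \<forall>c\<in>carrier K. f (act q c) = act' q (f c))"
proof -
  interpret K: comm_group K by fact
  interpret H: comm_group H by fact
  have singleK: "gr_smult K act (Poly_Mapping.single q 1) c = act q c" if "c \<in> carrier K" for q c
  proof -
    have "finprod K (\<lambda>q'. act q' c [^]\<^bsub>K\<^esub> (if q' = q then 1 else 0 :: int)) {q} = act q c"
      using act[OF that] by (simp add: K.finprod_insert)
    then show ?thesis by (simp add: gr_smult_def lookup_single when_def eq_commute[of q])
  qed
  have singleH: "gr_smult H act' (Poly_Mapping.single q 1) c = act' q c" if "c \<in> carrier H" for q c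
  proof -
    have "finprod H (\<lambda>q'. act' q' c [^]\<^bsub>H\<^esub> (if q' = q then 1 else 0 :: int)) {q} = act' q c"
      using act'[OF that] by (simp add: H.finprod_insert)
    then show ?thesis by (simp add: gr_smult_def lookup_single when_def eq_commute[of q])
  qed
  show ?thesis
  proof
    assume *: "gr_module_iso K act H act' f"
    then have iso: "f \<in> iso K H" by (simp add: gr_module_iso_def)
    have "f (act q c) = act' q (f c)" if c: "c \<in> carrier K" for q c
    proof -
      have fc: "f c \<in> carrier H" using iso c by (auto simp: iso_def hom_def)
      have "f (gr_smult K act (Poly_Mapping.single q 1) c) = gr_smult H act' (Poly_Mapping.single q 1) (f c)"
        using * c unfolding gr_module_iso_def by blast
      then show ?thesis using singleK[OF c] singleH[OF fc] by simp
    qed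
    then show "f \<in> iso K H \<and> (\<forall>q. \<forall>c\<in>carrier K. f (act q c) = act' q (f c))" using iso by blast
  next
    assume *: "f \<in> iso K H \<and> (\<forall>q. \<forall>c\<in>carrier K. f (act q c) = act' q (f c))"
    then have hom: "f \<in> hom K H" by (simp add: iso_def)
    have "f (gr_smult K act r c) = gr_smult H act' r (f c)" if c: "c \<in> carrier K" for r c
    proof -
      have "f (gr_smult K act r c) =
        finprod H (\<lambda>q. f (act q c [^]\<^bsub>K\<^esub> Poly_Mapping.lookup r q)) (Poly_Mapping.keys r)"
        unfolding gr_smult_def using assms hom act[OF c] by (intro hom_finprod_group) auto
      also have "\<dots> = gr_smult H act' r (f c)"
        unfolding gr_smult_def
      proof (rule H.finprod_cong')
        fix q
        have "f (act q c [^]\<^bsub>K\<^esub> Poly_Mapping.lookup r q) = f (act q c) [^]\<^bsub>H\<^esub> Poly_Mapping.lookup r q"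
          using hom_int_pow[OF hom act[OF c] K.is_group H.is_group] .
        then show "f (act q c [^]\<^bsub>K\<^esub> Poly_Mapping.lookup r q) = act' q (f c) [^]\<^bsub>H\<^esub> Poly_Mapping.lookup r q"
          using * c by metis
      next
        show "(\<lambda>q. act' q (f c) [^]\<^bsub>H\<^esub> Poly_Mapping.lookup r q) \<in> Poly_Mapping.keys r \<rightarrow> carrier H"
          using hom c act' by (auto simp: hom_def)
      qed simp
      finally show ?thesis .
    qed
    then show "gr_module_iso K act H act' f" using * by (simp add: gr_module_iso_def)
  qed
qed

context finite_kgraph begin

section \<open>Graded homology described by chain classes\<close>

abbreviation "chain_class x n \<equiv> H0gr_class \<Lambda> (chain x n)"

lemma chain_class_eq_iff:
  "x \<in> int_vecs \<Lambda> \<Longrightarrow> y \<in> int_vecs \<Lambda> \<Longrightarrow>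
    chain_class x n = chain_class y m \<longleftrightarrow> dim_class \<Lambda> x n = dim_class \<Lambda> y m"
  by (simp only: H0gr_class_eq_iff chain_diff_I_iff)

lemma chain_class_carrier: "chain_class x n \<in> carrier (H0gr \<Lambda>)"
  unfolding H0gr_carrier_iff using chain_Cc by blast

lemma H0gr_carrierE:
  assumes "h \<in> carrier (H0gr \<Lambda>)"
  obtains x n where "x \<in> int_vecs \<Lambda>" "h = chain_class x n"
proof -
  obtain f where f: "f \<in> carrier (Cc (obj_top G))" "h = H0gr_class \<Lambda> f" using assms unfolding H0gr_carrier_iff by blast
  obtain x n where "x \<in> int_vecs \<Lambda>" "f - chain x n \<in> I" using chain_repr[OF f(1)] by blast
  then show thesis using that f(2) H0gr_class_eq_iff by metis
qed

lemma chain_class_mult: "chain_class x n \<otimes>\<^bsub>H0gr \<Lambda>\<^esub> chain_class y n = chain_class (x + y) n"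
  unfolding chain_add by (rule H0gr_mult[OF chain_Cc chain_Cc])

lemma chain_class_lift: "n \<le> N \<Longrightarrow> chain_class x n = chain_class (vec_mat \<Lambda> x (to_nat (N - n))) N"
  unfolding H0gr_class_eq_iff by (intro I_sym[OF chain_lift])

lemma H0gr_carrierE2:
  assumes "h \<in> carrier (H0gr \<Lambda>)" "h' \<in> carrier (H0gr \<Lambda>)"
  obtains x y n where "x \<in> int_vecs \<Lambda>" "h = chain_class x n" "y \<in> int_vecs \<Lambda>" "h' = chain_class y n"
proof -
  obtain x n where x: "x \<in> int_vecs \<Lambda>" "h = chain_class x n" using assms(1) by (rule H0gr_carrierE)
  obtain y m where y: "y \<in> int_vecs \<Lambda>" "h' = chain_class y m" using assms(2) by (rule H0gr_carrierE)
  have "h = chain_class (vec_mat \<Lambda> x (to_nat (sup n m - n))) (sup n m)"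
    unfolding x(2) by (rule chain_class_lift) simp
  moreover have "h' = chain_class (vec_mat \<Lambda> y (to_nat (sup n m - m))) (sup n m)"
    unfolding y(2) by (rule chain_class_lift) simp
  ultimately show thesis using that vec_mat_vecs by metis
qed

lemma H0gr_pos_iff: "h \<in> H0gr_pos \<Lambda> \<longleftrightarrow> (\<exists>x n. x \<in> int_vecs \<Lambda> \<and> 0 \<le> x \<and> h = chain_class x n)"
proof
  assume "h \<in> H0gr_pos \<Lambda>"
  then obtain f where f: "f \<in> carrier (Cc (obj_top G))" "0 \<le> f" "h = H0gr_class \<Lambda> f"
    unfolding H0gr_pos_def H0_pos_def H0gr_class_def by blast
  obtain x n where "x \<in> int_vecs \<Lambda>" "f - chain x n \<in> I" "0 \<le> x" using chain_repr[OF f(1)] f(2) by blast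
  then show "\<exists>x n. x \<in> int_vecs \<Lambda> \<and> 0 \<le> x \<and> h = chain_class x n" using f(3) H0gr_class_eq_iff by metis
next
  assume "\<exists>x n. x \<in> int_vecs \<Lambda> \<and> 0 \<le> x \<and> h = chain_class x n"
  then obtain x n where x: "x \<in> int_vecs \<Lambda>" "0 \<le> x" "h = chain_class x n" by blast
  then show "h \<in> H0gr_pos \<Lambda>"
    unfolding H0gr_pos_def H0_pos_def H0gr_class_def using chain_Cc chain_nonneg[OF x(2)] by blast
qed

text \<open>Acting by \<open>q\<close> on functions is composition with translation by
  \<open>- q\<close>, which moves the slice \<open>n\<close> to \<open>n + q\<close>.\<close>

lemma scaled_translate:
  fixes W :: "'c set" and n q :: "'k \<Rightarrow> int"
  shows "scaled c (W \<times> {n}) \<circ> skew_act (- q) = scaled c (W \<times> {n + q})"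
proof
  fix z :: "'c \<times> ('k \<Rightarrow> int)"
  obtain y m where z: "z = (y, m)" by (cases z)
  have "- q + m = n \<longleftrightarrow> m = n + q" by (metis add.commute add.left_cancel add_minus_cancel)
  then show "(scaled c (W \<times> {n}) \<circ> skew_act (- q)) z = scaled c (W \<times> {n + q}) z"
    unfolding z scaled_def o_def skew_act_def by simp
qed

lemma chain_translate: "chain x n \<circ> skew_act (- q) = chain x (n + q)"
proof
  fix z :: "('a, 'k) ipath \<times> ('k \<Rightarrow> int)"
  obtain y m where z: "z = (y, m)" by (cases z)
  have "- q + m = n \<longleftrightarrow> m = n + q" by (metis add.commute add.left_cancel add_minus_cancel)
  then show "(chain x n \<circ> skew_act (- q)) z = chain x (n + q) z"
    unfolding z chain_def o_def skew_act_def by simp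
qed

text \<open>A translated generator is the generator with base slice \<open>n + q\<close>. Hence the
  action descends to classes.\<close>

lemma I_translate: "f \<in> I \<Longrightarrow> f \<circ> skew_act (- q) \<in> I"
proof (induction rule: I_induct)
  case zero
  have "(0 :: ('a, 'k) gr_chain) \<circ> skew_act (- q) = 0" by (rule ext) simp
  then show ?case using I_0 by metis
next
  case (step f c l m n)
  have *: "(a - b + f) \<circ> h = (a \<circ> h) - (b \<circ> h) + (f \<circ> h)" for a b f :: "('a, 'k) gr_chain" and h
    by (rule ext) simp
  have e: "n + to_int (deg \<Lambda> l) - to_int (deg \<Lambda> m) + q = (n + q) + to_int (deg \<Lambda> l) - to_int (deg \<Lambda> m)"
    by (simp add: algebra_simps)
  have "(cyl_diff c l m n + f) \<circ> skew_act (- q) = cyl_diff c l m (n + q) + (f \<circ> skew_act (- q))"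
    unfolding cyl_diff_def * scaled_translate e ..
  then show ?case using I_add[OF cyl_diff_I[OF step(2-4)] step(1)] by metis
qed

lemma H0gr_act_class: "H0gr_act \<Lambda> q (H0gr_class \<Lambda> f) = H0gr_class \<Lambda> (f \<circ> skew_act (- q))"
proof -
  have "H0gr_class \<Lambda> (g \<circ> skew_act (- q)) = H0gr_class \<Lambda> (f \<circ> skew_act (- q))" if "g \<in> H0gr_class \<Lambda> f" for g
  proof -
    have "g - f \<in> I" using that unfolding H0gr_class_eq by auto
    then have "(g - f) \<circ> skew_act (- q) \<in> I" by (rule I_translate)
    moreover have "(g - f) \<circ> skew_act (- q) = (g \<circ> skew_act (- q)) - (f \<circ> skew_act (- q))" by (rule ext) simp
    ultimately show ?thesis unfolding H0gr_class_eq_iff by metis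
  qed
  moreover have "f \<in> H0gr_class \<Lambda> f" unfolding H0gr_class_eq
    by (rule image_eqI[of f "\<lambda>h. h + f" 0, OF add_0[symmetric] I_0])
  ultimately show ?thesis unfolding H0gr_act_def by (metis (no_types, lifting) SUP_eq_const empty_iff)
qed

lemma H0gr_act_chain: "H0gr_act \<Lambda> q (chain_class x n) = chain_class x (n + q)"
  unfolding H0gr_act_class chain_translate ..

lemma H0gr_act_carrier: "h \<in> carrier (H0gr \<Lambda>) \<Longrightarrow> H0gr_act \<Lambda> q h \<in> carrier (H0gr \<Lambda>)"
  by (metis H0gr_carrierE H0gr_act_chain chain_class_carrier)

lemma indicator_class:
  "l \<in> mor \<Lambda> \<Longrightarrow> H0gr_class \<Lambda> (indicator (cylinder \<Lambda> l \<times> {n})) =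
    chain_class (basis_vec (src \<Lambda> l)) (n + to_int (deg \<Lambda> l))"
  using scaled_chain[of l 1 n] unfolding H0gr_class_eq_iff scaled_1 by simp

lemma indicator_chain: "indicator (ipaths \<Lambda> \<times> {n}) = chain (indicator (vertices \<Lambda>)) n"
proof
  fix z :: "('a, 'k) ipath \<times> ('k \<Rightarrow> int)"
  show "indicator (ipaths \<Lambda> \<times> {n}) z = chain (indicator (vertices \<Lambda>)) n z"
    using ipath_vertex by (cases z) (auto simp: chain_def indicator_def)
qed

section \<open>The canonical identification with the dimension group\<close>

text \<open>An explicit candidate for \<open>Theta\<close>: every class is a chain class, and
  equality of chain classes is equality in the dimension group, so the description is unambiguous.
  The restriction matches the extensionality demanded of \<open>Theta\<close>.\<close>

definition theta :: "('a, 'k) gr_chain set \<Rightarrow> (('a \<Rightarrow> int) \<times> ('k \<Rightarrow> int)) set" where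
  "theta = restrict (\<lambda>h. THE P. \<exists>x n. x \<in> int_vecs \<Lambda> \<and> h = chain_class x n \<and> P = dim_class \<Lambda> x n)
    (carrier (H0gr \<Lambda>))"

lemma theta_chain: "x \<in> int_vecs \<Lambda> \<Longrightarrow> theta (chain_class x n) = dim_class \<Lambda> x n"
proof -
  assume x: "x \<in> int_vecs \<Lambda>"
  have "(THE P. \<exists>y m. y \<in> int_vecs \<Lambda> \<and> chain_class x n = chain_class y m \<and> P = dim_class \<Lambda> y m) = dim_class \<Lambda> x n"
  proof (rule the_equality)
    show "\<exists>y m. y \<in> int_vecs \<Lambda> \<and> chain_class x n = chain_class y m \<and> dim_class \<Lambda> x n = dim_class \<Lambda> y m"
      using x by blast
  qed (use x chain_class_eq_iff in metis)
  then show ?thesis using chain_class_carrier by (simp add: theta_def)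
qed

lemma theta_iso: "theta \<in> iso (H0gr \<Lambda>) (dim_group \<Lambda>)"
  unfolding iso_def mem_Collect_eq
proof
  show "theta \<in> hom (H0gr \<Lambda>) (dim_group \<Lambda>)"
  proof (rule homI)
    fix h assume "h \<in> carrier (H0gr \<Lambda>)"
    then obtain x n where "x \<in> int_vecs \<Lambda>" "h = chain_class x n" by (rule H0gr_carrierE)
    then show "theta h \<in> carrier (dim_group \<Lambda>)" using theta_chain dim_class_carrier by metis
  next
    fix h h' assume "h \<in> carrier (H0gr \<Lambda>)" "h' \<in> carrier (H0gr \<Lambda>)"
    then obtain x y n where x: "x \<in> int_vecs \<Lambda>" "h = chain_class x n" "y \<in> int_vecs \<Lambda>" "h' = chain_class y n"
      by (rule H0gr_carrierE2)
    show "theta (h \<otimes>\<^bsub>H0gr \<Lambda>\<^esub> h') = theta h \<otimes>\<^bsub>dim_group \<Lambda>\<^esub> theta h'"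
      unfolding x(2,4) chain_class_mult theta_chain[OF x(1)] theta_chain[OF x(3)] dim_mult[OF x(1,3)]
      by (rule theta_chain[OF int_vecs_add[OF x(1,3)]])
  qed
  show "bij_betw theta (carrier (H0gr \<Lambda>)) (carrier (dim_group \<Lambda>))"
    unfolding bij_betw_def
  proof
    show "inj_on theta (carrier (H0gr \<Lambda>))"
    proof (rule inj_onI)
      fix h h' assume h: "h \<in> carrier (H0gr \<Lambda>)" and h': "h' \<in> carrier (H0gr \<Lambda>)" and eq: "theta h = theta h'"
      obtain x n where x: "x \<in> int_vecs \<Lambda>" "h = chain_class x n" using h by (rule H0gr_carrierE)
      obtain y m where y: "y \<in> int_vecs \<Lambda>" "h' = chain_class y m" using h' by (rule H0gr_carrierE)
      show "h = h'"
        using eq unfolding x(2) y(2) theta_chain[OF x(1)] theta_chain[OF y(1)] chain_class_eq_iff[OF x(1) y(1)] .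
    qed
    show "theta ` carrier (H0gr \<Lambda>) = carrier (dim_group \<Lambda>)"
    proof
      show "theta ` carrier (H0gr \<Lambda>) \<subseteq> carrier (dim_group \<Lambda>)"
        by (rule image_subsetI) (metis H0gr_carrierE theta_chain dim_class_carrier)
      show "carrier (dim_group \<Lambda>) \<subseteq> theta ` carrier (H0gr \<Lambda>)"
      proof
        fix P assume "P \<in> carrier (dim_group \<Lambda>)"
        then obtain x n where "x \<in> int_vecs \<Lambda>" "P = dim_class \<Lambda> x n" unfolding dim_carrier_iff by blast
        then show "P \<in> theta ` carrier (H0gr \<Lambda>)" using theta_chain chain_class_carrier by (metis image_eqI)
      qed
    qed
  qed
qed

lemma theta_act: "h \<in> carrier (H0gr \<Lambda>) \<Longrightarrow> theta (H0gr_act \<Lambda> q h) = dim_act \<Lambda> q (theta h)"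
proof -
  assume "h \<in> carrier (H0gr \<Lambda>)"
  then obtain x n where x: "x \<in> int_vecs \<Lambda>" "h = chain_class x n" by (rule H0gr_carrierE)
  show ?thesis unfolding x(2) H0gr_act_chain theta_chain[OF x(1)] dim_act_class[OF x(1)] ..
qed

lemma theta_pos: "theta ` H0gr_pos \<Lambda> = dim_pos \<Lambda>"
proof
  show "theta ` H0gr_pos \<Lambda> \<subseteq> dim_pos \<Lambda>"
  proof (rule image_subsetI)
    fix h assume "h \<in> H0gr_pos \<Lambda>"
    then obtain x n where "x \<in> int_vecs \<Lambda>" "0 \<le> x" "h = chain_class x n" unfolding H0gr_pos_iff by blast
    then show "theta h \<in> dim_pos \<Lambda>" using theta_chain dim_class_pos by metis
  qed
  show "dim_pos \<Lambda> \<subseteq> theta ` H0gr_pos \<Lambda>"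
  proof
    fix P assume "P \<in> dim_pos \<Lambda>"
    then obtain x n where x: "x \<in> int_vecs \<Lambda>" "0 \<le> x" "P = dim_class \<Lambda> x n" by (rule dim_posE)
    then have "P = theta (chain_class x n)" using theta_chain by metis
    moreover have "chain_class x n \<in> H0gr_pos \<Lambda>" unfolding H0gr_pos_iff using x by blast
    ultimately show "P \<in> theta ` H0gr_pos \<Lambda>" by blast
  qed
qed

text \<open>The functions on whose classes the two maps agree form a group; it contains the
  indicators of cylinder slices, which generate all functions. This is the uniqueness behind
  \<open>Theta\<close>.\<close>

lemma H0gr_hom_eqI:
  assumes \<theta>: "\<theta> \<in> hom (H0gr \<Lambda>) K" and \<theta>': "\<theta>' \<in> hom (H0gr \<Lambda>) K" and K: "comm_group K"
    and eq: "\<And>l n. l \<in> mor \<Lambda> \<Longrightarrow>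
      \<theta> (H0gr_class \<Lambda> (indicator (cylinder \<Lambda> l \<times> {n}))) = \<theta>' (H0gr_class \<Lambda> (indicator (cylinder \<Lambda> l \<times> {n})))"
    and h: "h \<in> carrier (H0gr \<Lambda>)"
  shows "\<theta> h = \<theta>' h"
proof -
  interpret K: comm_group K by fact
  have grp: "group (H0gr \<Lambda>)" using comm_group_H0gr by (simp add: comm_group_def)
  define S where "S = {f \<in> carrier (Cc (obj_top G)). \<theta> (H0gr_class \<Lambda> f) = \<theta>' (H0gr_class \<Lambda> f)}"
  have cl: "H0gr_class \<Lambda> f \<in> carrier (H0gr \<Lambda>)" if "f \<in> carrier (Cc (obj_top G))" for f
    using that unfolding H0gr_carrier_iff by blast
  have clK: "\<theta> (H0gr_class \<Lambda> f) \<in> carrier K" "\<theta>' (H0gr_class \<Lambda> f) \<in> carrier K"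
    if "f \<in> carrier (Cc (obj_top G))" for f
    using cl[OF that] \<theta> \<theta>' by (auto simp: hom_def)
  have mult: "\<theta> (H0gr_class \<Lambda> (f + g)) = \<theta> (H0gr_class \<Lambda> f) \<otimes>\<^bsub>K\<^esub> \<theta> (H0gr_class \<Lambda> g)"
    "\<theta>' (H0gr_class \<Lambda> (f + g)) = \<theta>' (H0gr_class \<Lambda> f) \<otimes>\<^bsub>K\<^esub> \<theta>' (H0gr_class \<Lambda> g)"
    if fg: "f \<in> carrier (Cc (obj_top G))" "g \<in> carrier (Cc (obj_top G))" for f g
    using hom_mult[OF \<theta> cl[OF fg(1)] cl[OF fg(2)]] hom_mult[OF \<theta>' cl[OF fg(1)] cl[OF fg(2)]]
    unfolding H0gr_mult[OF fg] by blast+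
  have S_add: "f + g \<in> S" if "f \<in> S" "g \<in> S" for f g
    using that mult[of f g] Cc_add[of f _ g] unfolding S_def by simp
  have "H0gr_class \<Lambda> 0 = \<one>\<^bsub>H0gr \<Lambda>\<^esub>"
    unfolding H0gr_class_eq H0gr_def H0_def FactGroup_def by simp
  then have z: "\<theta> (H0gr_class \<Lambda> 0) = \<one>\<^bsub>K\<^esub>" "\<theta>' (H0gr_class \<Lambda> 0) = \<one>\<^bsub>K\<^esub>"
    using hom_one[OF \<theta> grp K.is_group] hom_one[OF \<theta>' grp K.is_group] by simp_all
  then have S_0: "0 \<in> S" unfolding S_def using Cc_zero by (intro CollectI conjI) (simp_all only:)
  have S_uminus: "- f \<in> S" if "f \<in> S" for f
  proof -
    have f: "f \<in> carrier (Cc (obj_top G))" "\<theta> (H0gr_class \<Lambda> f) = \<theta>' (H0gr_class \<Lambda> f)" using that by (simp_all add: S_def)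
    have mf: "- f \<in> carrier (Cc (obj_top G))" using f(1) by (rule Cc_uminus)
    have "f + - f = 0" by (rule right_minus)
    then have "\<theta> (H0gr_class \<Lambda> f) \<otimes>\<^bsub>K\<^esub> \<theta> (H0gr_class \<Lambda> (- f)) = \<theta> (H0gr_class \<Lambda> f) \<otimes>\<^bsub>K\<^esub> \<theta>' (H0gr_class \<Lambda> (- f))"
      using mult[OF f(1) mf] z f(2) by metis
    then have "\<theta> (H0gr_class \<Lambda> (- f)) = \<theta>' (H0gr_class \<Lambda> (- f))"
      using clK[OF f(1)] clK[OF mf] by (simp add: K.Units_l_cancel K.Units_eq)
    then show ?thesis using mf by (simp add: S_def)
  qed
  have one: "scaled 1 (cylinder \<Lambda> l \<times> {n}) \<in> S" if "l \<in> mor \<Lambda>" for l n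
    using scaled_cyl_Cc[OF that, of 1 n] eq[OF that, of n] unfolding S_def scaled_1 by simp
  have nat: "scaled (int k) (cylinder \<Lambda> l \<times> {n}) \<in> S" if "l \<in> mor \<Lambda>" for k l n
  proof (induction k)
    case 0
    have "scaled (int 0) (cylinder \<Lambda> l \<times> {n}) = 0" by (rule ext) (simp add: scaled_def)
    then show ?case using S_0 by metis
  next
    case (Suc k)
    have "scaled (int (Suc k)) (cylinder \<Lambda> l \<times> {n}) =
      scaled (int k) (cylinder \<Lambda> l \<times> {n}) + scaled 1 (cylinder \<Lambda> l \<times> {n})"
      by (rule ext) (simp add: scaled_def)
    then show ?case using S_add[OF Suc one[OF that]] by metis
  qed
  have int: "scaled c (cylinder \<Lambda> l \<times> {n}) \<in> S" if l: "l \<in> mor \<Lambda>" for c l n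
  proof (cases "0 \<le> c")
    case True
    then show ?thesis using nat[OF l, of "nat c" n] by simp
  next
    case False
    have "scaled c (cylinder \<Lambda> l \<times> {n}) = - scaled (int (nat (- c))) (cylinder \<Lambda> l \<times> {n})"
      using False by (intro ext) (simp add: scaled_def)
    then show ?thesis using S_uminus[OF nat[OF l]] by metis
  qed
  obtain f where f: "f \<in> carrier (Cc (obj_top G))" "h = H0gr_class \<Lambda> f" using h unfolding H0gr_carrier_iff by blast
  have "f \<in> S"
  proof (rule level_base.Cc_decomp[OF level_base_obj_skew f(1)])
    fix L D c
    assume D: "finite D" "\<And>W. W \<in> D \<Longrightarrow> \<exists>V (n :: 'k \<Rightarrow> int). W = V \<times> {n} \<and> cyl_base L V"
      and f: "f = (\<Sum>W\<in>D. scaled (c W) W)"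
    have W: "scaled (c W) W \<in> S" if "W \<in> D" for W
      using D(2)[OF that] int unfolding cyl_base_def by blast
    have "(\<Sum>W\<in>D. scaled (c W) W) \<in> S"
      using D(1) W
    proof (induction D rule: finite_induct)
      case empty
      show ?case unfolding sum.empty by (rule S_0)
    next
      case (insert W D)
      have "(\<Sum>W\<in>D. scaled (c W) W) \<in> S" by (rule insert.IH) (rule insert.prems, erule insertI2)
      then show ?case unfolding sum.insert[OF insert.hyps] using insert.prems[OF insertI1] by (intro S_add)
    qed
    then show "f \<in> S" using f by metis
  qed
  then show ?thesis unfolding f(2) S_def by blast
qed

lemma gr_module_iso_theta_iff:
  "gr_module_iso (H0gr \<Lambda>) (H0gr_act \<Lambda>) (dim_group \<Lambda>) (dim_act \<Lambda>) \<theta> \<longleftrightarrow>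
    \<theta> \<in> iso (H0gr \<Lambda>) (dim_group \<Lambda>) \<and> (\<forall>q. \<forall>h\<in>carrier (H0gr \<Lambda>). \<theta> (H0gr_act \<Lambda> q h) = dim_act \<Lambda> q (\<theta> h))"
  using comm_group_H0gr comm_group_dim_group H0gr_act_carrier dim_act_carrier by (rule gr_module_iso_iff)

text \<open>The definite description is resolved: \<open>theta\<close> has the required properties,
  and any competitor agrees with it on generators and outside the carrier.\<close>

lemma Theta_eq: "Theta \<Lambda> = theta"
  unfolding Theta_def
proof (rule the_equality)
  have "gr_module_iso (H0gr \<Lambda>) (H0gr_act \<Lambda>) (dim_group \<Lambda>) (dim_act \<Lambda>) theta"
    unfolding gr_module_iso_theta_iff using theta_iso theta_act by blast
  moreover have "theta (H0gr_class \<Lambda> (indicator (cylinder \<Lambda> l \<times> {n}))) =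
    dim_class \<Lambda> (basis_vec (src \<Lambda> l)) (n + to_int (deg \<Lambda> l))" if "l \<in> mor \<Lambda>" for l n
    unfolding indicator_class[OF that] using that by (intro theta_chain) simp
  ultimately show "theta \<in> extensional (carrier (H0gr \<Lambda>)) \<and>
     gr_module_iso (H0gr \<Lambda>) (H0gr_act \<Lambda>) (dim_group \<Lambda>) (dim_act \<Lambda>) theta \<and>
     theta ` H0gr_pos \<Lambda> = dim_pos \<Lambda> \<and>
     (\<forall>l \<in> mor \<Lambda>. \<forall>n. theta (H0gr_class \<Lambda> (indicator (cylinder \<Lambda> l \<times> {n}))) =
        dim_class \<Lambda> (basis_vec (src \<Lambda> l)) (n + to_int (deg \<Lambda> l)))"
    using theta_pos by (simp add: theta_def)
next
  fix \<theta>
  assume *: "\<theta> \<in> extensional (carrier (H0gr \<Lambda>)) \<and>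
     gr_module_iso (H0gr \<Lambda>) (H0gr_act \<Lambda>) (dim_group \<Lambda>) (dim_act \<Lambda>) \<theta> \<and>
     \<theta> ` H0gr_pos \<Lambda> = dim_pos \<Lambda> \<and>
     (\<forall>l \<in> mor \<Lambda>. \<forall>n. \<theta> (H0gr_class \<Lambda> (indicator (cylinder \<Lambda> l \<times> {n}))) =
        dim_class \<Lambda> (basis_vec (src \<Lambda> l)) (n + to_int (deg \<Lambda> l)))"
  have hom: "\<theta> \<in> hom (H0gr \<Lambda>) (dim_group \<Lambda>)" "theta \<in> hom (H0gr \<Lambda>) (dim_group \<Lambda>)"
    using * theta_iso by (auto simp: gr_module_iso_def iso_def)
  show "\<theta> = theta"
  proof (rule extensionalityI)
    show "\<theta> \<in> extensional (carrier (H0gr \<Lambda>))" using * by blast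
    show "theta \<in> extensional (carrier (H0gr \<Lambda>))" by (simp add: theta_def)
    fix h assume h: "h \<in> carrier (H0gr \<Lambda>)"
    show "\<theta> h = theta h"
    proof (rule H0gr_hom_eqI[OF hom comm_group_dim_group _ h])
      fix l n assume l: "l \<in> mor \<Lambda>"
      have "theta (H0gr_class \<Lambda> (indicator (cylinder \<Lambda> l \<times> {n}))) =
        dim_class \<Lambda> (basis_vec (src \<Lambda> l)) (n + to_int (deg \<Lambda> l))"
        unfolding indicator_class[OF l] using l by (intro theta_chain) simp
      then show "\<theta> (H0gr_class \<Lambda> (indicator (cylinder \<Lambda> l \<times> {n}))) =
        theta (H0gr_class \<Lambda> (indicator (cylinder \<Lambda> l \<times> {n})))"
        using * l by metis
    qed
  qed
qed

lemma indicator_vecs: "indicator (vertices \<Lambda>) \<in> int_vecs \<Lambda>"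
  by (simp add: int_vecs_def)

lemma Theta_unit: "Theta \<Lambda> (H0gr_class \<Lambda> (indicator (ipaths \<Lambda> \<times> {0}))) = dim_unit \<Lambda>"
  unfolding Theta_eq indicator_chain dim_unit_def by (rule theta_chain[OF indicator_vecs])

lemma unit_class_carrier: "H0gr_class \<Lambda> (indicator (ipaths \<Lambda> \<times> {0})) \<in> carrier (H0gr \<Lambda>)"
  unfolding indicator_chain by (rule chain_class_carrier)

end

section \<open>The talented monoid as a positive cone\<close>

lemma count_sum_mset: "count (\<Sum>z\<in>#M. F z) y = (\<Sum>z\<in>#M. count (F z) y)"
  by (induction M) auto

context finite_kgraph begin

definition bounded_by :: "('k \<Rightarrow> int) \<Rightarrow> ('a \<times> ('k \<Rightarrow> int)) multiset \<Rightarrow> bool" where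
  "bounded_by L M \<longleftrightarrow> (\<forall>z\<in>#M. snd z \<le> L)"

lemma ex_bound: "\<exists>L. bounded_by L M"
proof (induction M)
  case empty
  show ?case by (simp add: bounded_by_def)
next
  case (add z M)
  then obtain L where "bounded_by L M" by blast
  then have "bounded_by (sup L (snd z)) (add_mset z M)"
    unfolding bounded_by_def by (auto intro: le_supI1)
  then show ?case by blast
qed

lemma bounded_by_mono: "bounded_by L M \<Longrightarrow> L \<le> L' \<Longrightarrow> bounded_by L' M"
  unfolding bounded_by_def using order_trans by blast

lemma bounded_by_add: "bounded_by L (M + N) \<longleftrightarrow> bounded_by L M \<and> bounded_by L N"
  unfolding bounded_by_def by auto

lemma tal_free_add: "M + N \<in> tal_free \<Lambda> \<longleftrightarrow> M \<in> tal_free \<Lambda> \<and> N \<in> tal_free \<Lambda>"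
  by (simp add: tal_free_def)

lemma tal_free_add_mset: "add_mset z M \<in> tal_free \<Lambda> \<longleftrightarrow> fst z \<in> vertices \<Lambda> \<and> M \<in> tal_free \<Lambda>"
  unfolding tal_free_def by (cases z) auto

lemma tal_free_empty: "{#} \<in> tal_free \<Lambda>"
  by (simp add: tal_free_def)

lemma tal_cong_free: "tal_cong \<Lambda> M N \<Longrightarrow> M \<in> tal_free \<Lambda> \<and> N \<in> tal_free \<Lambda>"
proof (induction rule: tal_cong.induct)
  case (gen v n i)
  have "src \<Lambda> a \<in> vertices \<Lambda>" if "a \<in> paths_from \<Lambda> v (basis_vec i)" for a
    using that src_vertex[of a] by (simp add: paths_from_iff)
  then show ?case using gen finite_paths_from[OF gen] by (auto simp: tal_free_def)
qed (simp_all add: tal_free_add)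

text \<open>The vertex multiplicities after all generators have been expanded to level
  \<open>L\<close>. It has this meaning only if \<open>L\<close> bounds the levels in
  \<open>M\<close>, since \<open>to_nat\<close> truncates negative differences.\<close>

definition mvec :: "('k \<Rightarrow> int) \<Rightarrow> ('a \<times> ('k \<Rightarrow> int)) multiset \<Rightarrow> 'a \<Rightarrow> int" where
  "mvec L M v = (\<Sum>z\<in>#M. vec_mat \<Lambda> (basis_vec (fst z)) (to_nat (L - snd z)) v)"

lemma mvec_empty: "mvec L {#} = 0"
  by (rule ext) (simp add: mvec_def)

lemma mvec_add_mset: "mvec L (add_mset z M) = vec_mat \<Lambda> (basis_vec (fst z)) (to_nat (L - snd z)) + mvec L M"
  by (rule ext) (simp add: mvec_def)

lemma mvec_add: "mvec L (M + N) = mvec L M + mvec L N"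
  by (rule ext) (simp add: mvec_def)

lemma mvec_vecs: "mvec L M \<in> int_vecs \<Lambda>"
  by (induction M) (simp_all only: mvec_empty mvec_add_mset int_vecs_0 int_vecs_add vec_mat_vecs)

lemma basis_vec_nonneg: "0 \<le> (basis_vec v :: 'a \<Rightarrow> int)"
  by (simp add: le_fun_def basis_vec_def)

lemma mvec_nonneg: "0 \<le> mvec L M"
proof -
  have "0 \<le> mvec L M v" for v
    using vec_mat_nonneg[OF basis_vec_nonneg] unfolding mvec_def le_fun_def
    by (induction M) (simp_all add: add_nonneg_nonneg)
  then show ?thesis by (simp add: le_fun_def)
qed

lemma mvec_lift:
  "bounded_by L M \<Longrightarrow> L \<le> L' \<Longrightarrow> vec_mat \<Lambda> (mvec L M) (to_nat (L' - L)) = mvec L' M"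
proof (induction M)
  case empty
  show ?case by (simp only: mvec_empty vec_mat_zero)
next
  case (add z M)
  then have z: "snd z \<le> L" "bounded_by L M" by (simp_all add: bounded_by_def)
  show ?case
    unfolding mvec_add_mset vec_mat_add add.IH[OF z(2) add.prems(2)] vec_mat_vec_mat
      to_nat_diff_split[OF z(1) add.prems(2), symmetric] ..
qed

text \<open>Eventual equality of expansions is a congruence, and it holds for the defining relations
  because expanding first in direction \<open>i\<close> does not change the expansion at levels
  above. The thresholds meet in suprema.\<close>

lemma tal_cong_mvec: "tal_cong \<Lambda> M N \<Longrightarrow> \<exists>L0. \<forall>L\<ge>L0. mvec L M = mvec L N"
proof (induction rule: tal_cong.induct)
  case (gen v n i)
  let ?P = "paths_from \<Lambda> v (basis_vec i)"
  have "mvec L {#(v, n)#} = mvec L (image_mset (\<lambda>\<alpha>. (src \<Lambda> \<alpha>, n + basis_vec i)) (mset_set ?P))"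
    if L: "n + basis_vec i \<le> L" for L
  proof
    fix w
    let ?q = "to_nat (L - (n + basis_vec i))"
    \<comment> \<open>Above \<open>n + basis_vec i\<close> neither difference is truncated, so the
      exponents on the two sides differ by exactly \<open>basis_vec i\<close>.\<close>
    have "n \<le> n + basis_vec i" by (auto simp: le_fun_def basis_vec_def)
    from to_nat_diff_split[OF this L] have q: "to_nat (L - n) = basis_vec i + ?q"
      using to_nat_simps(2)[of "basis_vec i"] by simp
    have "mvec L {#(v, n)#} w = vec_mat \<Lambda> (basis_vec v) (basis_vec i + ?q) w"
      by (simp add: mvec_def q)
    also have "\<dots> = (\<Sum>a\<in>?P. vec_mat \<Lambda> (basis_vec (src \<Lambda> a)) ?q w)"
    proof (cases "w \<in> vertices \<Lambda>")
      case True
      have "(\<Sum>a\<in>?P. vec_mat \<Lambda> (basis_vec (src \<Lambda> a)) ?q w) = (\<Sum>a\<in>?P. int (adj_mat \<Lambda> ?q (src \<Lambda> a) w))"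
        using True by (intro sum.cong) (auto simp: vec_mat_basis_vec paths_from_iff)
      also have "\<dots> = (\<Sum>u\<in>vertices \<Lambda>. int (adj_mat \<Lambda> (basis_vec i) v u) * int (adj_mat \<Lambda> ?q u w))"
        using sum_paths_from[OF gen, of "\<lambda>u. int (adj_mat \<Lambda> ?q u w)" "basis_vec i"] by simp
      also have "\<dots> = vec_mat \<Lambda> (basis_vec v) (basis_vec i + ?q) w"
        using True gen by (simp add: vec_mat_basis_vec adj_mat_add)
      finally show ?thesis by simp
    qed (simp add: vec_mat_def)
    also have "\<dots> = mvec L (image_mset (\<lambda>\<alpha>. (src \<Lambda> \<alpha>, n + basis_vec i)) (mset_set ?P)) w"
      by (simp add: mvec_def image_mset.compositionality o_def sum_unfold_sum_mset)
    finally show "mvec L {#(v, n)#} w = mvec L (image_mset (\<lambda>\<alpha>. (src \<Lambda> \<alpha>, n + basis_vec i)) (mset_set ?P)) w" .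
  qed
  then show ?case by blast
next
  case (refl M)
  show ?case by blast
next
  case (sym M N)
  then show ?case by metis
next
  case (trans M N P)
  then obtain L1 L2 where "\<forall>L\<ge>L1. mvec L M = mvec L N" "\<forall>L\<ge>L2. mvec L N = mvec L P" by blast
  then have "\<forall>L\<ge>sup L1 L2. mvec L M = mvec L P" by (metis le_supE)
  then show ?case by blast
next
  case (add M N M' N')
  then obtain L1 L2 where "\<forall>L\<ge>L1. mvec L M = mvec L N" "\<forall>L\<ge>L2. mvec L M' = mvec L N'" by blast
  then have "\<forall>L\<ge>sup L1 L2. mvec L (M + M') = mvec L (N + N')" unfolding mvec_add by (metis le_supE)
  then show ?case by blast
qed

section \<open>Normal forms in the talented monoid\<close>

text \<open>The normal form of an element: all its generators sit at level \<open>L\<close>, and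
  \<open>x\<close> counts them by vertex.\<close>

definition mrep :: "('a \<Rightarrow> nat) \<Rightarrow> ('k \<Rightarrow> int) \<Rightarrow> ('a \<times> ('k \<Rightarrow> int)) multiset" where
  "mrep x L = (\<Sum>v\<in>vertices \<Lambda>. replicate_mset (x v) (v, L))"

lemma count_mrep: "count (mrep x L) (w, m) = (if w \<in> vertices \<Lambda> \<and> m = L then x w else 0)"
proof -
  have "count (mrep x L) (w, m) = (\<Sum>v\<in>vertices \<Lambda>. if v = w then (if m = L then x w else 0) else 0)"
    unfolding mrep_def count_sum by (intro sum.cong) auto
  then show ?thesis using finite_vertices by simp
qed

lemma mrep_free: "mrep x L \<in> tal_free \<Lambda>"
proof -
  have "z \<in> vertices \<Lambda> \<times> UNIV" if "z \<in># mrep x L" for z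
  proof (cases z)
    case (Pair w m)
    then have "count (mrep x L) (w, m) \<noteq> 0" using that by simp
    then show ?thesis using Pair unfolding count_mrep by (auto split: if_splits)
  qed
  then show ?thesis unfolding tal_free_def by blast
qed

lemma sum_mset_mrep:
  fixes g :: "'a \<times> ('k \<Rightarrow> int) \<Rightarrow> 'c::comm_semiring_1"
  shows "(\<Sum>z\<in>#mrep x L. g z) = (\<Sum>v\<in>vertices \<Lambda>. of_nat (x v) * g (v, L))"
proof -
  have rep: "(\<Sum>z\<in>#replicate_mset k y. g z) = of_nat k * g y" for k y
    by (induction k) (auto simp: algebra_simps)
  have "(\<Sum>z\<in>#(\<Sum>v\<in>F. replicate_mset (x v) (v, L)). g z) = (\<Sum>v\<in>F. of_nat (x v) * g (v, L))" if "finite F" for F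
    using that by (induction F rule: finite_induct) (auto simp: rep)
  then show ?thesis unfolding mrep_def using finite_vertices by blast
qed

lemma tal_cong_sum_mset:
  assumes "M \<in> tal_free \<Lambda>" "\<And>z. z \<in># M \<Longrightarrow> tal_cong \<Lambda> {#z#} (F z)"
  shows "tal_cong \<Lambda> M (\<Sum>z\<in>#M. F z)"
  using assms
proof (induction M)
  case empty
  then show ?case using tal_cong.refl[OF tal_free_empty] by simp
next
  case (add z M)
  have "tal_cong \<Lambda> M (\<Sum>z\<in>#M. F z)" using add by (simp add: tal_free_add_mset)
  moreover have "tal_cong \<Lambda> {#z#} (F z)" using add.prems by simp
  ultimately have "tal_cong \<Lambda> ({#z#} + M) (F z + (\<Sum>z\<in>#M. F z))" by (intro tal_cong.add)
  then show ?case by simp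
qed

text \<open>Collecting the right-hand side of a defining relation by sources turns it into a row of
  the adjacency matrix.\<close>

lemma tal_cong_gen_mrep:
  assumes v: "v \<in> vertices \<Lambda>"
  shows "tal_cong \<Lambda> {#(v, n)#} (mrep (adj_mat \<Lambda> (basis_vec i) v) (n + basis_vec i))"
proof -
  let ?P = "paths_from \<Lambda> v (basis_vec i)"
  have "image_mset (\<lambda>\<alpha>. (src \<Lambda> \<alpha>, n + basis_vec i)) (mset_set ?P) = mrep (adj_mat \<Lambda> (basis_vec i) v) (n + basis_vec i)"
  proof (rule multiset_eqI)
    fix z :: "'a \<times> ('k \<Rightarrow> int)"
    obtain w m where z: "z = (w, m)" by (cases z)
    have "count (image_mset (\<lambda>\<alpha>. (src \<Lambda> \<alpha>, n + basis_vec i)) (mset_set ?P)) z =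
      card {a \<in> ?P. (src \<Lambda> a, n + basis_vec i) = z}"
      using finite_paths_from[OF v] by (simp add: count_image_mset vimage_def Int_def conj_commute eq_commute[of z])
    also have "\<dots> = (if m = n + basis_vec i then adj_mat \<Lambda> (basis_vec i) v w else 0)"
    proof (cases "m = n + basis_vec i")
      case True
      then show ?thesis unfolding z adj_mat_alt by simp
    next
      case False
      then have "{a \<in> ?P. (src \<Lambda> a, n + basis_vec i) = z} = {}" unfolding z by blast
      then show ?thesis using False by (simp only: card.empty if_False)
    qed
    also have "\<dots> = count (mrep (adj_mat \<Lambda> (basis_vec i) v) (n + basis_vec i)) z"
    proof (cases "w \<in> vertices \<Lambda>")
      case False
      have "{a \<in> ?P. src \<Lambda> a = w} = {}"
      proof -
        have "src \<Lambda> a \<noteq> w" if "a \<in> ?P" for a using that False src_vertex[of a] by (auto simp: paths_from_iff)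
        then show ?thesis by blast
      qed
      then have "adj_mat \<Lambda> (basis_vec i) v w = 0" unfolding adj_mat_alt by (simp only: card.empty)
      then show ?thesis unfolding z count_mrep by simp
    qed (simp add: z count_mrep)
    finally show "count (image_mset (\<lambda>\<alpha>. (src \<Lambda> \<alpha>, n + basis_vec i)) (mset_set ?P)) z =
      count (mrep (adj_mat \<Lambda> (basis_vec i) v) (n + basis_vec i)) z" .
  qed
  then show ?thesis using tal_cong.gen[OF v, of n i] by metis
qed

text \<open>Applying the relations in direction \<open>i\<close> to every generator of a normal form
  multiplies its vector by the matrix of that direction; repeated use reaches any degree.\<close>

lemma tal_cong_vertex:
  assumes v: "v \<in> vertices \<Lambda>"
  shows "tal_cong \<Lambda> {#(v, n)#} (mrep (adj_mat \<Lambda> q v) (n + to_int q))"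
proof (induction q rule: fun_nat_induct)
  case zero
  have "{#(v, n)#} = mrep (adj_mat \<Lambda> 0 v) (n + to_int 0)"
  proof (rule multiset_eqI)
    fix z :: "'a \<times> ('k \<Rightarrow> int)"
    show "count {#(v, n)#} z = count (mrep (adj_mat \<Lambda> 0 v) (n + to_int 0)) z"
      using v adj_mat_0[OF v] by (cases z) (auto simp: count_mrep)
  qed
  moreover have "{#(v, n)#} \<in> tal_free \<Lambda>" using v by (simp add: tal_free_def)
  ultimately show ?case using tal_cong.refl by metis
next
  case (step q i)
  let ?M = "mrep (adj_mat \<Lambda> q v) (n + to_int q)"
  let ?F = "\<lambda>z. mrep (adj_mat \<Lambda> (basis_vec i) (fst z)) (snd z + basis_vec i)"
  have "tal_cong \<Lambda> ?M (\<Sum>z\<in>#?M. ?F z)"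
  proof (rule tal_cong_sum_mset[OF mrep_free])
    fix z assume "z \<in># ?M"
    then have "fst z \<in> vertices \<Lambda>" using mrep_free[of "adj_mat \<Lambda> q v" "n + to_int q"] unfolding tal_free_def by auto
    from tal_cong_gen_mrep[OF this, of "snd z" i] show "tal_cong \<Lambda> {#z#} (?F z)" by simp
  qed
  moreover have "(\<Sum>z\<in>#?M. ?F z) = mrep (adj_mat \<Lambda> (basis_vec i + q) v) (n + to_int (basis_vec i + q))"
  proof (rule multiset_eqI)
    fix z :: "'a \<times> ('k \<Rightarrow> int)"
    obtain w m where z: "z = (w, m)" by (cases z)
    have "count (\<Sum>z\<in>#?M. ?F z) z = (\<Sum>u\<in>vertices \<Lambda>. adj_mat \<Lambda> q v u * count (?F (u, n + to_int q)) z)"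
      unfolding count_sum_mset sum_mset_mrep by simp
    also have "\<dots> = (if w \<in> vertices \<Lambda> \<and> m = n + to_int q + basis_vec i
      then \<Sum>u\<in>vertices \<Lambda>. adj_mat \<Lambda> q v u * adj_mat \<Lambda> (basis_vec i) u w else 0)"
    proof (cases "w \<in> vertices \<Lambda> \<and> m = n + to_int q + basis_vec i")
      case True
      show ?thesis unfolding z count_mrep fst_conv snd_conv if_P[OF True] ..
    next
      case False
      show ?thesis unfolding z count_mrep fst_conv snd_conv if_not_P[OF False] mult_0_right sum.neutral_const ..
    qed
    also have "\<dots> = count (mrep (adj_mat \<Lambda> (basis_vec i + q) v) (n + to_int (basis_vec i + q))) z"
    proof -
      have "n + to_int (basis_vec i + q) = n + to_int q + basis_vec i" by (simp add: add_ac)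
      \<comment> \<open>The new direction comes first in the induction but its matrix stands last in
        the product. Commutativity of the addition of degrees reconciles the two orders.\<close>
      moreover have "(\<Sum>u\<in>vertices \<Lambda>. adj_mat \<Lambda> q v u * adj_mat \<Lambda> (basis_vec i) u w) = adj_mat \<Lambda> (basis_vec i + q) v w"
        using adj_mat_add[OF v, of q "basis_vec i" w] by (simp add: add.commute)
      ultimately show ?thesis unfolding z count_mrep by metis
    qed
    finally show "count (\<Sum>z\<in>#?M. ?F z) z =
      count (mrep (adj_mat \<Lambda> (basis_vec i + q) v) (n + to_int (basis_vec i + q))) z" .
  qed
  ultimately show ?case using tal_cong.trans[OF step] by metis
qed

text \<open>Expanding each generator to level \<open>L\<close> adds up to the normal form with
  vector \<open>mvec L M\<close>. The coercion \<open>nat\<close> loses nothing, as the entries are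
  multiplicities.\<close>

lemma tal_cong_mrep_mvec:
  assumes M: "M \<in> tal_free \<Lambda>" and L: "bounded_by L M"
  shows "tal_cong \<Lambda> M (mrep (\<lambda>v. nat (mvec L M v)) L)"
proof -
  let ?F = "\<lambda>z. mrep (adj_mat \<Lambda> (to_nat (L - snd z)) (fst z)) L"
  have "tal_cong \<Lambda> M (\<Sum>z\<in>#M. ?F z)"
  proof (rule tal_cong_sum_mset[OF M])
    fix z assume z: "z \<in># M"
    have "fst z \<in> vertices \<Lambda>" using M z unfolding tal_free_def by auto
    moreover have "snd z + to_int (to_nat (L - snd z)) = L"
      using z L by (simp add: bounded_by_def to_int_to_nat fun_le_diff_iff)
    ultimately show "tal_cong \<Lambda> {#z#} (?F z)"
      using tal_cong_vertex[of "fst z" "snd z" "to_nat (L - snd z)"] by simp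
  qed
  moreover have "(\<Sum>z\<in>#M. ?F z) = mrep (\<lambda>v. nat (mvec L M v)) L"
  proof (rule multiset_eqI)
    fix y :: "'a \<times> ('k \<Rightarrow> int)"
    obtain w m where y: "y = (w, m)" by (cases y)
    have *: "int (count (\<Sum>z\<in>#M. ?F z) (w, L)) = mvec L M w" if w: "w \<in> vertices \<Lambda>"
      using M
    proof (induction M)
      case empty
      show ?case by (simp add: mvec_def)
    next
      case (add z M)
      then have z: "fst z \<in> vertices \<Lambda>" "M \<in> tal_free \<Lambda>" by (simp_all add: tal_free_add_mset)
      have c: "count (?F z) (w, L) = adj_mat \<Lambda> (to_nat (L - snd z)) (fst z) w"
        unfolding count_mrep using w by metis
      have "int (count (\<Sum>z\<in>#add_mset z M. ?F z) (w, L)) =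
        int (count (?F z) (w, L)) + int (count (\<Sum>z\<in>#M. ?F z) (w, L))" by simp
      also have "\<dots> = vec_mat \<Lambda> (basis_vec (fst z)) (to_nat (L - snd z)) w + mvec L M w"
        unfolding c add.IH[OF z(2)] vec_mat_basis_vec[OF z(1) w] ..
      finally show ?case unfolding mvec_add_mset plus_fun_apply .
    qed
    have **: "count (\<Sum>z\<in>#M. ?F z) (w, m) = 0" if "\<not> (w \<in> vertices \<Lambda> \<and> m = L)"
    proof -
      have "count (?F z) (w, m) = 0" for z unfolding count_mrep if_not_P[OF that] ..
      then show ?thesis unfolding count_sum_mset by (simp only: sum_mset.neutral_const)
    qed
    show "count (\<Sum>z\<in>#M. ?F z) y = count (mrep (\<lambda>v. nat (mvec L M v)) L) y"
    proof (cases "w \<in> vertices \<Lambda> \<and> m = L")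
      case True
      then have "count (\<Sum>z\<in>#M. ?F z) (w, m) = nat (mvec L M w)"
        using arg_cong[OF *, of nat] unfolding nat_int by blast
      then show ?thesis unfolding y count_mrep if_P[OF True] .
    next
      case False
      show ?thesis unfolding y count_mrep if_not_P[OF False] by (rule **[OF False])
    qed
  qed
  ultimately show ?thesis by metis
qed

lemma mvec_eq_tal_cong:
  assumes "M \<in> tal_free \<Lambda>" "N \<in> tal_free \<Lambda>" "bounded_by L M" "bounded_by L N" "mvec L M = mvec L N"
  shows "tal_cong \<Lambda> M N"
  using tal_cong_mrep_mvec[OF assms(1,3)] tal_cong_mrep_mvec[OF assms(2,4)] unfolding assms(5)
  by (rule tal_cong.trans[OF _ tal_cong.sym])

section \<open>Comparison with the positive cone\<close>

text \<open>The monoid map that sends the generator \<open>(v, n)\<close> to the class of the basis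
  vector at \<open>v\<close> in level \<open>n\<close>. The chosen bound is immaterial, since
  raising it only lifts the representative.\<close>

definition mclass :: "('a \<times> ('k \<Rightarrow> int)) multiset \<Rightarrow> (('a \<Rightarrow> int) \<times> ('k \<Rightarrow> int)) set" where
  "mclass M = (let L = SOME L. bounded_by L M in dim_class \<Lambda> (mvec L M) L)"

lemma mclass_eq:
  assumes "bounded_by L M"
  shows "mclass M = dim_class \<Lambda> (mvec L M) L"
proof -
  have *: "dim_class \<Lambda> (mvec K M) K = dim_class \<Lambda> (mvec (sup K K') M) (sup K K')" if "bounded_by K M" for K K'
    using dim_class_lift[OF mvec_vecs[of K M], of K "sup K K'"] mvec_lift[OF that sup_ge1] by simp
  let ?L = "SOME L. bounded_by L M"
  have "bounded_by ?L M" using ex_bound by (rule someI_ex)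
  then show ?thesis using *[of ?L L] *[OF assms, of ?L] unfolding mclass_def Let_def by (simp add: sup_commute)
qed

text \<open>Equality in the dimension group means equal expansions at some high level, and equal
  expansions have a common normal form; the converse is invariance of expansions. So the talented
  monoid embeds into the dimension group.\<close>

lemma mclass_eq_iff:
  assumes M: "M \<in> tal_free \<Lambda>" and N: "N \<in> tal_free \<Lambda>"
  shows "mclass M = mclass N \<longleftrightarrow> tal_cong \<Lambda> M N"
proof -
  obtain L where "bounded_by L (M + N)" using ex_bound by blast
  then have L: "bounded_by L M" "bounded_by L N" by (simp_all add: bounded_by_add)
  show ?thesis
  proof
    assume "mclass M = mclass N"
    then have "dim_class \<Lambda> (mvec L M) L = dim_class \<Lambda> (mvec L N) L" using mclass_eq L by metis
    then obtain l where l: "L \<le> l" "vec_mat \<Lambda> (mvec L M) (to_nat (l - L)) = vec_mat \<Lambda> (mvec L N) (to_nat (l - L))"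
      unfolding dim_class_eq_iff[OF mvec_vecs mvec_vecs] by blast
    have "mvec l M = mvec l N" using l(2) unfolding mvec_lift[OF L(1) l(1)] mvec_lift[OF L(2) l(1)] .
    then show "tal_cong \<Lambda> M N"
      by (rule mvec_eq_tal_cong[OF M N bounded_by_mono[OF L(1) l(1)] bounded_by_mono[OF L(2) l(1)]])
  next
    assume "tal_cong \<Lambda> M N"
    then obtain L0 where "\<forall>L\<ge>L0. mvec L M = mvec L N" using tal_cong_mvec by blast
    then have "mvec (sup L L0) M = mvec (sup L L0) N" by simp
    moreover have "mclass M = dim_class \<Lambda> (mvec (sup L L0) M) (sup L L0)"
      by (rule mclass_eq[OF bounded_by_mono[OF L(1) sup_ge1]])
    moreover have "mclass N = dim_class \<Lambda> (mvec (sup L L0) N) (sup L L0)"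
      by (rule mclass_eq[OF bounded_by_mono[OF L(2) sup_ge1]])
    ultimately show "mclass M = mclass N" by simp
  qed
qed

lemma mclass_add: "mclass (M + N) = mclass M \<otimes>\<^bsub>dim_group \<Lambda>\<^esub> mclass N"
proof -
  obtain L where L: "bounded_by L (M + N)" using ex_bound by blast
  then have L': "bounded_by L M" "bounded_by L N" by (simp_all add: bounded_by_add)
  show ?thesis unfolding mclass_eq[OF L] mclass_eq[OF L'(1)] mclass_eq[OF L'(2)] mvec_add
    by (rule dim_mult[OF mvec_vecs mvec_vecs, symmetric])
qed

definition mshift :: "('k \<Rightarrow> int) \<Rightarrow> ('a \<times> ('k \<Rightarrow> int)) multiset \<Rightarrow> ('a \<times> ('k \<Rightarrow> int)) multiset" where
  "mshift m M = image_mset (\<lambda>(v, n). (v, n + m)) M"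

lemma mshift_free: "M \<in> tal_free \<Lambda> \<Longrightarrow> mshift m M \<in> tal_free \<Lambda>"
  by (auto simp: mshift_def tal_free_def)

lemma mclass_shift: "mclass (mshift m M) = dim_act \<Lambda> m (mclass M)"
proof -
  obtain L where L: "bounded_by L M" using ex_bound by blast
  have "bounded_by (L + m) (mshift m M)"
    using L by (auto simp: bounded_by_def mshift_def le_fun_def)
  moreover have "mvec (L + m) (mshift m M) = mvec L M"
    by (rule ext, induction M) (auto simp: mvec_def mshift_def)
  ultimately have "mclass (mshift m M) = dim_class \<Lambda> (mvec L M) (L + m)" using mclass_eq by metis
  then show ?thesis unfolding mclass_eq[OF L] dim_act_class[OF mvec_vecs] .
qed

lemma mclass_pos: "mclass M \<in> dim_pos \<Lambda>"
proof -
  obtain L where L: "bounded_by L M" using ex_bound by blast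
  show ?thesis unfolding mclass_eq[OF L] by (rule dim_class_pos[OF mvec_vecs mvec_nonneg])
qed

text \<open>The normal form with a nonnegative vector as multiplicities is a preimage of the class
  of that vector.\<close>

lemma mclass_surj:
  assumes "P \<in> dim_pos \<Lambda>"
  shows "\<exists>M\<in>tal_free \<Lambda>. mclass M = P"
proof -
  obtain x n where x: "x \<in> int_vecs \<Lambda>" "0 \<le> x" "P = dim_class \<Lambda> x n" using assms by (rule dim_posE)
  let ?M = "mrep (\<lambda>v. nat (x v)) n"
  have "bounded_by n ?M"
    unfolding bounded_by_def
  proof
    fix z assume "z \<in># ?M"
    then have "count ?M (fst z, snd z) \<noteq> 0" by simp
    then have "snd z = n" unfolding count_mrep by (simp split: if_splits)
    then show "snd z \<le> n" by simp
  qed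
  moreover have "mvec n ?M = x"
  proof
    fix v
    have z: "to_nat (n - n) = 0" by (simp add: to_nat_def fun_eq_iff)
    have "mvec n ?M v = (\<Sum>u\<in>vertices \<Lambda>. int (nat (x u)) * vec_mat \<Lambda> (basis_vec u) (to_nat (n - n)) v)"
      unfolding mvec_def sum_mset_mrep by simp
    also have "\<dots> = (\<Sum>u\<in>vertices \<Lambda>. if u = v then x u else 0)"
    proof (rule sum.cong[OF HOL.refl])
      fix u assume u: "u \<in> vertices \<Lambda>"
      have "0 \<le> x u" using x(2) by (simp add: le_fun_def)
      then show "int (nat (x u)) * vec_mat \<Lambda> (basis_vec u) (to_nat (n - n)) v = (if u = v then x u else 0)"
        unfolding z vec_mat_0[OF basis_vec_int_vecs[OF u]] by (simp add: basis_vec_def)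
    qed
    also have "\<dots> = x v" using finite_vertices x(1) by (simp add: int_vecs_def)
    finally show "mvec n ?M v = x v" .
  qed
  ultimately have "mclass ?M = P" using mclass_eq x(3) by metis
  then show ?thesis using mrep_free by blast
qed

abbreviation "tclass M \<equiv> tal_rel \<Lambda> `` {M}"

lemma tclass_iff: "N \<in> tclass M \<longleftrightarrow> tal_cong \<Lambda> M N"
  by (simp add: tal_rel_def)

lemma tclass_eq_iff:
  assumes "M \<in> tal_free \<Lambda>" "N \<in> tal_free \<Lambda>"
  shows "tclass M = tclass N \<longleftrightarrow> mclass M = mclass N"
proof
  assume "tclass M = tclass N"
  then have "N \<in> tclass M" using tal_cong.refl[OF assms(2)] tclass_iff by blast
  then show "mclass M = mclass N" using mclass_eq_iff[OF assms] tclass_iff by blast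
next
  assume "mclass M = mclass N"
  then have "tal_cong \<Lambda> M N" using mclass_eq_iff[OF assms] by blast
  then have "tal_cong \<Lambda> M K \<longleftrightarrow> tal_cong \<Lambda> N K" for K using tal_cong.trans tal_cong.sym by metis
  then show "tclass M = tclass N" unfolding set_eq_iff tclass_iff by blast
qed

lemma tal_carrier_iff: "P \<in> carrier (tal_monoid \<Lambda>) \<longleftrightarrow> (\<exists>M\<in>tal_free \<Lambda>. P = tclass M)"
  by (auto simp: tal_monoid_def quotient_def)

text \<open>As for dimension classes, an operation on representatives collapses to a single value;
  here invariance is tested through \<open>mclass\<close>, which turns it into computations in a
  group.\<close>

lemma UN_tclass:
  assumes M: "M \<in> tal_free \<Lambda>"
    and F: "\<And>N. N \<in> tal_free \<Lambda> \<Longrightarrow> mclass N = mclass M \<Longrightarrow> F N = F M"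
  shows "(\<Union>N\<in>tclass M. F N) = F M"
proof -
  have "F N = F M" if "N \<in> tclass M" for N
  proof -
    have "tal_cong \<Lambda> M N" using that tclass_iff by blast
    then have "N \<in> tal_free \<Lambda>" "mclass M = mclass N" using tal_cong_free mclass_eq_iff[OF M] by blast+
    then show ?thesis using F by metis
  qed
  moreover have "M \<in> tclass M" using tal_cong.refl[OF M] tclass_iff by blast
  ultimately show ?thesis by (metis (no_types, lifting) SUP_eq_const empty_iff)
qed

lemma tclass_mult:
  assumes "M \<in> tal_free \<Lambda>" "N \<in> tal_free \<Lambda>"
  shows "tclass M \<otimes>\<^bsub>tal_monoid \<Lambda>\<^esub> tclass N = tclass (M + N)"
proof -
  have 1: "(\<Union>N'\<in>tclass N. tclass (M' + N')) = tclass (M' + N)" if "M' \<in> tal_free \<Lambda>" for M'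
    using that assms(2) by (intro UN_tclass) (simp_all add: tclass_eq_iff tal_free_add mclass_add)
  have "tclass M \<otimes>\<^bsub>tal_monoid \<Lambda>\<^esub> tclass N = (\<Union>M'\<in>tclass M. \<Union>N'\<in>tclass N. tclass (M' + N'))"
    by (simp add: tal_monoid_def)
  also have "\<dots> = (\<Union>N'\<in>tclass N. tclass (M + N'))"
    using assms by (intro UN_tclass) (simp_all add: 1 tclass_eq_iff tal_free_add mclass_add)
  also have "\<dots> = tclass (M + N)" using 1[OF assms(1)] .
  finally show ?thesis .
qed

lemma tclass_act:
  assumes "M \<in> tal_free \<Lambda>"
  shows "tal_act \<Lambda> m (tclass M) = tclass (mshift m M)"
  unfolding tal_act_def mshift_def[symmetric]
  using assms by (intro UN_tclass) (simp_all add: tclass_eq_iff mshift_free mclass_shift)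

text \<open>The isomorphism from the talented monoid onto the positive cone. The chosen
  representative is immaterial because equal classes have equal \<open>mclass\<close>.\<close>

definition kappa :: "('a \<times> ('k \<Rightarrow> int)) multiset set \<Rightarrow> (('a \<Rightarrow> int) \<times> ('k \<Rightarrow> int)) set" where
  "kappa P = mclass (SOME M. M \<in> tal_free \<Lambda> \<and> P = tclass M)"

lemma kappa_tclass:
  assumes "M \<in> tal_free \<Lambda>"
  shows "kappa (tclass M) = mclass M"
proof -
  let ?N = "SOME N. N \<in> tal_free \<Lambda> \<and> tclass M = tclass N"
  have N: "?N \<in> tal_free \<Lambda> \<and> tclass M = tclass ?N" by (rule someI[of _ M]) (simp add: assms)
  have "mclass M = mclass ?N"
    using N tclass_eq_iff[OF assms conjunct1[OF N]] by (rule iffD1[OF _ conjunct2, rotated])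
  then show ?thesis unfolding kappa_def by (rule HOL.sym)
qed

lemma kappa_bij: "bij_betw kappa (carrier (tal_monoid \<Lambda>)) (dim_pos \<Lambda>)"
  unfolding bij_betw_def
proof
  show "inj_on kappa (carrier (tal_monoid \<Lambda>))"
  proof (rule inj_onI)
    fix P Q assume "P \<in> carrier (tal_monoid \<Lambda>)" "Q \<in> carrier (tal_monoid \<Lambda>)" and eq: "kappa P = kappa Q"
    then obtain M N where M: "M \<in> tal_free \<Lambda>" "P = tclass M" "N \<in> tal_free \<Lambda>" "Q = tclass N"
      unfolding tal_carrier_iff by blast
    show "P = Q" using eq unfolding M(2,4) kappa_tclass[OF M(1)] kappa_tclass[OF M(3)] tclass_eq_iff[OF M(1,3)] .
  qed
  show "kappa ` carrier (tal_monoid \<Lambda>) = dim_pos \<Lambda>"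
  proof
    show "kappa ` carrier (tal_monoid \<Lambda>) \<subseteq> dim_pos \<Lambda>"
      by (rule image_subsetI) (metis tal_carrier_iff kappa_tclass mclass_pos)
    show "dim_pos \<Lambda> \<subseteq> kappa ` carrier (tal_monoid \<Lambda>)"
    proof
      fix P assume "P \<in> dim_pos \<Lambda>"
      then obtain M where M: "M \<in> tal_free \<Lambda>" "mclass M = P" using mclass_surj by blast
      then have "P = kappa (tclass M)" using kappa_tclass by metis
      moreover have "tclass M \<in> carrier (tal_monoid \<Lambda>)" unfolding tal_carrier_iff using M(1) by blast
      ultimately show "P \<in> kappa ` carrier (tal_monoid \<Lambda>)" by blast
    qed
  qed
qed

lemma tal_mult_closed:
  "P \<in> carrier (tal_monoid \<Lambda>) \<Longrightarrow> Q \<in> carrier (tal_monoid \<Lambda>) \<Longrightarrow> P \<otimes>\<^bsub>tal_monoid \<Lambda>\<^esub> Q \<in> carrier (tal_monoid \<Lambda>)"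
  unfolding tal_carrier_iff using tclass_mult tal_free_add by metis

lemma tal_act_closed: "P \<in> carrier (tal_monoid \<Lambda>) \<Longrightarrow> tal_act \<Lambda> m P \<in> carrier (tal_monoid \<Lambda>)"
  unfolding tal_carrier_iff using tclass_act mshift_free by metis

lemma kappa_mult:
  assumes "P \<in> carrier (tal_monoid \<Lambda>)" "Q \<in> carrier (tal_monoid \<Lambda>)"
  shows "kappa (P \<otimes>\<^bsub>tal_monoid \<Lambda>\<^esub> Q) = kappa P \<otimes>\<^bsub>dim_group \<Lambda>\<^esub> kappa Q"
proof -
  obtain M N where M: "M \<in> tal_free \<Lambda>" "P = tclass M" "N \<in> tal_free \<Lambda>" "Q = tclass N"
    using assms unfolding tal_carrier_iff by blast
  have MN: "M + N \<in> tal_free \<Lambda>" using M by (simp add: tal_free_add)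
  show ?thesis
    unfolding M(2,4) tclass_mult[OF M(1,3)] kappa_tclass[OF M(1)] kappa_tclass[OF M(3)] kappa_tclass[OF MN]
    by (rule mclass_add)
qed

lemma kappa_act:
  assumes "P \<in> carrier (tal_monoid \<Lambda>)"
  shows "kappa (tal_act \<Lambda> m P) = dim_act \<Lambda> m (kappa P)"
proof -
  obtain M where M: "M \<in> tal_free \<Lambda>" "P = tclass M" using assms unfolding tal_carrier_iff by blast
  show ?thesis
    unfolding M(2) tclass_act[OF M(1)] kappa_tclass[OF M(1)] kappa_tclass[OF mshift_free[OF M(1)]] by (rule mclass_shift)
qed

lemma tal_one: "\<one>\<^bsub>tal_monoid \<Lambda>\<^esub> \<in> carrier (tal_monoid \<Lambda>)" "kappa \<one>\<^bsub>tal_monoid \<Lambda>\<^esub> = \<one>\<^bsub>dim_group \<Lambda>\<^esub>"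
proof -
  have one: "\<one>\<^bsub>tal_monoid \<Lambda>\<^esub> = tclass {#}" by (simp add: tal_monoid_def)
  show "\<one>\<^bsub>tal_monoid \<Lambda>\<^esub> \<in> carrier (tal_monoid \<Lambda>)" unfolding one tal_carrier_iff using tal_free_empty by blast
  have b: "bounded_by 0 {#}" by (simp add: bounded_by_def)
  show "kappa \<one>\<^bsub>tal_monoid \<Lambda>\<^esub> = \<one>\<^bsub>dim_group \<Lambda>\<^esub>"
    unfolding one kappa_tclass[OF tal_free_empty] mclass_eq[OF b] mvec_empty by (rule dim_class_0)
qed

end

section \<open>Shift equivalence\<close>

text \<open>Row vector times matrix for arbitrary index sets, so that \<open>R\<close>,
  \<open>S\<close> and the adjacency matrices are composed by one rule. The cut-off outside
  \<open>W\<close> makes results over a vertex set elements of \<open>int_vecs\<close>.\<close>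

definition mv :: "'u set \<Rightarrow> 'w set \<Rightarrow> ('u \<Rightarrow> 'w \<Rightarrow> nat) \<Rightarrow> ('u \<Rightarrow> int) \<Rightarrow> 'w \<Rightarrow> int" where
  "mv V W R x = (\<lambda>b. if b \<in> W then \<Sum>u\<in>V. x u * int (R u b) else 0)"

lemma mv_add: "mv V W R (x + y) = mv V W R x + mv V W R y"
  by (rule ext) (simp add: mv_def algebra_simps sum.distrib)

lemma mv_nonneg: "0 \<le> x \<Longrightarrow> 0 \<le> mv V W R x"
  by (auto simp: mv_def le_fun_def intro!: sum_nonneg)

lemma mv_mv: "mv V' W S (mv V V' R x) = mv V W (\<lambda>u b. \<Sum>c\<in>V'. R u c * S c b) x"
proof
  fix b
  have "(\<Sum>c\<in>V'. (\<Sum>u\<in>V. x u * int (R u c)) * int (S c b)) = (\<Sum>c\<in>V'. \<Sum>u\<in>V. x u * (int (R u c) * int (S c b)))"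
    by (simp add: sum_distrib_right mult.assoc)
  also have "\<dots> = (\<Sum>u\<in>V. \<Sum>c\<in>V'. x u * (int (R u c) * int (S c b)))" by (rule sum.swap)
  also have "\<dots> = (\<Sum>u\<in>V. x u * int (\<Sum>c\<in>V'. R u c * S c b))" by (simp add: sum_distrib_left)
  finally show "mv V' W S (mv V V' R x) b = mv V W (\<lambda>u b. \<Sum>c\<in>V'. R u c * S c b) x b"
    by (simp add: mv_def)
qed

lemma mv_cong: "(\<And>u b. u \<in> V \<Longrightarrow> b \<in> W \<Longrightarrow> R u b = R' u b) \<Longrightarrow> mv V W R x = mv V W R' x"
  by (rule ext) (simp add: mv_def)

lemma mv_basis: "finite V \<Longrightarrow> u \<in> V \<Longrightarrow> b \<in> W \<Longrightarrow> mv V W R (basis_vec u) b = int (R u b)"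
  by (simp add: mv_def basis_vec_def if_distrib[of "\<lambda>x. x * _"] cong: if_cong)

text \<open>Basis vectors read off rows, which turns identities of vectors back into the entrywise
  equations of the matrices.\<close>

lemma mv_eqD:
  assumes "mv V W R (basis_vec u) = mv V W R' (basis_vec u)" "finite V" "u \<in> V" "b \<in> W"
  shows "R u b = R' u b"
  using fun_cong[OF assms(1), of b] unfolding mv_basis[OF assms(2-4)] by simp

lemma mv_vec_mat: "vec_mat \<Lambda> x n = mv (vertices \<Lambda>) (vertices \<Lambda>) (adj_mat \<Lambda> n) x"
  by (rule ext) (simp add: mv_def vec_mat_def)

lemma mv_vecs: "mv V (vertices \<Omega>) R x \<in> int_vecs \<Omega>"
  by (simp add: mv_def int_vecs_def)

abbreviation gmv :: "('a, 'k) kgr \<Rightarrow> ('b, 'k) kgr \<Rightarrow> ('a \<Rightarrow> 'b \<Rightarrow> nat) \<Rightarrow> ('a \<Rightarrow> int) \<Rightarrow> 'b \<Rightarrow> int" where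
  "gmv \<Lambda> \<Omega> \<equiv> mv (vertices \<Lambda>) (vertices \<Omega>)"

definition intertwines :: "('a, 'k) kgr \<Rightarrow> ('b, 'k) kgr \<Rightarrow> ('a \<Rightarrow> 'b \<Rightarrow> nat) \<Rightarrow> bool" where
  "intertwines \<Lambda> \<Omega> R \<longleftrightarrow> (\<forall>i. \<forall>u\<in>vertices \<Lambda>. \<forall>b\<in>vertices \<Omega>.
    (\<Sum>v\<in>vertices \<Lambda>. adj_mat \<Lambda> (basis_vec i) u v * R v b) =
    (\<Sum>c\<in>vertices \<Omega>. R u c * adj_mat \<Omega> (basis_vec i) c b))"

definition mat_factor :: "('a, 'k) kgr \<Rightarrow> ('b, 'k) kgr \<Rightarrow> ('k \<Rightarrow> nat) \<Rightarrow> ('a \<Rightarrow> 'b \<Rightarrow> nat) \<Rightarrow> ('b \<Rightarrow> 'a \<Rightarrow> nat) \<Rightarrow> bool" where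
  "mat_factor \<Lambda> \<Omega> p R S \<longleftrightarrow> (\<forall>u\<in>vertices \<Lambda>. \<forall>v\<in>vertices \<Lambda>.
    adj_mat \<Lambda> p u v = (\<Sum>x\<in>vertices \<Omega>. R u x * S x v))"

lemma intertwines_basis:
  assumes R: "intertwines \<Lambda> \<Omega> R"
  shows "gmv \<Lambda> \<Omega> R (vec_mat \<Lambda> x (basis_vec i)) = vec_mat \<Omega> (gmv \<Lambda> \<Omega> R x) (basis_vec i)"
  unfolding mv_vec_mat mv_mv using R by (intro mv_cong) (simp add: intertwines_def)

lemma mat_factor_vec:
  "mat_factor \<Lambda> \<Omega> p R S \<Longrightarrow> gmv \<Omega> \<Lambda> S (gmv \<Lambda> \<Omega> R x) = vec_mat \<Lambda> x p"
  unfolding mv_vec_mat mv_mv by (intro mv_cong) (simp add: mat_factor_def)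

lemma intertwinesI:
  assumes "finite (vertices \<Lambda>)"
    and "\<And>i u. u \<in> vertices \<Lambda> \<Longrightarrow>
      gmv \<Lambda> \<Omega> R (vec_mat \<Lambda> (basis_vec u) (basis_vec i)) = vec_mat \<Omega> (gmv \<Lambda> \<Omega> R (basis_vec u)) (basis_vec i)"
  shows "intertwines \<Lambda> \<Omega> R"
  unfolding intertwines_def
proof (intro allI ballI)
  fix i u b assume u: "u \<in> vertices \<Lambda>" and b: "b \<in> vertices \<Omega>"
  from mv_eqD[OF assms(2)[OF u, of i, unfolded mv_vec_mat mv_mv] assms(1) u b]
  show "(\<Sum>v\<in>vertices \<Lambda>. adj_mat \<Lambda> (basis_vec i) u v * R v b) =
    (\<Sum>c\<in>vertices \<Omega>. R u c * adj_mat \<Omega> (basis_vec i) c b)" .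
qed

lemma mat_factorI:
  assumes "finite (vertices \<Lambda>)"
    and "\<And>u. u \<in> vertices \<Lambda> \<Longrightarrow> gmv \<Omega> \<Lambda> S (gmv \<Lambda> \<Omega> R (basis_vec u)) = vec_mat \<Lambda> (basis_vec u) p"
  shows "mat_factor \<Lambda> \<Omega> p R S"
  unfolding mat_factor_def
proof (intro ballI)
  fix u v assume u: "u \<in> vertices \<Lambda>" and v: "v \<in> vertices \<Lambda>"
  from mv_eqD[OF assms(2)[OF u, unfolded mv_vec_mat mv_mv] assms(1) u v]
  show "adj_mat \<Lambda> p u v = (\<Sum>x\<in>vertices \<Omega>. R u x * S x v)" by (rule HOL.sym)
qed

text \<open>The relation for the coordinate directions propagates to all degrees by composition. The
  vector is taken from \<open>int_vecs\<close> because there the matrix of degree zero acts as the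
  identity.\<close>

lemma intertwines_all:
  assumes "finite_kgraph \<Lambda>" "finite_kgraph \<Omega>" "intertwines \<Lambda> \<Omega> R" "x \<in> int_vecs \<Lambda>"
  shows "gmv \<Lambda> \<Omega> R (vec_mat \<Lambda> x q) = vec_mat \<Omega> (gmv \<Lambda> \<Omega> R x) q"
proof -
  interpret L: finite_kgraph \<Lambda> by fact
  interpret O: finite_kgraph \<Omega> by fact
  show ?thesis using assms(4)
  proof (induction q arbitrary: x rule: fun_nat_induct)
    case zero
    then show ?case by (simp only: L.vec_mat_0 O.vec_mat_0[OF mv_vecs])
  next
    case (step q i)
    have "gmv \<Lambda> \<Omega> R (vec_mat \<Lambda> x (basis_vec i + q)) = gmv \<Lambda> \<Omega> R (vec_mat \<Lambda> (vec_mat \<Lambda> x (basis_vec i)) q)"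
      by (simp only: L.vec_mat_vec_mat)
    also have "\<dots> = vec_mat \<Omega> (gmv \<Lambda> \<Omega> R (vec_mat \<Lambda> x (basis_vec i))) q"
      by (rule step.IH[OF L.vec_mat_vecs])
    also have "\<dots> = vec_mat \<Omega> (gmv \<Lambda> \<Omega> R x) (basis_vec i + q)"
      unfolding intertwines_basis[OF assms(3)] O.vec_mat_vec_mat ..
    finally show ?case .
  qed
qed

section \<open>From isomorphisms of cones to matrices\<close>

text \<open>Conditions on the cone only, so that isomorphisms of dimension groups and of talented
  monoids both supply such a map.\<close>

definition pos_hom :: "('a, 'k) kgr \<Rightarrow> ('b, 'k) kgr \<Rightarrow>
    ((('a \<Rightarrow> int) \<times> ('k \<Rightarrow> int)) set \<Rightarrow> (('b \<Rightarrow> int) \<times> ('k \<Rightarrow> int)) set) \<Rightarrow> bool" where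
  "pos_hom \<Lambda> \<Omega> g \<longleftrightarrow> (\<forall>P\<in>dim_pos \<Lambda>. g P \<in> dim_pos \<Omega>) \<and>
     (\<forall>P\<in>dim_pos \<Lambda>. \<forall>Q\<in>dim_pos \<Lambda>. g (P \<otimes>\<^bsub>dim_group \<Lambda>\<^esub> Q) = g P \<otimes>\<^bsub>dim_group \<Omega>\<^esub> g Q) \<and>
     (\<forall>m. \<forall>P\<in>dim_pos \<Lambda>. g (dim_act \<Lambda> m P) = dim_act \<Omega> m (g P))"

text \<open>The image of the neutral element is idempotent, and cancellation in the surrounding
  group makes it neutral.\<close>

lemma pos_hom_one:
  assumes "finite_kgraph \<Lambda>" "finite_kgraph \<Omega>" "pos_hom \<Lambda> \<Omega> g"
  shows "g \<one>\<^bsub>dim_group \<Lambda>\<^esub> = \<one>\<^bsub>dim_group \<Omega>\<^esub>"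
proof -
  interpret L: finite_kgraph \<Lambda> by fact
  interpret O: finite_kgraph \<Omega> by fact
  interpret LG: comm_group "dim_group \<Lambda>" by (rule L.comm_group_dim_group)
  interpret OG: comm_group "dim_group \<Omega>" by (rule O.comm_group_dim_group)
  have one: "\<one>\<^bsub>dim_group \<Lambda>\<^esub> \<in> dim_pos \<Lambda>"
    unfolding L.dim_one by (rule L.dim_class_pos[OF L.int_vecs_0 order_refl])
  then have "g \<one>\<^bsub>dim_group \<Lambda>\<^esub> \<in> carrier (dim_group \<Omega>)"
    using assms(3) O.dim_pos_carrier unfolding pos_hom_def by blast
  moreover have "g (\<one>\<^bsub>dim_group \<Lambda>\<^esub> \<otimes>\<^bsub>dim_group \<Lambda>\<^esub> \<one>\<^bsub>dim_group \<Lambda>\<^esub>) = g \<one>\<^bsub>dim_group \<Lambda>\<^esub> \<otimes>\<^bsub>dim_group \<Omega>\<^esub> g \<one>\<^bsub>dim_group \<Lambda>\<^esub>"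
    using assms(3) one unfolding pos_hom_def by blast
  then have "g \<one>\<^bsub>dim_group \<Lambda>\<^esub> = g \<one>\<^bsub>dim_group \<Lambda>\<^esub> \<otimes>\<^bsub>dim_group \<Omega>\<^esub> g \<one>\<^bsub>dim_group \<Lambda>\<^esub>" by simp
  ultimately show ?thesis by (metis OG.l_cancel_one' )
qed

lemma finite_upper_bound:
  fixes f :: "'u \<Rightarrow> 'k \<Rightarrow> int"
  assumes "finite F"
  shows "\<exists>N. N0 \<le> N \<and> (\<forall>u\<in>F. f u \<le> N)"
  using assms
proof (induction F rule: finite_induct)
  case (insert u F)
  then obtain N where "N0 \<le> N" "\<forall>u\<in>F. f u \<le> N" by blast
  then have "N0 \<le> sup N (f u) \<and> (\<forall>v\<in>insert u F. f v \<le> sup N (f u))"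
    by (auto intro: le_supI1)
  then show ?case by blast
qed auto

text \<open>The images of the basis classes at level zero, lifted to a common level
  \<open>N\<close>, are the rows of the matrix. Additivity extends the formula to nonnegative
  vectors, equivariance to the other levels.\<close>

lemma pos_hom_matrix:
  assumes "finite_kgraph \<Lambda>" "finite_kgraph \<Omega>" and g: "pos_hom \<Lambda> \<Omega> g"
  shows "\<exists>R N. 0 \<le> N \<and> (\<forall>x m. x \<in> int_vecs \<Lambda> \<longrightarrow> 0 \<le> x \<longrightarrow>
    g (dim_class \<Lambda> x m) = dim_class \<Omega> (gmv \<Lambda> \<Omega> R x) (m + N))"
proof -
  interpret L: finite_kgraph \<Lambda> by fact
  interpret O: finite_kgraph \<Omega> by fact
  have g_pos: "g P \<in> dim_pos \<Omega>" if "P \<in> dim_pos \<Lambda>" for P using g that unfolding pos_hom_def by blast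
  have g_mult: "g (P \<otimes>\<^bsub>dim_group \<Lambda>\<^esub> Q) = g P \<otimes>\<^bsub>dim_group \<Omega>\<^esub> g Q" if "P \<in> dim_pos \<Lambda>" "Q \<in> dim_pos \<Lambda>" for P Q
    using g that unfolding pos_hom_def by blast
  have g_act: "g (dim_act \<Lambda> m P) = dim_act \<Omega> m (g P)" if "P \<in> dim_pos \<Lambda>" for m P
    using g that unfolding pos_hom_def by blast
  have "\<exists>y n. y \<in> int_vecs \<Omega> \<and> 0 \<le> y \<and> g (dim_class \<Lambda> (basis_vec u) 0) = dim_class \<Omega> y n"
    if u: "u \<in> vertices \<Lambda>" for u
  proof -
    have "g (dim_class \<Lambda> (basis_vec u) 0) \<in> dim_pos \<Omega>"
      by (intro g_pos L.dim_class_pos L.basis_vec_int_vecs L.basis_vec_nonneg u)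
    then show ?thesis by (rule O.dim_posE) blast
  qed
  then obtain y n where y: "\<And>u. u \<in> vertices \<Lambda> \<Longrightarrow> y u \<in> int_vecs \<Omega> \<and> 0 \<le> y u \<and>
    g (dim_class \<Lambda> (basis_vec u) 0) = dim_class \<Omega> (y u) (n u)" by metis
  obtain N where N: "0 \<le> N" "\<forall>u\<in>vertices \<Lambda>. n u \<le> N"
    using finite_upper_bound[OF L.finite_vertices, of 0 n] by blast
  define R where "R u b = nat (vec_mat \<Omega> (y u) (to_nat (N - n u)) b)" for u b
  let ?g = "\<lambda>x. gmv \<Lambda> \<Omega> R x"
  have R: "?g (basis_vec u) = vec_mat \<Omega> (y u) (to_nat (N - n u))" if u: "u \<in> vertices \<Lambda>" for u
  proof
    fix b
    have "0 \<le> vec_mat \<Omega> (y u) (to_nat (N - n u)) b"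
      using O.vec_mat_nonneg[of "y u" "to_nat (N - n u)"] y[OF u] by (simp add: le_fun_def)
    then show "?g (basis_vec u) b = vec_mat \<Omega> (y u) (to_nat (N - n u)) b"
      using mv_basis[OF L.finite_vertices u, of b "vertices \<Omega>" R]
      by (cases "b \<in> vertices \<Omega>") (simp_all add: R_def mv_def[of _ _ R] vec_mat_def[of \<Omega> "y u"])
  qed
  have g_basis: "g (dim_class \<Lambda> (basis_vec u) 0) = dim_class \<Omega> (?g (basis_vec u)) N" if u: "u \<in> vertices \<Lambda>" for u
    unfolding R[OF u] using y[OF u] O.dim_class_lift[of "y u" "n u" N] N(2) u by metis
  have g_zero: "g (dim_class \<Lambda> 0 0) = dim_class \<Omega> (?g 0) N"
  proof -
    have "?g 0 = 0" by (rule ext) (simp add: mv_def)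
    then show ?thesis using pos_hom_one[OF assms] O.dim_class_0[of N] unfolding L.dim_one by metis
  qed
  have g_add: "g (dim_class \<Lambda> (x + x') 0) = dim_class \<Omega> (?g (x + x')) N"
    if x: "x \<in> int_vecs \<Lambda>" "0 \<le> x" "g (dim_class \<Lambda> x 0) = dim_class \<Omega> (?g x) N"
      and x': "x' \<in> int_vecs \<Lambda>" "0 \<le> x'" "g (dim_class \<Lambda> x' 0) = dim_class \<Omega> (?g x') N" for x x'
    using g_mult[OF L.dim_class_pos[OF x(1,2)] L.dim_class_pos[OF x'(1,2)], of 0 0]
    unfolding L.dim_mult[OF x(1) x'(1)] x(3) x'(3) O.dim_mult[OF mv_vecs mv_vecs] mv_add .
  \<comment> \<open>Additivity on the cone gives no access to differences, so a nonnegative vector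
    is built up from multiples of one basis vector and then, via \<open>rv\<close>, vertex by
    vertex.\<close>
  define cv where "cv c u = (\<lambda>v. if v = u then int c else 0)" for c and u :: 'a
  have cv: "cv c u \<in> int_vecs \<Lambda> \<and> 0 \<le> cv c u \<and> g (dim_class \<Lambda> (cv c u) 0) = dim_class \<Omega> (?g (cv c u)) N"
    if u: "u \<in> vertices \<Lambda>" for c u
  proof (induction c)
    case 0
    have "cv 0 u = 0" by (rule ext) (simp add: cv_def)
    then show ?case using g_zero L.int_vecs_0 by (metis order_refl)
  next
    case (Suc c)
    have S: "cv (Suc c) u = cv c u + basis_vec u" by (rule ext) (simp add: cv_def basis_vec_def)
    have "0 \<le> cv (Suc c) u" by (simp add: cv_def le_fun_def)
    moreover have "cv (Suc c) u \<in> int_vecs \<Lambda>" using u by (auto simp: cv_def int_vecs_def)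
    moreover have "g (dim_class \<Lambda> (cv (Suc c) u) 0) = dim_class \<Omega> (?g (cv (Suc c) u)) N"
      unfolding S using Suc L.basis_vec_int_vecs[OF u] L.basis_vec_nonneg g_basis[OF u] by (intro g_add) blast+
    ultimately show ?case by blast
  qed
  define rv where "rv x F = (\<lambda>v. if v \<in> F then x v else 0)" for x :: "'a \<Rightarrow> int" and F
  have rv: "rv x F \<in> int_vecs \<Lambda> \<and> 0 \<le> rv x F \<and> g (dim_class \<Lambda> (rv x F) 0) = dim_class \<Omega> (?g (rv x F)) N"
    if x: "0 \<le> x" and F: "finite F" "F \<subseteq> vertices \<Lambda>" for x F
    using F
  proof (induction F rule: finite_induct)
    case empty
    have "rv x {} = 0" by (rule ext) (simp add: rv_def)
    then show ?case using g_zero L.int_vecs_0 by (metis order_refl)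
  next
    case (insert u F)
    have u: "u \<in> vertices \<Lambda>" using insert.prems by blast
    have IH: "rv x F \<in> int_vecs \<Lambda> \<and> 0 \<le> rv x F \<and> g (dim_class \<Lambda> (rv x F) 0) = dim_class \<Omega> (?g (rv x F)) N"
      using insert.IH insert.prems by blast
    have "0 \<le> x u" using x by (simp add: le_fun_def)
    then have S: "rv x (insert u F) = rv x F + cv (nat (x u)) u"
      using insert.hyps by (intro ext) (auto simp: rv_def cv_def)
    have "g (dim_class \<Lambda> (rv x F + cv (nat (x u)) u) 0) = dim_class \<Omega> (?g (rv x F + cv (nat (x u)) u)) N"
      using IH cv[OF u, of "nat (x u)"] by (intro g_add) blast+
    moreover have "0 \<le> rv x (insert u F)" using x by (simp add: rv_def le_fun_def)
    moreover have "rv x (insert u F) v = 0" if "v \<notin> vertices \<Lambda>" for v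
      unfolding rv_def using insert.prems that by (metis subsetD)
    then have "rv x (insert u F) \<in> int_vecs \<Lambda>" unfolding int_vecs_def by blast
    ultimately show ?case unfolding S by blast
  qed
  have "g (dim_class \<Lambda> x m) = dim_class \<Omega> (?g x) (m + N)" if x: "x \<in> int_vecs \<Lambda>" "0 \<le> x" for x m
  proof -
    have "rv x (vertices \<Lambda>) = x" using x(1) by (intro ext) (simp add: rv_def int_vecs_def)
    then have gx: "g (dim_class \<Lambda> x 0) = dim_class \<Omega> (?g x) N"
      using rv[OF x(2) L.finite_vertices order_refl] by metis
    have "g (dim_class \<Lambda> x m) = g (dim_act \<Lambda> m (dim_class \<Lambda> x 0))"
      unfolding L.dim_act_class[OF x(1)] by simp
    also have "\<dots> = dim_act \<Omega> m (dim_class \<Omega> (?g x) N)"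
      unfolding g_act[OF L.dim_class_pos[OF x]] gx ..
    also have "\<dots> = dim_class \<Omega> (?g x) (m + N)" unfolding O.dim_act_class[OF mv_vecs] by (simp only: add.commute)
    finally show ?thesis .
  qed
  then show ?thesis using N(1) by blast
qed

lemma dim_class_eq_same:
  assumes "finite_kgraph \<Lambda>" "x \<in> int_vecs \<Lambda>" "y \<in> int_vecs \<Lambda>" "dim_class \<Lambda> x n = dim_class \<Lambda> y n"
  shows "\<exists>q. vec_mat \<Lambda> x q = vec_mat \<Lambda> y q"
proof -
  interpret L: finite_kgraph \<Lambda> by fact
  show ?thesis using assms(4) unfolding L.dim_class_eq_iff[OF assms(2,3)] by blast
qed

text \<open>An equality that holds after one power persists after further powers, and powers
  commute, so the sum of the individual exponents serves the whole finite family.\<close>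

lemma finite_common_power:
  assumes "finite_kgraph \<Lambda>" "finite F" "\<And>z. z \<in> F \<Longrightarrow> \<exists>q. vec_mat \<Lambda> (f z) q = vec_mat \<Lambda> (h z) q"
  shows "\<exists>q. \<forall>z\<in>F. vec_mat \<Lambda> (f z) q = vec_mat \<Lambda> (h z) q"
  using assms(2,3)
proof (induction F rule: finite_induct)
  case (insert z F)
  interpret L: finite_kgraph \<Lambda> by fact
  have "\<exists>q. \<forall>z\<in>F. vec_mat \<Lambda> (f z) q = vec_mat \<Lambda> (h z) q" using insert.IH insert.prems by blast
  then obtain q where q: "\<forall>z\<in>F. vec_mat \<Lambda> (f z) q = vec_mat \<Lambda> (h z) q" by blast
  obtain p where p: "vec_mat \<Lambda> (f z) p = vec_mat \<Lambda> (h z) p" using insert.prems[OF insertI1] by blast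
  have "vec_mat \<Lambda> (f w) (q + p) = vec_mat \<Lambda> (h w) (q + p)" if "w \<in> insert z F" for w
  proof (cases "w = z")
    case True
    then show ?thesis using p L.vec_mat_vec_mat[of _ p q] by (metis add.commute)
  next
    case False
    then show ?thesis using q that L.vec_mat_vec_mat[of _ q p] by (metis insertE)
  qed
  then show ?case by blast
qed simp

text \<open>Multiplying the matrix of the previous lemma by a power of the target matrices, the relation
  \<open>A\<^sub>i R \<sim> R B\<^sub>i\<close>, which holds in the limit, becomes an equation.\<close>
lemma pos_hom_intertwiner:
  assumes "finite_kgraph \<Lambda>" "finite_kgraph \<Omega>" and g: "pos_hom \<Lambda> \<Omega> g"
  shows "\<exists>R n. intertwines \<Lambda> \<Omega> R \<and> (\<forall>x m. x \<in> int_vecs \<Lambda> \<longrightarrow> 0 \<le> x \<longrightarrow>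
    g (dim_class \<Lambda> x m) = dim_class \<Omega> (gmv \<Lambda> \<Omega> R x) (m + to_int n))"
proof -
  interpret L: finite_kgraph \<Lambda> by fact
  interpret O: finite_kgraph \<Omega> by fact
  from pos_hom_matrix[OF assms] obtain R0 N where N: "0 \<le> N" and
    "\<forall>x m. x \<in> int_vecs \<Lambda> \<longrightarrow> 0 \<le> x \<longrightarrow> g (dim_class \<Lambda> x m) = dim_class \<Omega> (gmv \<Lambda> \<Omega> R0 x) (m + N)" by (elim exE conjE)
  then have R0: "g (dim_class \<Lambda> x m) = dim_class \<Omega> (gmv \<Lambda> \<Omega> R0 x) (m + N)" if "x \<in> int_vecs \<Lambda>" "0 \<le> x" for x m
    using that by simp
  let ?g = "\<lambda>x. gmv \<Lambda> \<Omega> R0 x"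
  \<comment> \<open>One class has two representatives: the basis vector at level
    \<open>- basis_vec i\<close> and its image under the matrix at level zero. Computing
    \<open>g\<close> on both compares the two products in the limit.\<close>
  have "\<exists>q. vec_mat \<Omega> (?g (vec_mat \<Lambda> (basis_vec u) (basis_vec i))) q = vec_mat \<Omega> (vec_mat \<Omega> (?g (basis_vec u)) (basis_vec i)) q"
    if u: "u \<in> vertices \<Lambda>" for u i
  proof (rule dim_class_eq_same[OF assms(2) mv_vecs O.vec_mat_vecs])
    have b: "(basis_vec u :: 'a \<Rightarrow> int) \<in> int_vecs \<Lambda>" "0 \<le> (basis_vec u :: 'a \<Rightarrow> int)"
      using L.basis_vec_int_vecs[OF u] L.basis_vec_nonneg by blast+
    have e: "- basis_vec i + to_int (basis_vec i) = 0" "- basis_vec i + N + to_int (basis_vec i) = N" by simp_all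
    have "dim_class \<Omega> (?g (vec_mat \<Lambda> (basis_vec u) (basis_vec i))) N =
      g (dim_class \<Lambda> (vec_mat \<Lambda> (basis_vec u) (basis_vec i)) 0)"
      using R0[OF L.vec_mat_vecs L.vec_mat_nonneg[OF b(2)], of "basis_vec i" 0] by simp
    also have "dim_class \<Lambda> (vec_mat \<Lambda> (basis_vec u) (basis_vec i)) 0 = dim_class \<Lambda> (basis_vec u) (- basis_vec i)"
      using L.dim_class_lift_nat[OF b(1), of "basis_vec i" "- basis_vec i"] unfolding e .
    also have "g (dim_class \<Lambda> (basis_vec u) (- basis_vec i)) = dim_class \<Omega> (?g (basis_vec u)) (- basis_vec i + N)"
      by (rule R0[OF b])
    also have "\<dots> = dim_class \<Omega> (vec_mat \<Omega> (?g (basis_vec u)) (basis_vec i)) N"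
      using O.dim_class_lift_nat[OF mv_vecs, of _ R0 "basis_vec u" "basis_vec i" "- basis_vec i + N"] unfolding e by (rule HOL.sym)
    finally show "dim_class \<Omega> (?g (vec_mat \<Lambda> (basis_vec u) (basis_vec i))) N =
      dim_class \<Omega> (vec_mat \<Omega> (?g (basis_vec u)) (basis_vec i)) N" .
  qed
  \<comment> \<open>Vertices and directions form a finite index set, so a single power works for all
    equations at once.\<close>
  then have "\<exists>q. \<forall>z\<in>vertices \<Lambda> \<times> (UNIV :: 'b set). vec_mat \<Omega> (?g (vec_mat \<Lambda> (basis_vec (fst z)) (basis_vec (snd z)))) q =
    vec_mat \<Omega> (vec_mat \<Omega> (?g (basis_vec (fst z))) (basis_vec (snd z))) q"
    using L.finite_vertices by (intro finite_common_power[OF assms(2)]) auto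
  then obtain q where q: "vec_mat \<Omega> (?g (vec_mat \<Lambda> (basis_vec u) (basis_vec i))) q =
    vec_mat \<Omega> (vec_mat \<Omega> (?g (basis_vec u)) (basis_vec i)) q" if "u \<in> vertices \<Lambda>" for u i by force
  \<comment> \<open>The correcting power of the target matrices commutes with each of them, so the
    equations after the power become exact intertwining relations for the product.\<close>
  define R where "R u b = (\<Sum>c\<in>vertices \<Omega>. R0 u c * adj_mat \<Omega> q c b)" for u b
  have R: "gmv \<Lambda> \<Omega> R x = vec_mat \<Omega> (?g x) q" for x
    unfolding mv_vec_mat mv_mv R_def ..
  have "intertwines \<Lambda> \<Omega> R"
  proof (rule intertwinesI[OF L.finite_vertices])
    fix i u assume u: "u \<in> vertices \<Lambda>"
    show "gmv \<Lambda> \<Omega> R (vec_mat \<Lambda> (basis_vec u) (basis_vec i)) = vec_mat \<Omega> (gmv \<Lambda> \<Omega> R (basis_vec u)) (basis_vec i)"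
      unfolding R q[OF u] O.vec_mat_vec_mat by (simp only: add.commute)
  qed
  moreover have "g (dim_class \<Lambda> x m) = dim_class \<Omega> (gmv \<Lambda> \<Omega> R x) (m + to_int (to_nat N + q))"
    if "x \<in> int_vecs \<Lambda>" "0 \<le> x" for x m
  proof -
    have e: "m + to_int (to_nat N + q) = m + N + to_int q" using N by (simp add: to_int_to_nat add.assoc)
    show ?thesis unfolding R0[OF that] R e by (rule O.dim_class_lift_nat[OF mv_vecs, symmetric])
  qed
  ultimately show ?thesis by blast
qed

text \<open>The identities for the inverse are checked after applying \<open>g\<close>, which is
  injective on the cone.\<close>

lemma pos_hom_inverse:
  assumes "finite_kgraph \<Lambda>" and g: "pos_hom \<Lambda> \<Omega> g" and bij: "bij_betw g (dim_pos \<Lambda>) (dim_pos \<Omega>)"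
  shows "pos_hom \<Omega> \<Lambda> (inv_into (dim_pos \<Lambda>) g)"
proof -
  interpret L: finite_kgraph \<Lambda> by fact
  let ?h = "inv_into (dim_pos \<Lambda>) g"
  have inj: "inj_on g (dim_pos \<Lambda>)" using bij by (simp add: bij_betw_def)
  have h: "?h P \<in> dim_pos \<Lambda>" "g (?h P) = P" if "P \<in> dim_pos \<Omega>" for P
    using that bij by (simp_all add: bij_betw_def inv_into_into f_inv_into_f)
  have hg: "?h (g P) = P" if "P \<in> dim_pos \<Lambda>" for P using inv_into_f_f[OF inj that] .
  show ?thesis unfolding pos_hom_def
  proof (intro conjI ballI allI)
    fix P Q assume P: "P \<in> dim_pos \<Omega>" and Q: "Q \<in> dim_pos \<Omega>"
    have "g (?h P \<otimes>\<^bsub>dim_group \<Lambda>\<^esub> ?h Q) = P \<otimes>\<^bsub>dim_group \<Omega>\<^esub> Q"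
      using g h[OF P] h[OF Q] unfolding pos_hom_def by metis
    then show "?h (P \<otimes>\<^bsub>dim_group \<Omega>\<^esub> Q) = ?h P \<otimes>\<^bsub>dim_group \<Lambda>\<^esub> ?h Q"
      using hg[OF L.dim_pos_mult[OF h(1)[OF P] h(1)[OF Q]]] by metis
  next
    fix m P assume P: "P \<in> dim_pos \<Omega>"
    have "g (dim_act \<Lambda> m (?h P)) = dim_act \<Omega> m P" using g h[OF P] unfolding pos_hom_def by metis
    then show "?h (dim_act \<Omega> m P) = dim_act \<Lambda> m (?h P)" using hg[OF L.dim_act_pos[OF h(1)[OF P]]] by metis
  qed (use h in blast)
qed

definition shift_equiv :: "('a, 'k) kgr \<Rightarrow> ('b, 'k) kgr \<Rightarrow> ('k \<Rightarrow> nat) \<Rightarrow> ('a \<Rightarrow> 'b \<Rightarrow> nat) \<Rightarrow> ('b \<Rightarrow> 'a \<Rightarrow> nat) \<Rightarrow> bool" where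
  "shift_equiv \<Lambda> \<Omega> p R S \<longleftrightarrow> mat_factor \<Lambda> \<Omega> p R S \<and> mat_factor \<Omega> \<Lambda> p S R \<and>
    intertwines \<Lambda> \<Omega> R \<and> intertwines \<Omega> \<Lambda> S"

text \<open>That \<open>h\<close> inverts \<open>g\<close> says that a basis class at level zero
  equals its image under both matrices at level \<open>n + n'\<close>. Lifting the basis class to
  that level leaves two vectors with equal class there, hence equal after some power; finitely many
  vertices share one.\<close>

lemma inverse_power:
  assumes "finite_kgraph \<Lambda>" "finite_kgraph \<Omega>"
    and gh: "\<forall>P\<in>dim_pos \<Lambda>. h (g P) = P"
    and g: "\<forall>x m. x \<in> int_vecs \<Lambda> \<longrightarrow> 0 \<le> x \<longrightarrow> g (dim_class \<Lambda> x m) = dim_class \<Omega> (gmv \<Lambda> \<Omega> R x) (m + to_int n)"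
    and h: "\<forall>x m. x \<in> int_vecs \<Omega> \<longrightarrow> 0 \<le> x \<longrightarrow> h (dim_class \<Omega> x m) = dim_class \<Lambda> (gmv \<Omega> \<Lambda> S x) (m + to_int n')"
  shows "\<exists>q. \<forall>u\<in>vertices \<Lambda>. vec_mat \<Lambda> (gmv \<Omega> \<Lambda> S (gmv \<Lambda> \<Omega> R (basis_vec u))) q =
    vec_mat \<Lambda> (basis_vec u) (n + n' + q)"
proof -
  interpret L: finite_kgraph \<Lambda> by fact
  interpret O: finite_kgraph \<Omega> by fact
  have single: "\<exists>q. vec_mat \<Lambda> (gmv \<Omega> \<Lambda> S (gmv \<Lambda> \<Omega> R (basis_vec u))) q = vec_mat \<Lambda> (vec_mat \<Lambda> (basis_vec u) (n + n')) q"
    if u: "u \<in> vertices \<Lambda>" for u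
  proof (rule dim_class_eq_same[OF assms(1) mv_vecs L.vec_mat_vecs])
    have b: "(basis_vec u :: 'a \<Rightarrow> int) \<in> int_vecs \<Lambda>" "0 \<le> (basis_vec u :: 'a \<Rightarrow> int)"
      using L.basis_vec_int_vecs[OF u] L.basis_vec_nonneg by blast+
    have e: "0 + to_int n + to_int n' = 0 + to_int (n + n')" by simp
    have "dim_class \<Lambda> (gmv \<Omega> \<Lambda> S (gmv \<Lambda> \<Omega> R (basis_vec u))) (0 + to_int n + to_int n') =
      h (dim_class \<Omega> (gmv \<Lambda> \<Omega> R (basis_vec u)) (0 + to_int n))"
      using h mv_vecs[of "vertices \<Lambda>" \<Omega> R "basis_vec u"] mv_nonneg[OF b(2), of "vertices \<Lambda>" "vertices \<Omega>" R] by metis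
    also have "\<dots> = h (g (dim_class \<Lambda> (basis_vec u) 0))" using g b by metis
    also have "\<dots> = dim_class \<Lambda> (basis_vec u) 0" by (rule bspec[OF gh L.dim_class_pos[OF b]])
    also have "\<dots> = dim_class \<Lambda> (vec_mat \<Lambda> (basis_vec u) (n + n')) (0 + to_int (n + n'))"
      by (rule L.dim_class_lift_nat[OF b(1), symmetric])
    finally show "dim_class \<Lambda> (gmv \<Omega> \<Lambda> S (gmv \<Lambda> \<Omega> R (basis_vec u))) (0 + to_int n + to_int n') =
      dim_class \<Lambda> (vec_mat \<Lambda> (basis_vec u) (n + n')) (0 + to_int n + to_int n')" unfolding e .
  qed
  have "\<exists>q. \<forall>u\<in>vertices \<Lambda>. vec_mat \<Lambda> (gmv \<Omega> \<Lambda> S (gmv \<Lambda> \<Omega> R (basis_vec u))) q =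
    vec_mat \<Lambda> (vec_mat \<Lambda> (basis_vec u) (n + n')) q"
    by (rule finite_common_power[OF assms(1) L.finite_vertices single])
  then show ?thesis unfolding L.vec_mat_vec_mat .
qed

text \<open>The two products agree with adjacency matrices only after multiplication by powers
  \<open>q1\<close> and \<open>q2\<close>. Appending the power \<open>q1 + q2\<close> to
  \<open>S\<close> alone corrects both.\<close>

lemma pos_iso_shift_equiv:
  assumes "finite_kgraph \<Lambda>" "finite_kgraph \<Omega>" and g: "pos_hom \<Lambda> \<Omega> g"
    and bij: "bij_betw g (dim_pos \<Lambda>) (dim_pos \<Omega>)"
  shows "\<exists>R S p. shift_equiv \<Lambda> \<Omega> p R S"
proof -
  interpret L: finite_kgraph \<Lambda> by fact
  interpret O: finite_kgraph \<Omega> by fact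
  let ?h = "inv_into (dim_pos \<Lambda>) g"
  have h: "pos_hom \<Omega> \<Lambda> ?h" by (rule pos_hom_inverse[OF assms(1) g bij])
  have hg: "\<forall>P\<in>dim_pos \<Lambda>. ?h (g P) = P" using bij by (simp add: bij_betw_def)
  have gh: "\<forall>P\<in>dim_pos \<Omega>. g (?h P) = P" using bij by (simp add: bij_betw_def f_inv_into_f)
  obtain R n where R: "intertwines \<Lambda> \<Omega> R"
    "\<forall>x m. x \<in> int_vecs \<Lambda> \<longrightarrow> 0 \<le> x \<longrightarrow> g (dim_class \<Lambda> x m) = dim_class \<Omega> (gmv \<Lambda> \<Omega> R x) (m + to_int n)"
    using pos_hom_intertwiner[OF assms(1,2) g] by (elim exE conjE)
  obtain S n' where S: "intertwines \<Omega> \<Lambda> S"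
    "\<forall>x m. x \<in> int_vecs \<Omega> \<longrightarrow> 0 \<le> x \<longrightarrow> ?h (dim_class \<Omega> x m) = dim_class \<Lambda> (gmv \<Omega> \<Lambda> S x) (m + to_int n')"
    using pos_hom_intertwiner[OF assms(2,1) h] by (elim exE conjE)
  obtain q1 where q1: "\<forall>u\<in>vertices \<Lambda>. vec_mat \<Lambda> (gmv \<Omega> \<Lambda> S (gmv \<Lambda> \<Omega> R (basis_vec u))) q1 =
    vec_mat \<Lambda> (basis_vec u) (n + n' + q1)"
    using inverse_power[OF assms(1,2) hg R(2) S(2)] by (elim exE)
  obtain q2 where q2: "\<forall>u\<in>vertices \<Omega>. vec_mat \<Omega> (gmv \<Lambda> \<Omega> R (gmv \<Omega> \<Lambda> S (basis_vec u))) q2 =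
    vec_mat \<Omega> (basis_vec u) (n' + n + q2)"
    using inverse_power[OF assms(2,1) gh S(2) R(2)] by (elim exE)
  \<comment> \<open>The lag \<open>?p\<close> consists of the level shifts \<open>n\<close> and
    \<open>n'\<close> of the two maps and of the powers that make either product exact.\<close>
  let ?q = "q1 + q2" and ?p = "n + n' + (q1 + q2)"
  define S' where "S' b u = (\<Sum>v\<in>vertices \<Lambda>. S b v * adj_mat \<Lambda> ?q v u)" for b u
  have S': "gmv \<Omega> \<Lambda> S' y = vec_mat \<Lambda> (gmv \<Omega> \<Lambda> S y) ?q" for y
    unfolding mv_vec_mat mv_mv S'_def ..
  have "mat_factor \<Lambda> \<Omega> ?p R S'"
  proof (rule mat_factorI[OF L.finite_vertices])
    fix u assume u: "u \<in> vertices \<Lambda>"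
    have "gmv \<Omega> \<Lambda> S' (gmv \<Lambda> \<Omega> R (basis_vec u)) = vec_mat \<Lambda> (vec_mat \<Lambda> (gmv \<Omega> \<Lambda> S (gmv \<Lambda> \<Omega> R (basis_vec u))) q1) q2"
      unfolding S' L.vec_mat_vec_mat ..
    also have "\<dots> = vec_mat \<Lambda> (basis_vec u) ?p" unfolding bspec[OF q1 u] L.vec_mat_vec_mat by (simp only: add.assoc)
    finally show "gmv \<Omega> \<Lambda> S' (gmv \<Lambda> \<Omega> R (basis_vec u)) = vec_mat \<Lambda> (basis_vec u) ?p" .
  qed
  moreover have "mat_factor \<Omega> \<Lambda> ?p S' R"
  proof (rule mat_factorI[OF O.finite_vertices])
    fix u assume u: "u \<in> vertices \<Omega>"
    \<comment> \<open>In the second product the appended power stands between \<open>S\<close> and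
      \<open>R\<close>; exact intertwining carries it past \<open>R\<close>.\<close>
    have "gmv \<Lambda> \<Omega> R (gmv \<Omega> \<Lambda> S' (basis_vec u)) = vec_mat \<Omega> (gmv \<Lambda> \<Omega> R (gmv \<Omega> \<Lambda> S (basis_vec u))) ?q"
      unfolding S' by (rule intertwines_all[OF assms(1,2) R(1) mv_vecs])
    also have "\<dots> = vec_mat \<Omega> (vec_mat \<Omega> (gmv \<Lambda> \<Omega> R (gmv \<Omega> \<Lambda> S (basis_vec u))) q2) q1"
      unfolding O.vec_mat_vec_mat by (simp only: add.commute)
    also have "\<dots> = vec_mat \<Omega> (basis_vec u) ?p" unfolding bspec[OF q2 u] O.vec_mat_vec_mat by (simp only: add_ac)
    finally show "gmv \<Lambda> \<Omega> R (gmv \<Omega> \<Lambda> S' (basis_vec u)) = vec_mat \<Omega> (basis_vec u) ?p" .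
  qed
  moreover have "intertwines \<Omega> \<Lambda> S'"
  proof (rule intertwinesI[OF O.finite_vertices])
    fix i u
    show "gmv \<Omega> \<Lambda> S' (vec_mat \<Omega> (basis_vec u) (basis_vec i)) = vec_mat \<Lambda> (gmv \<Omega> \<Lambda> S' (basis_vec u)) (basis_vec i)"
      unfolding S' intertwines_basis[OF S(1)] L.vec_mat_vec_mat by (simp only: add.commute)
  qed
  ultimately show ?thesis unfolding shift_equiv_def using R(1) by blast
qed

section \<open>Dimension groups and shift equivalence\<close>

text \<open>The \<delta> are the actions of the negative basis vectors, hence generate those of all
  negative degrees; a general degree is a difference, and its positive part is removed by inverting
  an action.\<close>

lemma dim_group_iso_iff:
  fixes \<Lambda> :: "('a, 'k::finite) kgr" and \<Omega> :: "('b, 'k) kgr"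
  assumes "finite_kgraph \<Lambda>" "finite_kgraph \<Omega>"
  shows "dim_group_iso \<Lambda> \<Omega> \<phi> \<longleftrightarrow> \<phi> \<in> iso (dim_group \<Lambda>) (dim_group \<Omega>) \<and> \<phi> ` dim_pos \<Lambda> = dim_pos \<Omega> \<and>
    (\<forall>m. \<forall>h\<in>carrier (dim_group \<Lambda>). \<phi> (dim_act \<Lambda> m h) = dim_act \<Omega> m (\<phi> h))"
proof -
  interpret L: finite_kgraph \<Lambda> by fact
  interpret O: finite_kgraph \<Omega> by fact
  have "(\<forall>i. \<forall>h\<in>carrier (dim_group \<Lambda>). \<phi> (dim_delta \<Lambda> i h) = dim_delta \<Omega> i (\<phi> h)) \<longleftrightarrow>
    (\<forall>m. \<forall>h\<in>carrier (dim_group \<Lambda>). \<phi> (dim_act \<Lambda> m h) = dim_act \<Omega> m (\<phi> h))"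
    if iso: "\<phi> \<in> iso (dim_group \<Lambda>) (dim_group \<Omega>)"
  proof
    have \<phi>: "\<phi> h \<in> carrier (dim_group \<Omega>)" if "h \<in> carrier (dim_group \<Lambda>)" for h
      using iso that by (auto simp: iso_def hom_def)
    {
      assume *: "\<forall>i. \<forall>h\<in>carrier (dim_group \<Lambda>). \<phi> (dim_delta \<Lambda> i h) = dim_delta \<Omega> i (\<phi> h)"
      have neg: "\<phi> (dim_act \<Lambda> (- to_int q) h) = dim_act \<Omega> (- to_int q) (\<phi> h)" if "h \<in> carrier (dim_group \<Lambda>)" for q h
        using that
      proof (induction q arbitrary: h rule: fun_nat_induct)
        case zero
        show ?case
          by (simp only: to_int_simps(1) minus_zero L.dim_act_0[OF zero] O.dim_act_0[OF \<phi>[OF zero]])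
      next
        case (step q i)
        have e: "- to_int (basis_vec i + q) = - to_int q + - basis_vec i" by simp
        have "\<phi> (dim_act \<Lambda> (- to_int q) (dim_act \<Lambda> (- basis_vec i) h)) = dim_act \<Omega> (- to_int q) (\<phi> (dim_act \<Lambda> (- basis_vec i) h))"
          by (rule step.IH[OF L.dim_act_carrier[OF step.prems]])
        also have "\<phi> (dim_act \<Lambda> (- basis_vec i) h) = dim_act \<Omega> (- basis_vec i) (\<phi> h)"
          using * step.prems L.dim_delta_act[OF step.prems] O.dim_delta_act[OF \<phi>[OF step.prems]] by metis
        finally show ?case unfolding e L.dim_act_add[OF step.prems] O.dim_act_add[OF \<phi>[OF step.prems]] .
      qed
      show "\<forall>m. \<forall>h\<in>carrier (dim_group \<Lambda>). \<phi> (dim_act \<Lambda> m h) = dim_act \<Omega> m (\<phi> h)"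
      proof (intro allI ballI)
        fix m :: "'k \<Rightarrow> int" and h assume h: "h \<in> carrier (dim_group \<Lambda>)"
        \<comment> \<open>Positive and negative part of \<open>m\<close>. Acting by the negative of
          \<open>a\<close> on the action of \<open>m\<close> gives that of the negative of
          \<open>b\<close>, and both negatives are covered by the induction.\<close>
        define a where "a = to_nat m"
        define b where "b = to_nat (- m)"
        have m: "m = to_int a + - to_int b"
          by (rule ext) (simp add: a_def b_def to_int_def to_nat_def)
        have "dim_act \<Lambda> (- to_int a) (dim_act \<Lambda> m h) = dim_act \<Lambda> (- to_int b) h"
          unfolding L.dim_act_add[OF h] by (simp add: m)
        then have "dim_act \<Omega> (- to_int a) (\<phi> (dim_act \<Lambda> m h)) = dim_act \<Omega> (- to_int b) (\<phi> h)"
          using neg[OF L.dim_act_carrier[OF h]] neg[OF h] by metis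
        then have "dim_act \<Omega> (to_int a) (dim_act \<Omega> (- to_int a) (\<phi> (dim_act \<Lambda> m h))) = dim_act \<Omega> m (\<phi> h)"
          unfolding m using O.dim_act_add[OF \<phi>[OF h]] by metis
        moreover have "dim_act \<Omega> (to_int a) (dim_act \<Omega> (- to_int a) (\<phi> (dim_act \<Lambda> m h))) = \<phi> (dim_act \<Lambda> m h)"
          using O.dim_act_add[OF \<phi>[OF L.dim_act_carrier[OF h]]] O.dim_act_0[OF \<phi>[OF L.dim_act_carrier[OF h]]]
          by (metis add.right_inverse)
        ultimately show "\<phi> (dim_act \<Lambda> m h) = dim_act \<Omega> m (\<phi> h)" by metis
      qed
    next
      assume *: "\<forall>m. \<forall>h\<in>carrier (dim_group \<Lambda>). \<phi> (dim_act \<Lambda> m h) = dim_act \<Omega> m (\<phi> h)"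
      show "\<forall>i. \<forall>h\<in>carrier (dim_group \<Lambda>). \<phi> (dim_delta \<Lambda> i h) = dim_delta \<Omega> i (\<phi> h)"
        using * L.dim_delta_act O.dim_delta_act[OF \<phi>] by metis
    }
  qed
  then show ?thesis unfolding dim_group_iso_def by blast
qed

text \<open>Right multiplication by \<open>R\<close> at a fixed level is well defined because
  \<open>R\<close> intertwines. Right multiplication by \<open>S\<close> with the level raised by
  \<open>p\<close> inverts it, since the products of \<open>R\<close> and \<open>S\<close> are the
  matrices of degree \<open>p\<close>. Both matrices are nonnegative, so cones correspond.\<close>

lemma shift_equiv_dim_group_iso:
  assumes "finite_kgraph \<Lambda>" "finite_kgraph \<Omega>" "shift_equiv \<Lambda> \<Omega> p R S"
  shows "\<exists>\<phi>. dim_group_iso \<Lambda> \<Omega> \<phi>"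
proof -
  interpret L: finite_kgraph \<Lambda> by fact
  interpret O: finite_kgraph \<Omega> by fact
  have RS: "gmv \<Omega> \<Lambda> S (gmv \<Lambda> \<Omega> R x) = vec_mat \<Lambda> x p" for x
    using assms(3) mat_factor_vec unfolding shift_equiv_def by blast
  have SR: "gmv \<Lambda> \<Omega> R (gmv \<Omega> \<Lambda> S y) = vec_mat \<Omega> y p" for y
    using assms(3) mat_factor_vec unfolding shift_equiv_def by blast
  have R: "gmv \<Lambda> \<Omega> R (vec_mat \<Lambda> x q) = vec_mat \<Omega> (gmv \<Lambda> \<Omega> R x) q" if "x \<in> int_vecs \<Lambda>" for x q
    using assms that unfolding shift_equiv_def by (intro intertwines_all) blast+
  define \<phi> where "\<phi> P = (\<Union>(x, n)\<in>P. dim_class \<Omega> (gmv \<Lambda> \<Omega> R x) n)" for P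
  have \<phi>: "\<phi> (dim_class \<Lambda> x n) = dim_class \<Omega> (gmv \<Lambda> \<Omega> R x) n" if x: "x \<in> int_vecs \<Lambda>" for x n
    unfolding \<phi>_def
  proof (rule L.UN_dim_class[OF x])
    fix y m assume y: "y \<in> int_vecs \<Lambda>" and "dim_class \<Lambda> y m = dim_class \<Lambda> x n"
    then obtain l where l: "m \<le> l" "n \<le> l" "vec_mat \<Lambda> y (to_nat (l - m)) = vec_mat \<Lambda> x (to_nat (l - n))"
      unfolding L.dim_class_eq_iff[OF y x] by blast
    have "vec_mat \<Omega> (gmv \<Lambda> \<Omega> R y) (to_nat (l - m)) = vec_mat \<Omega> (gmv \<Lambda> \<Omega> R x) (to_nat (l - n))"
      unfolding R[OF x, symmetric] R[OF y, symmetric] l(3) ..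
    then show "dim_class \<Omega> (gmv \<Lambda> \<Omega> R y) m = dim_class \<Omega> (gmv \<Lambda> \<Omega> R x) n"
      unfolding O.dim_class_eq_iff[OF mv_vecs mv_vecs] using l by blast
  qed
  have carr: "\<phi> P \<in> carrier (dim_group \<Omega>)" if "P \<in> carrier (dim_group \<Lambda>)" for P
    using that \<phi> O.dim_class_carrier[OF mv_vecs] unfolding L.dim_carrier_iff by metis
  have surj: "dim_class \<Omega> y n = \<phi> (dim_class \<Lambda> (gmv \<Omega> \<Lambda> S y) (n + to_int p))" if "y \<in> int_vecs \<Omega>" for y n
    unfolding \<phi>[OF mv_vecs] SR by (rule O.dim_class_lift_nat[OF that, symmetric])
  have "\<phi> \<in> hom (dim_group \<Lambda>) (dim_group \<Omega>)"
  proof (rule homI[OF carr])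
    fix P Q assume "P \<in> carrier (dim_group \<Lambda>)" "Q \<in> carrier (dim_group \<Lambda>)"
    then obtain x y n where *: "x \<in> int_vecs \<Lambda>" "P = dim_class \<Lambda> x n" "y \<in> int_vecs \<Lambda>" "Q = dim_class \<Lambda> y n"
      by (rule L.dim_carrierE2)
    show "\<phi> (P \<otimes>\<^bsub>dim_group \<Lambda>\<^esub> Q) = \<phi> P \<otimes>\<^bsub>dim_group \<Omega>\<^esub> \<phi> Q"
      unfolding *(2,4) L.dim_mult[OF *(1,3)] \<phi>[OF *(1)] \<phi>[OF *(3)] O.dim_mult[OF mv_vecs mv_vecs]
        \<phi>[OF L.int_vecs_add[OF *(1,3)]] mv_add ..
  qed
  moreover have "inj_on \<phi> (carrier (dim_group \<Lambda>))"
  proof (rule inj_onI)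
    fix P Q assume P: "P \<in> carrier (dim_group \<Lambda>)" and Q: "Q \<in> carrier (dim_group \<Lambda>)" and eq: "\<phi> P = \<phi> Q"
    obtain x y n where *: "x \<in> int_vecs \<Lambda>" "P = dim_class \<Lambda> x n" "y \<in> int_vecs \<Lambda>" "Q = dim_class \<Lambda> y n"
      using P Q by (rule L.dim_carrierE2)
    have "dim_class \<Omega> (gmv \<Lambda> \<Omega> R x) n = dim_class \<Omega> (gmv \<Lambda> \<Omega> R y) n"
      using eq unfolding *(2,4) \<phi>[OF *(1)] \<phi>[OF *(3)] .
    from dim_class_eq_same[OF assms(2) mv_vecs mv_vecs this]
    obtain q where "gmv \<Lambda> \<Omega> R (vec_mat \<Lambda> x q) = gmv \<Lambda> \<Omega> R (vec_mat \<Lambda> y q)"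
      unfolding R[OF *(1), symmetric] R[OF *(3), symmetric] by (elim exE)
    \<comment> \<open>Applying \<open>S\<close> turns \<open>R\<close> into the matrix of degree
      \<open>p\<close>, so the original vectors already agree after the power
      \<open>q + p\<close>.\<close>
    from arg_cong[OF this, of "gmv \<Omega> \<Lambda> S"] have e: "vec_mat \<Lambda> x (q + p) = vec_mat \<Lambda> y (q + p)"
      unfolding RS L.vec_mat_vec_mat .
    show "P = Q"
      unfolding *(2,4) L.dim_class_lift_nat[OF *(1), of "q + p", symmetric] L.dim_class_lift_nat[OF *(3), of "q + p", symmetric] e ..
  qed
  moreover have "\<phi> ` carrier (dim_group \<Lambda>) = carrier (dim_group \<Omega>)"
  proof
    show "\<phi> ` carrier (dim_group \<Lambda>) \<subseteq> carrier (dim_group \<Omega>)" using carr by blast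
    show "carrier (dim_group \<Omega>) \<subseteq> \<phi> ` carrier (dim_group \<Lambda>)"
    proof
      fix P assume "P \<in> carrier (dim_group \<Omega>)"
      then obtain y n where "y \<in> int_vecs \<Omega>" "P = dim_class \<Omega> y n" unfolding O.dim_carrier_iff by blast
      then have "P = \<phi> (dim_class \<Lambda> (gmv \<Omega> \<Lambda> S y) (n + to_int p))" using surj by metis
      moreover have "dim_class \<Lambda> (gmv \<Omega> \<Lambda> S y) (n + to_int p) \<in> carrier (dim_group \<Lambda>)"
        by (rule L.dim_class_carrier[OF mv_vecs])
      ultimately show "P \<in> \<phi> ` carrier (dim_group \<Lambda>)" by blast
    qed
  qed
  moreover have "\<phi> ` dim_pos \<Lambda> = dim_pos \<Omega>"
  proof
    show "\<phi> ` dim_pos \<Lambda> \<subseteq> dim_pos \<Omega>"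
    proof (rule image_subsetI)
      fix P assume "P \<in> dim_pos \<Lambda>"
      then obtain x n where x: "x \<in> int_vecs \<Lambda>" "0 \<le> x" "P = dim_class \<Lambda> x n" by (rule L.dim_posE)
      show "\<phi> P \<in> dim_pos \<Omega>" unfolding x(3) \<phi>[OF x(1)] by (rule O.dim_class_pos[OF mv_vecs mv_nonneg[OF x(2)]])
    qed
    show "dim_pos \<Omega> \<subseteq> \<phi> ` dim_pos \<Lambda>"
    proof
      fix P assume "P \<in> dim_pos \<Omega>"
      then obtain y n where y: "y \<in> int_vecs \<Omega>" "0 \<le> y" "P = dim_class \<Omega> y n" by (rule O.dim_posE)
      then have "P = \<phi> (dim_class \<Lambda> (gmv \<Omega> \<Lambda> S y) (n + to_int p))" using surj by metis
      moreover have "dim_class \<Lambda> (gmv \<Omega> \<Lambda> S y) (n + to_int p) \<in> dim_pos \<Lambda>"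
        by (rule L.dim_class_pos[OF mv_vecs mv_nonneg[OF y(2)]])
      ultimately show "P \<in> \<phi> ` dim_pos \<Lambda>" by blast
    qed
  qed
  moreover have "\<forall>m. \<forall>P\<in>carrier (dim_group \<Lambda>). \<phi> (dim_act \<Lambda> m P) = dim_act \<Omega> m (\<phi> P)"
  proof (intro allI ballI)
    fix m P assume P: "P \<in> carrier (dim_group \<Lambda>)"
    obtain x n where x: "x \<in> int_vecs \<Lambda>" "P = dim_class \<Lambda> x n" using P unfolding L.dim_carrier_iff by blast
    show "\<phi> (dim_act \<Lambda> m P) = dim_act \<Omega> m (\<phi> P)"
      unfolding x(2) L.dim_act_class[OF x(1)] \<phi>[OF x(1)] O.dim_act_class[OF mv_vecs] ..
  qed
  ultimately have "dim_group_iso \<Lambda> \<Omega> \<phi>"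
    unfolding dim_group_iso_iff[OF assms(1,2)] iso_def bij_betw_def by (intro CollectI conjI)
  then show ?thesis by blast
qed

lemma dim_group_iso_pos_iso:
  assumes "finite_kgraph \<Lambda>" "finite_kgraph \<Omega>" "dim_group_iso \<Lambda> \<Omega> \<phi>"
  shows "pos_hom \<Lambda> \<Omega> \<phi> \<and> bij_betw \<phi> (dim_pos \<Lambda>) (dim_pos \<Omega>)"
proof -
  interpret L: finite_kgraph \<Lambda> by fact
  interpret O: finite_kgraph \<Omega> by fact
  have \<phi>: "\<phi> \<in> hom (dim_group \<Lambda>) (dim_group \<Omega>)" "inj_on \<phi> (carrier (dim_group \<Lambda>))"
    "\<phi> ` dim_pos \<Lambda> = dim_pos \<Omega>"
    "\<And>m h. h \<in> carrier (dim_group \<Lambda>) \<Longrightarrow> \<phi> (dim_act \<Lambda> m h) = dim_act \<Omega> m (\<phi> h)"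
    using assms(3) unfolding dim_group_iso_iff[OF assms(1,2)] iso_def bij_betw_def by blast+
  have "\<phi> (P \<otimes>\<^bsub>dim_group \<Lambda>\<^esub> Q) = \<phi> P \<otimes>\<^bsub>dim_group \<Omega>\<^esub> \<phi> Q" if "P \<in> dim_pos \<Lambda>" "Q \<in> dim_pos \<Lambda>" for P Q
    using that L.dim_pos_carrier by (intro hom_mult[OF \<phi>(1)]) blast+
  moreover have "inj_on \<phi> (dim_pos \<Lambda>)" using \<phi>(2) L.dim_pos_carrier by (rule inj_on_subset)
  moreover have "\<phi> (dim_act \<Lambda> m P) = dim_act \<Omega> m (\<phi> P)" if "P \<in> dim_pos \<Lambda>" for m P
    using that L.dim_pos_carrier \<phi>(4) by blast
  ultimately show ?thesis unfolding pos_hom_def bij_betw_def using \<phi>(3) by blast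
qed

section \<open>Transport between cones and talented monoids\<close>

text \<open>Conjugation with the two maps \<open>kappa\<close>. Each identity in the target monoid
  is checked in its cone, where \<open>kappa\<close> is injective.\<close>

lemma pos_iso_tal_iso:
  assumes "finite_kgraph \<Lambda>" "finite_kgraph \<Omega>" and g: "pos_hom \<Lambda> \<Omega> g"
    and bij: "bij_betw g (dim_pos \<Lambda>) (dim_pos \<Omega>)"
  shows "\<exists>f. zk_monoid_iso (tal_monoid \<Lambda>) (tal_act \<Lambda>) (tal_monoid \<Omega>) (tal_act \<Omega>) f"
proof -
  interpret L: finite_kgraph \<Lambda> by fact
  interpret O: finite_kgraph \<Omega> by fact
  let ?T = "carrier (tal_monoid \<Lambda>)" and ?T' = "carrier (tal_monoid \<Omega>)"
  define f where "f = inv_into ?T' O.kappa \<circ> (g \<circ> L.kappa)"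
  have inj: "inj_on O.kappa ?T'" using O.kappa_bij by (simp add: bij_betw_def)
  have f_bij: "bij_betw f ?T ?T'"
    unfolding f_def by (intro bij_betw_trans[OF bij_betw_trans[OF L.kappa_bij bij]] bij_betw_inv_into O.kappa_bij)
  have f_T: "f P \<in> ?T'" if "P \<in> ?T" for P using f_bij that by (rule bij_betw_apply)
  have \<kappa>: "L.kappa P \<in> dim_pos \<Lambda>" if "P \<in> ?T" for P using L.kappa_bij that by (rule bij_betw_apply)
  have \<kappa>f: "O.kappa (f P) = g (L.kappa P)" if "P \<in> ?T" for P
  proof -
    have "g (L.kappa P) \<in> O.kappa ` ?T'"
      using O.kappa_bij bij_betw_apply[OF bij \<kappa>[OF that]] by (simp add: bij_betw_def)
    then show ?thesis unfolding f_def o_def by (rule f_inv_into_f)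
  qed
  have eqI: "P = Q" if "P \<in> ?T'" "Q \<in> ?T'" "O.kappa P = O.kappa Q" for P Q
    using inj that by (simp add: inj_on_def)
  have "f (P \<otimes>\<^bsub>tal_monoid \<Lambda>\<^esub> Q) = f P \<otimes>\<^bsub>tal_monoid \<Omega>\<^esub> f Q" if P: "P \<in> ?T" and Q: "Q \<in> ?T" for P Q
  proof (rule eqI[OF f_T[OF L.tal_mult_closed[OF P Q]] O.tal_mult_closed[OF f_T[OF P] f_T[OF Q]]])
    show "O.kappa (f (P \<otimes>\<^bsub>tal_monoid \<Lambda>\<^esub> Q)) = O.kappa (f P \<otimes>\<^bsub>tal_monoid \<Omega>\<^esub> f Q)"
      unfolding \<kappa>f[OF L.tal_mult_closed[OF P Q]] O.kappa_mult[OF f_T[OF P] f_T[OF Q]] \<kappa>f[OF P] \<kappa>f[OF Q] L.kappa_mult[OF P Q]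
      using g \<kappa>[OF P] \<kappa>[OF Q] unfolding pos_hom_def by blast
  qed
  then have "f \<in> hom (tal_monoid \<Lambda>) (tal_monoid \<Omega>)" using f_T by (intro homI)
  moreover have "f \<one>\<^bsub>tal_monoid \<Lambda>\<^esub> = \<one>\<^bsub>tal_monoid \<Omega>\<^esub>"
  proof (rule eqI[OF f_T[OF L.tal_one(1)] O.tal_one(1)])
    show "O.kappa (f \<one>\<^bsub>tal_monoid \<Lambda>\<^esub>) = O.kappa \<one>\<^bsub>tal_monoid \<Omega>\<^esub>"
      unfolding \<kappa>f[OF L.tal_one(1)] L.tal_one(2) O.tal_one(2) by (rule pos_hom_one[OF assms(1-3)])
  qed
  moreover have "f (tal_act \<Lambda> m P) = tal_act \<Omega> m (f P)" if P: "P \<in> ?T" for m P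
  proof (rule eqI[OF f_T[OF L.tal_act_closed[OF P]] O.tal_act_closed[OF f_T[OF P]]])
    show "O.kappa (f (tal_act \<Lambda> m P)) = O.kappa (tal_act \<Omega> m (f P))"
      unfolding \<kappa>f[OF L.tal_act_closed[OF P]] O.kappa_act[OF f_T[OF P]] \<kappa>f[OF P] L.kappa_act[OF P]
      using g \<kappa>[OF P] unfolding pos_hom_def by blast
  qed
  ultimately show ?thesis unfolding zk_monoid_iso_def iso_def using f_bij by blast
qed

text \<open>The same conjugation in the other direction; every positive class is the image of an
  element of the talented monoid, so the identities can be read off there.\<close>

lemma tal_iso_pos_iso:
  assumes "finite_kgraph \<Lambda>" "finite_kgraph \<Omega>"
    and f: "zk_monoid_iso (tal_monoid \<Lambda>) (tal_act \<Lambda>) (tal_monoid \<Omega>) (tal_act \<Omega>) f"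
  shows "\<exists>g. pos_hom \<Lambda> \<Omega> g \<and> bij_betw g (dim_pos \<Lambda>) (dim_pos \<Omega>)"
proof -
  interpret L: finite_kgraph \<Lambda> by fact
  interpret O: finite_kgraph \<Omega> by fact
  let ?T = "carrier (tal_monoid \<Lambda>)" and ?T' = "carrier (tal_monoid \<Omega>)"
  have hom: "f \<in> hom (tal_monoid \<Lambda>) (tal_monoid \<Omega>)" and bij: "bij_betw f ?T ?T'"
    and act: "\<And>m P. P \<in> ?T \<Longrightarrow> f (tal_act \<Lambda> m P) = tal_act \<Omega> m (f P)"
    using f unfolding zk_monoid_iso_def iso_def by blast+
  let ?i = "inv_into ?T L.kappa"
  define g where "g = O.kappa \<circ> (f \<circ> ?i)"
  have g_bij: "bij_betw g (dim_pos \<Lambda>) (dim_pos \<Omega>)"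
    unfolding g_def by (intro bij_betw_trans[OF bij_betw_trans[OF bij_betw_inv_into[OF L.kappa_bij] bij]] O.kappa_bij)
  have i: "?i (L.kappa P) = P" if "P \<in> ?T" for P
    using L.kappa_bij that by (simp add: bij_betw_def)
  have gk: "g (L.kappa P) = O.kappa (f P)" if "P \<in> ?T" for P unfolding g_def o_def i[OF that] ..
  have f_T: "f P \<in> ?T'" if "P \<in> ?T" for P using bij that by (rule bij_betw_apply)
  have surj: "\<exists>M\<in>?T. P = L.kappa M" if "P \<in> dim_pos \<Lambda>" for P
    using L.kappa_bij that unfolding bij_betw_def by blast
  have "g (P \<otimes>\<^bsub>dim_group \<Lambda>\<^esub> Q) = g P \<otimes>\<^bsub>dim_group \<Omega>\<^esub> g Q" if P: "P \<in> dim_pos \<Lambda>" and Q: "Q \<in> dim_pos \<Lambda>" for P Q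
  proof -
    obtain M N where M: "M \<in> ?T" "P = L.kappa M" and N: "N \<in> ?T" "Q = L.kappa N" using surj[OF P] surj[OF Q] by blast
    show ?thesis
      unfolding M(2) N(2) L.kappa_mult[OF M(1) N(1), symmetric] gk[OF M(1)] gk[OF N(1)]
        gk[OF L.tal_mult_closed[OF M(1) N(1)]] hom_mult[OF hom M(1) N(1)]
      by (rule O.kappa_mult[OF f_T[OF M(1)] f_T[OF N(1)]])
  qed
  moreover have "g (dim_act \<Lambda> m P) = dim_act \<Omega> m (g P)" if P: "P \<in> dim_pos \<Lambda>" for m P
  proof -
    obtain M where M: "M \<in> ?T" "P = L.kappa M" using surj[OF P] by blast
    show ?thesis
      unfolding M(2) L.kappa_act[OF M(1), symmetric] gk[OF M(1)] gk[OF L.tal_act_closed[OF M(1)]] act[OF M(1)]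
      by (rule O.kappa_act[OF f_T[OF M(1)]])
  qed
  ultimately have "pos_hom \<Lambda> \<Omega> g" unfolding pos_hom_def using bij_betw_apply[OF g_bij] by blast
  then show ?thesis using g_bij by blast
qed

section \<open>Transport between graded homology and dimension groups\<close>

lemma H0gr_iso_iff:
  assumes "finite_kgraph \<Lambda>" "finite_kgraph \<Omega>"
  shows "H0gr_iso \<Lambda> \<Omega> \<psi> \<longleftrightarrow> \<psi> \<in> iso (H0gr \<Lambda>) (H0gr \<Omega>) \<and> \<psi> ` H0gr_pos \<Lambda> = H0gr_pos \<Omega> \<and>
    (\<forall>m. \<forall>h\<in>carrier (H0gr \<Lambda>). \<psi> (H0gr_act \<Lambda> m h) = H0gr_act \<Omega> m (\<psi> h))"
proof -
  interpret L: finite_kgraph \<Lambda> by fact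
  interpret O: finite_kgraph \<Omega> by fact
  have "gr_module_iso (H0gr \<Lambda>) (H0gr_act \<Lambda>) (H0gr \<Omega>) (H0gr_act \<Omega>) \<psi> \<longleftrightarrow> \<psi> \<in> iso (H0gr \<Lambda>) (H0gr \<Omega>) \<and>
    (\<forall>m. \<forall>h\<in>carrier (H0gr \<Lambda>). \<psi> (H0gr_act \<Lambda> m h) = H0gr_act \<Omega> m (\<psi> h))"
    using L.comm_group_H0gr O.comm_group_H0gr L.H0gr_act_carrier O.H0gr_act_carrier by (rule gr_module_iso_iff)
  then show ?thesis unfolding H0gr_iso_def by blast
qed

lemma equivariant_inv_into:
  assumes bij: "bij_betw \<theta> A B"
    and act: "\<And>h. h \<in> A \<Longrightarrow> a h \<in> A" "\<And>h. h \<in> A \<Longrightarrow> \<theta> (a h) = b (\<theta> h)" and k: "k \<in> B"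
  shows "inv_into A \<theta> (b k) = a (inv_into A \<theta> k)"
proof -
  have k': "inv_into A \<theta> k \<in> A" "\<theta> (inv_into A \<theta> k) = k"
    using bij k by (simp_all add: bij_betw_def inv_into_into f_inv_into_f)
  have "b k = \<theta> (a (inv_into A \<theta> k))" using act(2)[OF k'(1)] k'(2) by simp
  then show ?thesis using inv_into_f_f[of \<theta> A "a (inv_into A \<theta> k)"] bij act(1)[OF k'(1)] by (simp add: bij_betw_def)
qed

text \<open>Conjugation with \<open>theta\<close>, which is an equivariant group isomorphism that
  matches the cones, carries over all three requirements.\<close>

lemma dim_group_iso_imp_H0gr_iso:
  assumes "finite_kgraph \<Lambda>" "finite_kgraph \<Omega>" "dim_group_iso \<Lambda> \<Omega> \<phi>"
  shows "\<exists>\<psi>. H0gr_iso \<Lambda> \<Omega> \<psi>"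
proof -
  interpret L: finite_kgraph \<Lambda> by fact
  interpret O: finite_kgraph \<Omega> by fact
  have \<phi>: "\<phi> \<in> iso (dim_group \<Lambda>) (dim_group \<Omega>)" "\<phi> ` dim_pos \<Lambda> = dim_pos \<Omega>"
    "\<And>m h. h \<in> carrier (dim_group \<Lambda>) \<Longrightarrow> \<phi> (dim_act \<Lambda> m h) = dim_act \<Omega> m (\<phi> h)"
    using assms(3) unfolding dim_group_iso_iff[OF assms(1,2)] by blast+
  let ?C = "carrier (H0gr \<Omega>)"
  let ?i = "inv_into ?C O.theta"
  have grp: "group (H0gr \<Omega>)" using O.comm_group_H0gr by (simp add: comm_group_def)
  have bij: "bij_betw O.theta ?C (carrier (dim_group \<Omega>))" using O.theta_iso by (simp add: iso_def)
  have "?i \<circ> \<phi> \<in> iso (dim_group \<Lambda>) (H0gr \<Omega>)"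
    by (rule iso_set_trans[OF \<phi>(1) group.iso_set_sym[OF grp O.theta_iso]])
  then have iso: "(?i \<circ> \<phi>) \<circ> L.theta \<in> iso (H0gr \<Lambda>) (H0gr \<Omega>)"
    by (rule iso_set_trans[OF L.theta_iso])
  define \<psi> where "\<psi> = (?i \<circ> \<phi>) \<circ> L.theta"
  have \<theta>: "L.theta h \<in> carrier (dim_group \<Lambda>)" if "h \<in> carrier (H0gr \<Lambda>)" for h
    using L.theta_iso that by (auto simp: iso_def hom_def)
  have \<phi>c: "\<phi> h \<in> carrier (dim_group \<Omega>)" if "h \<in> carrier (dim_group \<Lambda>)" for h
    using \<phi>(1) that by (auto simp: iso_def hom_def)
  have \<psi>: "\<psi> h = ?i (\<phi> (L.theta h))" for h by (simp add: \<psi>_def)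
  have pos_c: "H0gr_pos \<Lambda> \<subseteq> carrier (H0gr \<Lambda>)" "H0gr_pos \<Omega> \<subseteq> ?C"
    unfolding L.H0gr_pos_iff subset_iff O.H0gr_pos_iff using L.chain_class_carrier O.chain_class_carrier by blast+
  have "\<psi> ` H0gr_pos \<Lambda> = (\<lambda>h. ?i (\<phi> (L.theta h))) ` H0gr_pos \<Lambda>" unfolding \<psi> ..
  also have "\<dots> = ?i ` (\<phi> ` (L.theta ` H0gr_pos \<Lambda>))" by (simp only: image_image)
  also have "\<dots> = ?i ` (O.theta ` H0gr_pos \<Omega>)" unfolding L.theta_pos \<phi>(2) O.theta_pos ..
  also have "\<dots> = H0gr_pos \<Omega>"
    using bij pos_c(2) by (intro inv_into_image_cancel) (simp_all add: bij_betw_def)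
  finally have pos: "\<psi> ` H0gr_pos \<Lambda> = H0gr_pos \<Omega>" .
  have i: "?i (dim_act \<Omega> m k) = H0gr_act \<Omega> m (?i k)" if k: "k \<in> carrier (dim_group \<Omega>)" for m k
  proof (rule equivariant_inv_into[where a = "H0gr_act \<Omega> m" and b = "dim_act \<Omega> m", OF bij])
    fix h assume h: "h \<in> ?C"
    show "H0gr_act \<Omega> m h \<in> ?C" by (rule O.H0gr_act_carrier[OF h])
    show "O.theta (H0gr_act \<Omega> m h) = dim_act \<Omega> m (O.theta h)" by (rule O.theta_act[OF h])
  qed (rule k)
  have "\<psi> (H0gr_act \<Lambda> m h) = H0gr_act \<Omega> m (\<psi> h)" if h: "h \<in> carrier (H0gr \<Lambda>)" for m h
    unfolding \<psi> L.theta_act[OF h] \<phi>(3)[OF \<theta>[OF h]] by (rule i[OF \<phi>c[OF \<theta>[OF h]]])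
  then show ?thesis using iso pos unfolding H0gr_iso_iff[OF assms(1,2)] \<psi>_def[symmetric] by blast
qed

lemma H0gr_iso_imp_dim_group_iso:
  assumes "finite_kgraph \<Lambda>" "finite_kgraph \<Omega>" "H0gr_iso \<Lambda> \<Omega> \<psi>"
  shows "\<exists>\<phi>. dim_group_iso \<Lambda> \<Omega> \<phi>"
proof -
  interpret L: finite_kgraph \<Lambda> by fact
  interpret O: finite_kgraph \<Omega> by fact
  have \<psi>: "\<psi> \<in> iso (H0gr \<Lambda>) (H0gr \<Omega>)" "\<psi> ` H0gr_pos \<Lambda> = H0gr_pos \<Omega>"
    "\<And>m h. h \<in> carrier (H0gr \<Lambda>) \<Longrightarrow> \<psi> (H0gr_act \<Lambda> m h) = H0gr_act \<Omega> m (\<psi> h)"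
    using assms(3) unfolding H0gr_iso_iff[OF assms(1,2)] by blast+
  let ?C = "carrier (H0gr \<Lambda>)"
  let ?i = "inv_into ?C L.theta"
  have grp: "group (H0gr \<Lambda>)" using L.comm_group_H0gr by (simp add: comm_group_def)
  have bij: "bij_betw L.theta ?C (carrier (dim_group \<Lambda>))" using L.theta_iso by (simp add: iso_def)
  have "\<psi> \<circ> ?i \<in> iso (dim_group \<Lambda>) (H0gr \<Omega>)"
    by (rule iso_set_trans[OF group.iso_set_sym[OF grp L.theta_iso] \<psi>(1)])
  then have iso: "O.theta \<circ> (\<psi> \<circ> ?i) \<in> iso (dim_group \<Lambda>) (dim_group \<Omega>)"
    by (rule iso_set_trans[OF _ O.theta_iso])
  define \<phi> where "\<phi> = O.theta \<circ> (\<psi> \<circ> ?i)"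
  have \<phi>: "\<phi> k = O.theta (\<psi> (?i k))" for k by (simp add: \<phi>_def)
  have i: "?i k \<in> ?C" if "k \<in> carrier (dim_group \<Lambda>)" for k
    using bij that by (simp add: bij_betw_def inv_into_into)
  have \<psi>c: "\<psi> h \<in> carrier (H0gr \<Omega>)" if "h \<in> ?C" for h using \<psi>(1) that by (auto simp: iso_def hom_def)
  have pos_c: "H0gr_pos \<Lambda> \<subseteq> ?C" unfolding L.H0gr_pos_iff subset_iff using L.chain_class_carrier by blast
  have "\<phi> ` dim_pos \<Lambda> = (\<lambda>k. O.theta (\<psi> (?i k))) ` dim_pos \<Lambda>"
    unfolding \<phi> ..
  also have "\<dots> = O.theta ` (\<psi> ` (?i ` dim_pos \<Lambda>))" by (simp only: image_image)
  also have "?i ` dim_pos \<Lambda> = H0gr_pos \<Lambda>"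
    unfolding L.theta_pos[symmetric] using bij pos_c by (intro inv_into_image_cancel) (simp_all add: bij_betw_def)
  finally have pos: "\<phi> ` dim_pos \<Lambda> = dim_pos \<Omega>" unfolding \<psi>(2) O.theta_pos .
  have "\<phi> (dim_act \<Lambda> m k) = dim_act \<Omega> m (\<phi> k)" if k: "k \<in> carrier (dim_group \<Lambda>)" for m k
  proof -
    have "?i (dim_act \<Lambda> m k) = H0gr_act \<Lambda> m (?i k)"
    proof (rule equivariant_inv_into[where a = "H0gr_act \<Lambda> m" and b = "dim_act \<Lambda> m", OF bij])
      fix h assume h: "h \<in> ?C"
      show "H0gr_act \<Lambda> m h \<in> ?C" by (rule L.H0gr_act_carrier[OF h])
      show "L.theta (H0gr_act \<Lambda> m h) = dim_act \<Lambda> m (L.theta h)" by (rule L.theta_act[OF h])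
    qed (rule k)
    then show ?thesis
      unfolding \<phi>
      using \<psi>(3)[OF i[OF k]] O.theta_act[OF \<psi>c[OF i[OF k]]] by simp
  qed
  then show ?thesis using iso pos unfolding dim_group_iso_iff[OF assms(1,2)] \<phi>_def[symmetric] by blast
qed

text \<open>Each \<open>Theta\<close> sends the class of the indicator of slice zero to the order
  unit, because that indicator is the chain of the all-ones vector. Injectivity of
  \<open>Theta\<close> on the target side gives both directions.\<close>

lemma pointed_iff:
  assumes "finite_kgraph \<Lambda>" "finite_kgraph \<Omega>" "H0gr_iso \<Lambda> \<Omega> \<psi>"
    and eq: "\<forall>h\<in>carrier (H0gr \<Lambda>). \<phi> (Theta \<Lambda> h) = Theta \<Omega> (\<psi> h)"
  shows "\<phi> (dim_unit \<Lambda>) = dim_unit \<Omega> \<longleftrightarrow>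
    \<psi> (H0gr_class \<Lambda> (indicator (ipaths \<Lambda> \<times> {0}))) = H0gr_class \<Omega> (indicator (ipaths \<Omega> \<times> {0}))"
proof -
  interpret L: finite_kgraph \<Lambda> by fact
  interpret O: finite_kgraph \<Omega> by fact
  let ?u = "H0gr_class \<Lambda> (indicator (ipaths \<Lambda> \<times> {0}))" and ?u' = "H0gr_class \<Omega> (indicator (ipaths \<Omega> \<times> {0}))"
  have "\<psi> ?u \<in> carrier (H0gr \<Omega>)"
    using assms(3) L.unit_class_carrier unfolding H0gr_iso_iff[OF assms(1,2)] by (auto simp: iso_def hom_def)
  moreover have inj: "inj_on (Theta \<Omega>) (carrier (H0gr \<Omega>))"
    unfolding O.Theta_eq using O.theta_iso by (simp add: iso_def bij_betw_def)
  ultimately have "Theta \<Omega> (\<psi> ?u) = Theta \<Omega> ?u' \<longleftrightarrow> \<psi> ?u = ?u'"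
    by (intro inj_on_eq_iff[OF inj] O.unit_class_carrier)
  moreover have "\<phi> (dim_unit \<Lambda>) = Theta \<Omega> (\<psi> ?u)"
    using bspec[OF eq L.unit_class_carrier] unfolding L.Theta_unit .
  ultimately show ?thesis unfolding O.Theta_unit by simp
qed

theorem theorem5p4:
  fixes \<Lambda> :: "('a, 'k::finite) kgr" and \<Omega> :: "('b, 'k) kgr"
  assumes "kgraph \<Lambda>" and "kgraph \<Omega>"
    and "row_finite_no_sources \<Lambda>" and "row_finite_no_sources \<Omega>"
    and "finite (vertices \<Lambda>)" and "finite (vertices \<Omega>)"
  shows
    "((\<exists>(R :: 'a \<Rightarrow> 'b \<Rightarrow> nat) (S :: 'b \<Rightarrow> 'a \<Rightarrow> nat) (p :: 'k \<Rightarrow> nat).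
        (\<forall>u \<in> vertices \<Lambda>. \<forall>v \<in> vertices \<Lambda>.
           adj_mat \<Lambda> p u v = (\<Sum>x\<in>vertices \<Omega>. R u x * S x v)) \<and>
        (\<forall>x \<in> vertices \<Omega>. \<forall>y \<in> vertices \<Omega>.
           adj_mat \<Omega> p x y = (\<Sum>u\<in>vertices \<Lambda>. S x u * R u y)) \<and>
        (\<forall>i. \<forall>u \<in> vertices \<Lambda>. \<forall>x \<in> vertices \<Omega>.
           (\<Sum>v\<in>vertices \<Lambda>. adj_mat \<Lambda> (basis_vec i) u v * R v x) =
           (\<Sum>y\<in>vertices \<Omega>. R u y * adj_mat \<Omega> (basis_vec i) y x)) \<and>
        (\<forall>i. \<forall>x \<in> vertices \<Omega>. \<forall>u \<in> vertices \<Lambda>.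
           (\<Sum>y\<in>vertices \<Omega>. adj_mat \<Omega> (basis_vec i) x y * S y u) =
           (\<Sum>v\<in>vertices \<Lambda>. S x v * adj_mat \<Lambda> (basis_vec i) v u)))
      \<longleftrightarrow> (\<exists>\<phi>. dim_group_iso \<Lambda> \<Omega> \<phi>)) \<and>
     ((\<exists>\<phi>. dim_group_iso \<Lambda> \<Omega> \<phi>)
      \<longleftrightarrow> (\<exists>f. zk_monoid_iso (tal_monoid \<Lambda>) (tal_act \<Lambda>) (tal_monoid \<Omega>) (tal_act \<Omega>) f)) \<and>
     ((\<exists>f. zk_monoid_iso (tal_monoid \<Lambda>) (tal_act \<Lambda>) (tal_monoid \<Omega>) (tal_act \<Omega>) f)
      \<longleftrightarrow> (\<exists>\<psi>. H0gr_iso \<Lambda> \<Omega> \<psi>)) \<and>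
     (\<forall>\<phi> \<psi>. dim_group_iso \<Lambda> \<Omega> \<phi> \<and> H0gr_iso \<Lambda> \<Omega> \<psi> \<and>
        (\<forall>h \<in> carrier (H0gr \<Lambda>). \<phi> (Theta \<Lambda> h) = Theta \<Omega> (\<psi> h)) \<longrightarrow>
        (\<phi> (dim_unit \<Lambda>) = dim_unit \<Omega> \<longleftrightarrow>
         \<psi> (H0gr_class \<Lambda> (indicator (ipaths \<Lambda> \<times> {0}))) =
           H0gr_class \<Omega> (indicator (ipaths \<Omega> \<times> {0}))))"
proof -
  have fin: "finite_kgraph \<Lambda>" "finite_kgraph \<Omega>"
    using assms by (simp_all add: finite_kgraph_def finite_kgraph_axioms_def)
  have se_dim: "(\<exists>R S p. shift_equiv \<Lambda> \<Omega> p R S) \<longleftrightarrow> (\<exists>\<phi>. dim_group_iso \<Lambda> \<Omega> \<phi>)"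
    using shift_equiv_dim_group_iso[OF fin] dim_group_iso_pos_iso[OF fin] pos_iso_shift_equiv[OF fin] by blast
  \<comment> \<open>The return from talented monoids to dimension groups passes through shift
    equivalence: the matrices extend the information on the cone to the whole group.\<close>
  have dim_tal: "(\<exists>\<phi>. dim_group_iso \<Lambda> \<Omega> \<phi>) \<longleftrightarrow>
    (\<exists>f. zk_monoid_iso (tal_monoid \<Lambda>) (tal_act \<Lambda>) (tal_monoid \<Omega>) (tal_act \<Omega>) f)"
    using dim_group_iso_pos_iso[OF fin] pos_iso_tal_iso[OF fin] tal_iso_pos_iso[OF fin]
      pos_iso_shift_equiv[OF fin] shift_equiv_dim_group_iso[OF fin] by meson
  have dim_H0: "(\<exists>\<phi>. dim_group_iso \<Lambda> \<Omega> \<phi>) \<longleftrightarrow> (\<exists>\<psi>. H0gr_iso \<Lambda> \<Omega> \<psi>)"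
    using dim_group_iso_imp_H0gr_iso[OF fin] H0gr_iso_imp_dim_group_iso[OF fin] by blast
  have tal_H0: "(\<exists>f. zk_monoid_iso (tal_monoid \<Lambda>) (tal_act \<Lambda>) (tal_monoid \<Omega>) (tal_act \<Omega>) f) \<longleftrightarrow>
    (\<exists>\<psi>. H0gr_iso \<Lambda> \<Omega> \<psi>)"
    using dim_tal dim_H0 by blast
  have pointed: "\<forall>\<phi> \<psi>. dim_group_iso \<Lambda> \<Omega> \<phi> \<and> H0gr_iso \<Lambda> \<Omega> \<psi> \<and>
        (\<forall>h \<in> carrier (H0gr \<Lambda>). \<phi> (Theta \<Lambda> h) = Theta \<Omega> (\<psi> h)) \<longrightarrow>
        (\<phi> (dim_unit \<Lambda>) = dim_unit \<Omega> \<longleftrightarrow>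
         \<psi> (H0gr_class \<Lambda> (indicator (ipaths \<Lambda> \<times> {0}))) =
           H0gr_class \<Omega> (indicator (ipaths \<Omega> \<times> {0})))"
    by (intro allI impI pointed_iff[OF fin]) blast+
  show ?thesis
    by (rule conjI[OF se_dim[unfolded shift_equiv_def mat_factor_def intertwines_def]
      conjI[OF dim_tal conjI[OF tal_H0 pointed]]])
qed

end
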